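(* Let $n\ge 2$, $p>1$, and $q>0$ with $q\notin\{2,4,6,\dots\}$. (i) Let $f\in C_e^\infty(S^{n-1})$ be a positive function such that the Fourier transform of the distribution $\frac{1}{\Gamma(-q/2)}\, f^{p-1}\cdot r^q$ is a positive distribution on $\mathbb{R}^n\setminus\{0\}$. If $g\in C_e^\infty(S^{n-1})$ is a positive function such that $C_qf(\xi)\le C_qg(\xi)$ for every $\xi\in S^{n-1}$, then $\|f\|_{L_p(S^{n-1})}\le \|g\|_{L_p(S^{n-1})}$. (ii) Let $g\in C_e^\infty(S^{n-1})$ be a strictly positive function such that the Fourier transform of $\frac{1}{\Gamma(-q/2)}\, g^{p-1}\cdot r^q$ is not a positive distribution on $\mathbb{R}^n\setminus\{0\}$. Then there exists a strictly positive function $f\in C_e^\infty(S^{n-1})$ such that $C_qf(\xi)\le C_qg(\xi)$ for every $\xi\in S^{n-1}$, but $\|f\|_{L_p(S^{n-1})}>\|g\|_{L_p(S^{n-1})}$.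
   Context: $C_e^\infty(S^{n-1})$ denotes the space of even real-valued infinitely differentiable functions on the unit sphere $S^{n-1}\subset\mathbb{R}^n$. A function $f$ is positive on a set $D$ if $f(x)\ge 0$ for all $x\in D$, and strictly positive if $f(x)>0$ for all $x\in D$. For a function $h$ on $S^{n-1}$ and a real number $s$, $h\cdot r^{s}$ denotes the even function on $\mathbb{R}^n\setminus\{0\}$ given by $(h\cdot r^s)(x)=|x|_2^{s}\,h(x/|x|_2)$, where $|x|_2$ is the Euclidean norm; it is regarded as a Schwartz distribution on $\mathbb{R}^n$. The $q$-cosine transform is $C_qf(\xi)=\int_{S^{n-1}}|(x,\xi)|^q f(x)\,dx$ for $\xi\in S^{n-1}$. The Fourier transform of a test function is $\hat\phi(x)=\int_{\mathbb{R}^n}\phi(\xi)e^{-i(x,\xi)}d\xi$, and of a distribution $h$ is defined by $\langle\hat h,\phi\rangle=\langle h,\hat\phi\rangle$. A distribution is positive on an open set $D\subset\mathbb{R}^n$ if it takes nonnegative values on all nonnegative test functions supported in $D$. The $L_p$ norm is with respect to the standard surface measure on $S^{n-1}$. *)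

theory Defs
  imports "HOL-Analysis.Analysis"
begin

fun dderivs :: "nat \<Rightarrow> ('a::real_normed_vector \<Rightarrow> real) \<Rightarrow> ('a \<Rightarrow> real) set" where
  "dderivs 0 f = {f}"
| "dderivs (Suc k) f = {(\<lambda>x. frechet_derivative g (at x) v) | g v. g \<in> dderivs k f}"

definition Cinf_on :: "'a::real_normed_vector set \<Rightarrow> ('a \<Rightarrow> real) \<Rightarrow> bool" where
  "Cinf_on S f \<longleftrightarrow> (\<forall>k. \<forall>g\<in>dderivs k f. \<forall>x\<in>S. g differentiable (at x))"

text \<open>f is in C_e^infinity(S^{n-1}): even on the sphere and smooth (its 0-homogeneous
  extension is smooth on R^n minus the origin).\<close>
definition Ce_inf :: "('a::euclidean_space \<Rightarrow> real) \<Rightarrow> bool" where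
  "Ce_inf f \<longleftrightarrow> (\<forall>x\<in>sphere 0 1. f (- x) = f x) \<and>
     Cinf_on (- {0}) (\<lambda>x. f (x /\<^sub>R norm x))"

text \<open>Integral over S^{n-1} with respect to the standard surface measure, via the cone
  measure identity: int_S h d sigma = n * int_{B} h(x/|x|) dx.\<close>
definition sphere_integral :: "('a::euclidean_space \<Rightarrow> real) \<Rightarrow> real" where
  "sphere_integral h = real DIM('a) * (LINT x : ball 0 1 | lborel. h (x /\<^sub>R norm x))"

definition Lp_norm_sphere :: "real \<Rightarrow> ('a::euclidean_space \<Rightarrow> real) \<Rightarrow> real" where
  "Lp_norm_sphere p f = (sphere_integral (\<lambda>x. \<bar>f x\<bar> powr p)) powr (1 / p)"

definition cosine_transform :: "real \<Rightarrow> ('a::euclidean_space \<Rightarrow> real) \<Rightarrow> 'a \<Rightarrow> real" where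
  "cosine_transform q f \<xi> = sphere_integral (\<lambda>x. \<bar>x \<bullet> \<xi>\<bar> powr q * f x)"

definition fourier_test :: "('a::euclidean_space \<Rightarrow> real) \<Rightarrow> 'a \<Rightarrow> complex" where
  "fourier_test \<phi> x = (LINT \<xi>|lborel. complex_of_real (\<phi> \<xi>) * cis (- (x \<bullet> \<xi>)))"

definition test_fun :: "'a::euclidean_space set \<Rightarrow> ('a \<Rightarrow> real) \<Rightarrow> bool" where
  "test_fun D \<phi> \<longleftrightarrow> Cinf_on UNIV \<phi> \<and> compact (closure {x. \<phi> x \<noteq> 0})
      \<and> closure {x. \<phi> x \<noteq> 0} \<subseteq> D"

text \<open>Action of the Fourier transform of the distribution h . r^s on a test function:
  <(h r^s)^, phi> = <h r^s, phi^>.\<close>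
definition FT_homog :: "('a::euclidean_space \<Rightarrow> real) \<Rightarrow> real \<Rightarrow> ('a \<Rightarrow> real) \<Rightarrow> complex" where
  "FT_homog h s \<phi> = (LINT x|lborel. complex_of_real (norm x powr s * h (x /\<^sub>R norm x)) * fourier_test \<phi> x)"

definition FT_positive_on :: "'a::euclidean_space set \<Rightarrow> ('a \<Rightarrow> real) \<Rightarrow> real \<Rightarrow> bool" where
  "FT_positive_on D h s \<longleftrightarrow> (\<forall>\<phi>. test_fun D \<phi> \<and> (\<forall>x. 0 \<le> \<phi> x) \<longrightarrow>
      Im (FT_homog h s \<phi>) = 0 \<and> 0 \<le> Re (FT_homog h s \<phi>))"

end

theory Submission
  imports Defs "HOL-Probability.Characteristic_Functions" "HOL-Real_Asymp.Real_Asymp"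
begin

text \<open>
  For a test function \<open>\<phi>\<close> supported away from 0, let
  \<open>M \<phi> \<theta> = \<integral>\<^sub>0\<^sup>\<infinity> r\<^bsup>q+n-1\<^esup> \<phi>^(r \<theta>) dr\<close>. In polar coordinates the Fourier transform of
  \<open>h \<cdot> r\<^sup>q\<close> acts on \<open>\<phi>\<close> as the integral of \<open>h \<cdot> M \<phi>\<close> over the sphere. Writing \<open>|t|\<^sup>q\<close> as a
  superposition of Taylor remainders of cosines and applying Fourier inversion gives
  \<open>C\<^sub>q (M \<phi>) \<xi> = c \<integral>\<^sub>0\<^sup>\<infinity> s\<^bsup>-q-1\<^esup> \<phi>\<^sub>e(s \<xi>) ds\<close>, where \<open>\<phi>\<^sub>e\<close> is the even part of \<open>\<phi>\<close> and \<open>c\<close> has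
  the sign of \<open>\<Gamma>(-q/2)\<close>. So \<open>C\<^sub>q\<close> maps onto the smooth even functions and, being symmetric, is
  injective on them.

  For (i), put \<open>u = g - f\<close> and let \<open>\<phi> \<ge> 0\<close> be \<open>C\<^sub>q u\<close> times a radial bump; by injectivity \<open>M \<phi>\<close> is
  \<open>u\<close> up to a factor with the sign of \<open>c\<close>, so positivity of the Fourier transform yields
  \<open>\<integral> f\<^bsup>p-1\<^esup> u \<ge> 0\<close>, and Young's inequality concludes. For (ii), a violating \<open>\<phi> \<ge> 0\<close> gives
  \<open>u = M \<phi> / \<Gamma>(-q/2)\<close> with \<open>C\<^sub>q u \<ge> 0\<close> and \<open>\<integral> g\<^bsup>p-1\<^esup> u < 0\<close>; take \<open>f = g - \<epsilon> u\<close>.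

  Smoothness of both \<open>C\<^sub>q u\<close> and \<open>M \<phi>\<close> reduces to one fact: \<open>x \<mapsto> \<integral> K(x \<bullet> y) w(y) dy\<close> is smooth
  off 0 for every continuous \<open>K\<close> and test function \<open>w\<close>.
\<close>

subsection \<open>Smoothness calculus\<close>

text \<open>In (i) the function \<open>f\<close> may have zeros, so its power of exponent
  \<open>p - 1\<close> is in general only continuous and need not lie in the range of
  \<open>C\<^sub>q\<close> on smooth functions. The argument therefore represents the smooth
  function \<open>u\<close> as a multiple of \<open>M \<phi>\<close> and uses injectivity in a weak
  form: if \<open>C\<^sub>q w = 0\<close>, then \<open>w\<close> is orthogonal to every continuous
  function.

  Even integers \<open>q\<close> are excluded by the superposition. The weight
  \<open>s^(-1-q)\<close> times the remainder of order \<open>2 k + 2\<close> converges at 0 only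
  for \<open>q < 2 k + 2\<close> and at infinity only for \<open>q > 2 k\<close>, so
  \<open>q\<close> has to lie strictly between two consecutive even integers.

  The obstacle to smoothness is that the kernel \<open>K\<close>, for instance \<open>|t|\<close> to
  the power \<open>q\<close>, may have few derivatives, so differentiation under the integral cannot
  be iterated. All regularity comes from \<open>w\<close>: integration by parts replaces
  \<open>K\<close> by an antiderivative at the price of a derivative of \<open>w\<close> and a
  factor \<open>1 / |x|^2\<close>, and one differentiation in \<open>x\<close> then leads back to
  kernels that are at least continuous.\<close>

lemma frechet_derivative_eq:
  "(f has_derivative f') (at x) \<Longrightarrow> frechet_derivative f (at x) = f'"
  using frechet_derivative_at by blast

text \<open>Coinduction: by induction on \<open>k\<close>, every iterated derivative agrees on
  \<open>S\<close> with a member of \<open>A\<close>. Agreement is asked on \<open>S\<close> only,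
  since \<open>frechet_derivative\<close> is an arbitrary choice where a function is not
  differentiable; openness of \<open>S\<close> lets agreement pass to derivatives.\<close>

lemma Cinf_onI:
  assumes S: "open S" and f: "f \<in> A"
    and diff: "\<And>g x. g \<in> A \<Longrightarrow> x \<in> S \<Longrightarrow> g differentiable (at x)"
    and deriv: "\<And>g v. g \<in> A \<Longrightarrow> \<exists>g'\<in>A. \<forall>x\<in>S. frechet_derivative g (at x) v = g' x"
  shows "Cinf_on S f"
proof -
  have transfer: "(g has_derivative frechet_derivative g' (at x)) (at x)"
    if "g' \<in> A" "\<forall>x\<in>S. g x = g' x" "x \<in> S" for g g' x
  proof -
    have "(g' has_derivative frechet_derivative g' (at x)) (at x)"
      using diff[OF that(1,3)] by (simp add: frechet_derivative_works)
    then show ?thesis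
      by (rule has_derivative_transform_within_open[OF _ S that(3)]) (use that in auto)
  qed
  have "\<exists>g'\<in>A. \<forall>x\<in>S. g x = g' x" if "g \<in> dderivs k f" for k g
    using that
  proof (induction k arbitrary: g)
    case 0
    then show ?case using f by auto
  next
    case (Suc k)
    then obtain h v where g: "g = (\<lambda>x. frechet_derivative h (at x) v)" and h: "h \<in> dderivs k f"
      by auto
    from Suc.IH[OF h] obtain h' where h': "h' \<in> A" "\<forall>x\<in>S. h x = h' x" by auto
    obtain g' where "g' \<in> A" "\<forall>x\<in>S. frechet_derivative h' (at x) v = g' x"
      using deriv[OF h'(1)] by blast
    moreover have "frechet_derivative h (at x) = frechet_derivative h' (at x)" if "x \<in> S" for x
      using transfer[OF h' that] by (rule frechet_derivative_eq)
    ultimately show ?case unfolding g by auto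
  qed
  with transfer have "g differentiable (at x)" if "g \<in> dderivs k f" "x \<in> S" for k g x
    using that unfolding differentiable_def by blast
  then show ?thesis
    unfolding Cinf_on_def by blast
qed

lemma Cinf_on_differentiable: "Cinf_on S f \<Longrightarrow> x \<in> S \<Longrightarrow> f differentiable (at x)"
  unfolding Cinf_on_def by (drule spec[of _ 0]) simp

lemma Cinf_on_has_derivative:
  "Cinf_on S f \<Longrightarrow> x \<in> S \<Longrightarrow> (f has_derivative frechet_derivative f (at x)) (at x)"
  using Cinf_on_differentiable frechet_derivative_works by blast

text \<open>\<open>dderivs\<close> puts each new derivative outermost. Moving one derivative to the
  innermost position is what makes smoothness hereditary.\<close>

lemma dderivs_deriv_subset:
  "dderivs k (\<lambda>x. frechet_derivative f (at x) v) \<subseteq> dderivs (Suc k) f"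
proof (induction k)
  case (Suc k)
  then show ?case by (subst dderivs.simps(2), subst dderivs.simps(2)) blast
qed auto

lemma Cinf_on_deriv: "Cinf_on S f \<Longrightarrow> Cinf_on S (\<lambda>x. frechet_derivative f (at x) v)"
  unfolding Cinf_on_def using dderivs_deriv_subset by blast

lemma Cinf_on_Un: "Cinf_on S f \<Longrightarrow> Cinf_on T f \<Longrightarrow> Cinf_on (S \<union> T) f"
  unfolding Cinf_on_def by blast

text \<open>Derivatives at a point of an open set depend only on the values in that set, so the
  functions agreeing on \<open>S\<close> with a smooth one form a class closed under
  differentiation.\<close>

lemma Cinf_on_cong:
  assumes S: "open S" and g: "Cinf_on S g" and eq: "\<And>x. x \<in> S \<Longrightarrow> f x = g x"
  shows "Cinf_on S f"
proof (rule Cinf_onI[OF S, where A = "{f. \<exists>g. Cinf_on S g \<and> (\<forall>x\<in>S. f x = g x)}"])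
  let ?A = "{f. \<exists>g. Cinf_on S g \<and> (\<forall>x\<in>S. f x = g x)}"
  have *: "(f has_derivative frechet_derivative g (at x)) (at x)"
    if "Cinf_on S g" "\<forall>x\<in>S. f x = g x" "x \<in> S" for f g x
    by (rule has_derivative_transform_within_open[OF Cinf_on_has_derivative[OF that(1,3)] S that(3)])
      (use that in auto)
  show "f \<in> ?A" using g eq by auto
  show "h differentiable (at x)" if "h \<in> ?A" "x \<in> S" for h x
    using that * unfolding differentiable_def by blast
  show "\<exists>g'\<in>?A. \<forall>x\<in>S. frechet_derivative h (at x) v = g' x"
    if h: "h \<in> ?A" for h v
  proof -
    from h obtain g where g: "Cinf_on S g" "\<forall>x\<in>S. h x = g x" by auto
    have "\<forall>x\<in>S. frechet_derivative h (at x) v = frechet_derivative g (at x) v"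
      using frechet_derivative_eq[OF *[OF g]] by simp
    moreover have "(\<lambda>x. frechet_derivative g (at x) v) \<in> ?A"
      using Cinf_on_deriv[OF g(1)] by blast
    ultimately show ?thesis by (rule bexI)
  qed
qed

lemma Cinf_on_const [simp, intro]: "open S \<Longrightarrow> Cinf_on S (\<lambda>x. c)"
  by (rule Cinf_onI[where A = "range (\<lambda>c x. c)"]) auto

text \<open>Sums only: scalar and smooth coefficients are absorbed into the generators, so that no
  closure under multiplication has to be carried through the induction.\<close>

inductive_set add_span :: "('a \<Rightarrow> real) set \<Rightarrow> ('a \<Rightarrow> real) set" for B where
  base: "b \<in> B \<Longrightarrow> b \<in> add_span B"
| add: "f \<in> add_span B \<Longrightarrow> g \<in> add_span B \<Longrightarrow> (\<lambda>x. f x + g x) \<in> add_span B"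

text \<open>It suffices to differentiate generators: their sums are then automatically closed under
  differentiation.\<close>

lemma Cinf_on_add_span:
  assumes S: "open S" and f: "f \<in> add_span B"
    and diff: "\<And>b x. b \<in> B \<Longrightarrow> x \<in> S \<Longrightarrow> b differentiable (at x)"
    and deriv: "\<And>b v. b \<in> B \<Longrightarrow> \<exists>g\<in>add_span B. \<forall>x\<in>S. frechet_derivative b (at x) v = g x"
  shows "Cinf_on S f"
proof (rule Cinf_onI[OF S f])
  have d: "\<forall>x\<in>S. g differentiable (at x)" if "g \<in> add_span B" for g
    using that by induction (auto intro: diff)
  then show "g differentiable (at x)" if "g \<in> add_span B" "x \<in> S" for g x using that by blast
  show "\<exists>g'\<in>add_span B. \<forall>x\<in>S. frechet_derivative g (at x) v = g' x" if "g \<in> add_span B" for g v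
    using that
  proof induction
    case (base b)
    then show ?case by (rule deriv)
  next
    case (add f g)
    then obtain f' g' where fg: "f' \<in> add_span B" "\<forall>x\<in>S. frechet_derivative f (at x) v = f' x"
      "g' \<in> add_span B" "\<forall>x\<in>S. frechet_derivative g (at x) v = g' x" by auto
    have "frechet_derivative (\<lambda>x. f x + g x) (at x) v = f' x + g' x" if "x \<in> S" for x
    proof -
      have "((\<lambda>x. f x + g x) has_derivative
          (\<lambda>v. frechet_derivative f (at x) v + frechet_derivative g (at x) v)) (at x)"
        using d[OF add.hyps(1)] d[OF add.hyps(2)] that
        by (intro has_derivative_add iffD1[OF frechet_derivative_works]) blast+
      from frechet_derivative_eq[OF this] show ?thesis using fg that by auto
    qed
    with add_span.add[OF fg(1,3)] show ?case by (intro bexI[of _ "\<lambda>x. f' x + g' x"]) auto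
  qed
qed

section \<open>Closure of smooth functions under algebraic operations\<close>

lemma Cinf_on_add:
  assumes S: "open S" and fg: "Cinf_on S f" "Cinf_on S g"
  shows "Cinf_on S (\<lambda>x. f x + g x)"
proof (rule Cinf_on_add_span[OF S, where B = "{f. Cinf_on S f}"])
  show "(\<lambda>x. f x + g x) \<in> add_span {f. Cinf_on S f}"
    using fg by (intro add_span.add add_span.base) auto
  show "\<exists>g\<in>add_span {f. Cinf_on S f}. \<forall>x\<in>S. frechet_derivative b (at x) v = g x"
    if "b \<in> {f. Cinf_on S f}" for b v
    using that by (intro bexI[of _ "\<lambda>x. frechet_derivative b (at x) v"] add_span.base CollectI)
      (auto intro: Cinf_on_deriv)
qed (auto intro: Cinf_on_differentiable)

lemma Cinf_on_sum:
  assumes "open S" and "\<And>i. i \<in> I \<Longrightarrow> Cinf_on S (f i)"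
  shows "Cinf_on S (\<lambda>x. \<Sum>i\<in>I. f i x)"
  using assms(2) by (induction I rule: infinite_finite_induct) (auto intro!: Cinf_on_add assms(1))

lemma frechet_derivative_mult_at:
  fixes f g :: "'a::real_normed_vector \<Rightarrow> real"
  assumes "f differentiable (at x)" "g differentiable (at x)"
  shows "frechet_derivative (\<lambda>x. f x * g x) (at x) v =
    frechet_derivative f (at x) v * g x + f x * frechet_derivative g (at x) v"
proof -
  have "((\<lambda>x. f x * g x) has_derivative
     (\<lambda>v. f x * frechet_derivative g (at x) v + frechet_derivative f (at x) v * g x)) (at x)"
    using assms by (intro has_derivative_mult) (auto simp: frechet_derivative_works[symmetric])
  from frechet_derivative_eq[OF this] show ?thesis by simp
qed

lemma Cinf_on_mult:
  assumes S: "open S" and "Cinf_on S f" "Cinf_on S g"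
  shows "Cinf_on S (\<lambda>x. f x * g x)"
proof (rule Cinf_on_add_span[OF S, where B = "{\<lambda>x. f x * g x | f g. Cinf_on S f \<and> Cinf_on S g}"])
  let ?B = "{\<lambda>x. f x * g x | f g. Cinf_on S f \<and> Cinf_on S g}"
  show "(\<lambda>x. f x * g x) \<in> add_span ?B" using assms by (intro add_span.base) auto
  show "h differentiable (at x)" if "h \<in> ?B" "x \<in> S" for h x
    using that by (auto intro!: differentiable_mult intro: Cinf_on_differentiable)
  show "\<exists>g'\<in>add_span ?B. \<forall>x\<in>S. frechet_derivative h (at x) v = g' x" if h: "h \<in> ?B" for h v
  proof -
    from h obtain f g where h: "h = (\<lambda>x. f x * g x)" and fg: "Cinf_on S f" "Cinf_on S g" by auto
    have "(\<lambda>x. frechet_derivative f (at x) v * g x + f x * frechet_derivative g (at x) v) \<in> add_span ?B"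
      by (intro add_span.add add_span.base CollectI; intro exI conjI, rule refl)
        (intro Cinf_on_deriv fg)+
    then show ?thesis
      unfolding h by (rule rev_bexI)
        (use fg in \<open>auto intro!: frechet_derivative_mult_at Cinf_on_differentiable\<close>)
  qed
qed

lemma Cinf_on_cmult: "open S \<Longrightarrow> Cinf_on S f \<Longrightarrow> Cinf_on S (\<lambda>x. c * f x)"
  by (intro Cinf_on_mult) auto

lemma Cinf_on_minus: "open S \<Longrightarrow> Cinf_on S f \<Longrightarrow> Cinf_on S (\<lambda>x. - f x)"
  using Cinf_on_cmult[of S f "-1"] by simp

lemma Cinf_on_diff: "open S \<Longrightarrow> Cinf_on S f \<Longrightarrow> Cinf_on S g \<Longrightarrow> Cinf_on S (\<lambda>x. f x - g x)"
  using Cinf_on_add[of S f "\<lambda>x. - g x"] Cinf_on_minus[of S g] by simp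

lemma Cinf_on_bounded_linear:
  assumes "bounded_linear f" "open S" shows "Cinf_on S f"
proof (rule Cinf_onI[OF \<open>open S\<close>, where A = "insert f (range (\<lambda>c x. c))"])
  show "h differentiable (at x)" if "h \<in> insert f (range (\<lambda>c x. c))" for h x
    using that assms(1) bounded_linear_imp_differentiable by auto
  have "frechet_derivative f (at x) v = f v" for x v
    using frechet_derivative_eq[OF bounded_linear_imp_has_derivative[OF assms(1)]] by simp
  then show "\<exists>g'\<in>insert f (range (\<lambda>c x. c)). \<forall>x\<in>S. frechet_derivative h (at x) v = g' x"
    if "h \<in> insert f (range (\<lambda>c x. c))" for h v
    using that by auto
qed auto

lemma Cinf_on_inner_left: "open S \<Longrightarrow> Cinf_on S (\<lambda>x. x \<bullet> b)"
  by (intro Cinf_on_bounded_linear bounded_linear_inner_left)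

lemma Cinf_on_inner_right: "open S \<Longrightarrow> Cinf_on S (\<lambda>x. b \<bullet> x)"
  by (intro Cinf_on_bounded_linear bounded_linear_inner_right)

text \<open>By the product rule, sums of smooth multiples of members of \<open>B\<close> are closed
  under differentiation as soon as derivatives of members of \<open>B\<close> are such sums. The
  index type \<open>'i\<close> is a parameter because the existential over index sets cannot
  quantify over types.\<close>

lemma Cinf_on_generators:
  fixes B :: "('a::real_normed_vector \<Rightarrow> real) set"
  assumes S: "open S" and f: "f \<in> B"
    and diff: "\<And>b x. b \<in> B \<Longrightarrow> x \<in> S \<Longrightarrow> b differentiable (at x)"
    and deriv: "\<And>b v. b \<in> B \<Longrightarrow> \<exists>I a c. finite (I :: 'i set) \<and> (\<forall>i\<in>I. Cinf_on S (a i) \<and> c i \<in> B) \<and>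
      (\<forall>x\<in>S. frechet_derivative b (at x) v = (\<Sum>i\<in>I. a i x * c i x))"
  shows "Cinf_on S f"
proof -
  let ?B = "{\<lambda>x. a x * b x | a b. Cinf_on S a \<and> b \<in> B}"
  have sum: "(\<lambda>x. \<Sum>i\<in>I. a i x * c i x) \<in> add_span ?B"
    if "finite I" "\<forall>i\<in>I. Cinf_on S (a i) \<and> c i \<in> B" for I :: "'i set" and a c
    using that
  proof (induction I)
    \<comment> \<open>\<open>add_span\<close> has no zero of its own; it is obtained as the zero
      multiple of the generator \<open>f\<close>.\<close>
    case empty
    have "(\<lambda>x. 0 * f x) \<in> ?B"
      by (intro CollectI exI conjI, rule refl) (auto intro: f S)
    from add_span.base[OF this] show ?case by simp
  next
    case (insert i I)
    have "(\<lambda>x. a i x * c i x) \<in> ?B" using insert.prems by auto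
    from add_span.add[OF add_span.base[OF this]] insert show ?case by simp
  qed
  show ?thesis
  proof (rule Cinf_on_add_span[OF S, where B = ?B])
    have "(\<lambda>x. 1 * f x) \<in> ?B"
      by (intro CollectI exI conjI, rule refl) (auto intro: f S)
    from add_span.base[OF this] show "f \<in> add_span ?B" by simp
    show "h differentiable (at x)" if "h \<in> ?B" "x \<in> S" for h x
      using that diff by (auto intro!: differentiable_mult intro: Cinf_on_differentiable)
    show "\<exists>g'\<in>add_span ?B. \<forall>x\<in>S. frechet_derivative h (at x) v = g' x" if h: "h \<in> ?B" for h v
    proof -
      from h obtain k b where h: "h = (\<lambda>x. k x * b x)" and k: "Cinf_on S k" and b: "b \<in> B" by auto
      from deriv[OF b, of v] obtain I a c where I: "finite (I :: 'i set)"
        "\<forall>i\<in>I. Cinf_on S (a i) \<and> c i \<in> B"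
        "\<forall>x\<in>S. frechet_derivative b (at x) v = (\<Sum>i\<in>I. a i x * c i x)" by blast
      have "(\<lambda>x. \<Sum>i\<in>I. (k x * a i x) * c i x) \<in> add_span ?B"
        using I k by (intro sum[of I "\<lambda>i x. k x * a i x"]) (auto intro!: Cinf_on_mult S)
      moreover have "(\<lambda>x. frechet_derivative k (at x) v * b x) \<in> ?B"
        by (intro CollectI exI conjI, rule refl) (intro Cinf_on_deriv k b)+
      ultimately have "(\<lambda>x. frechet_derivative k (at x) v * b x + (\<Sum>i\<in>I. (k x * a i x) * c i x)) \<in> add_span ?B"
        by (intro add_span.add) (auto intro: add_span.base)
      then show ?thesis
        unfolding h
      proof (rule rev_bexI, intro ballI)
        fix x assume "x \<in> S"
        then have "frechet_derivative (\<lambda>x. k x * b x) (at x) v =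
            frechet_derivative k (at x) v * b x + k x * frechet_derivative b (at x) v"
          using k b diff by (intro frechet_derivative_mult_at) (auto intro: Cinf_on_differentiable)
        then show "frechet_derivative (\<lambda>x. k x * b x) (at x) v =
            frechet_derivative k (at x) v * b x + (\<Sum>i\<in>I. (k x * a i x) * c i x)"
          using I(3) \<open>x \<in> S\<close> by (simp add: sum_distrib_left mult.assoc)
      qed
    qed
  qed
qed

subsection \<open>Concrete smooth functions\<close>

text \<open>The powers for all real \<open>s\<close> are treated together. A derivative is written
  with the exponent lowered by 2 rather than 1, which makes the accompanying coefficient
  \<open>s * (x \<bullet> v)\<close> linear in \<open>x\<close>.\<close>

lemma Cinf_on_norm_powr: "Cinf_on (- {0}) (\<lambda>x::'a::real_inner. norm x powr s)"
proof (rule Cinf_on_generators[where B = "range (\<lambda>s (x::'a). norm x powr s)" and 'i = unit])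
  have d: "((\<lambda>x::'a. norm x powr s) has_derivative (\<lambda>v. (s * (x \<bullet> v)) * norm x powr (s - 2))) (at x)"
    if "x \<noteq> 0" for s x
  proof -
    have "((\<lambda>r. r powr s) has_real_derivative s * norm x powr (s - 1)) (at (norm x))"
      using that by (intro has_real_derivative_powr) auto
    from DERIV_compose_FDERIV[OF this has_derivative_norm[OF that]]
    have "((\<lambda>x. norm x powr s) has_derivative (\<lambda>v. v \<bullet> sgn x * (s * norm x powr (s - 1)))) (at x)" .
    moreover
    have "norm x powr (s - 1) = norm x powr (s - 2) * norm x"
      using that powr_add[of "norm x" "s - 2" 1] by simp
    then have "v \<bullet> sgn x * (s * norm x powr (s - 1)) = (s * (x \<bullet> v)) * norm x powr (s - 2)" for v
      using that by (simp add: sgn_div_norm inner_commute field_simps)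
    ultimately show ?thesis by simp
  qed
  show "b differentiable (at x)" if "b \<in> range (\<lambda>s (x::'a). norm x powr s)" "x \<in> - {0}" for b x
    using that d unfolding differentiable_def by auto
  show "\<exists>I a c. finite (I :: unit set) \<and> (\<forall>i\<in>I. Cinf_on (- {0}) (a i) \<and> c i \<in> range (\<lambda>s (x::'a). norm x powr s)) \<and>
      (\<forall>x\<in>- {0}. frechet_derivative b (at x) v = (\<Sum>i\<in>I. a i x * c i x))"
    if "b \<in> range (\<lambda>s (x::'a). norm x powr s)" for b v
  proof -
    from that obtain s where b: "b = (\<lambda>x. norm x powr s)" by auto
    show ?thesis
      unfolding b
      by (rule exI[of _ UNIV], rule exI[of _ "\<lambda>_ x. s * (x \<bullet> v)"],
          rule exI[of _ "\<lambda>_ x. norm x powr (s - 2)"])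
         (auto intro!: Cinf_on_cmult Cinf_on_inner_left simp: frechet_derivative_eq[OF d])
  qed
qed auto

text \<open>Chain rule through the radial projection. All smooth \<open>g\<close> serve as
  generators at once, because the partial derivatives of \<open>g\<close> appear composed with the
  same projection.\<close>

lemma Cinf_on_normalize:
  fixes g :: "'a::euclidean_space \<Rightarrow> real"
  assumes "Cinf_on (- {0}) g"
  shows "Cinf_on (- {0}) (\<lambda>x. g (x /\<^sub>R norm x))"
proof (rule Cinf_on_generators[where B = "{\<lambda>x. g (x /\<^sub>R norm x) | g. Cinf_on (- {0}) g}" and 'i = 'a])
  let ?B = "{\<lambda>x::'a. g (x /\<^sub>R norm x) | g. Cinf_on (- {0}) g}"
  \<comment> \<open>The \<open>b\<close>-component of the derivative of
    \<open>x /\<^sub>R norm x\<close> in direction \<open>v\<close>, that is, of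
    \<open>v / |x| - (x \<bullet> v) x / |x|^3\<close>.\<close>
  define a where "a v b x = (norm x powr (-1)) * (v \<bullet> b) + (- (norm x powr (-3) * (x \<bullet> v))) * (x \<bullet> b)" for v b x :: 'a
  have a: "Cinf_on (- {0}) (a v b)" for v b
    unfolding a_def
    by (intro Cinf_on_add Cinf_on_mult Cinf_on_minus Cinf_on_norm_powr Cinf_on_inner_left) auto
  have d: "((\<lambda>x. g (x /\<^sub>R norm x)) has_derivative
      (\<lambda>v. \<Sum>b\<in>Basis. a v b x * frechet_derivative g (at (x /\<^sub>R norm x)) b)) (at x)"
    if g: "Cinf_on (- {0}) g" and x: "x \<noteq> 0" for g x
  proof -
    let ?D = "frechet_derivative g (at (x /\<^sub>R norm x))"
    have D: "(g has_derivative ?D) (at (x /\<^sub>R norm x))"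
      using x by (intro Cinf_on_has_derivative[OF g]) auto
    have "((\<lambda>x. inverse (norm x)) has_derivative (\<lambda>v. - (inverse (norm x) * (v \<bullet> sgn x) * inverse (norm x)))) (at x)"
      using x by (intro Deriv.has_derivative_inverse has_derivative_norm) auto
    from has_derivative_scaleR[OF this has_derivative_ident]
    have N: "((\<lambda>x. x /\<^sub>R norm x) has_derivative
      (\<lambda>v. inverse (norm x) *\<^sub>R v + (- (inverse (norm x) * (v \<bullet> sgn x) * inverse (norm x))) *\<^sub>R x)) (at x)" .
    have "(\<lambda>v. ?D (inverse (norm x) *\<^sub>R v + (- (inverse (norm x) * (v \<bullet> sgn x) * inverse (norm x))) *\<^sub>R x))
        = (\<lambda>v. \<Sum>b\<in>Basis. a v b x * ?D b)"
    proof
      fix v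
      let ?w = "inverse (norm x) *\<^sub>R v + (- (inverse (norm x) * (v \<bullet> sgn x) * inverse (norm x))) *\<^sub>R x"
      have lin: "linear ?D" using has_derivative_linear[OF D] .
      have "?D ?w = ?D (\<Sum>b\<in>Basis. (?w \<bullet> b) *\<^sub>R b)" by (simp add: euclidean_representation)
      also have "\<dots> = (\<Sum>b\<in>Basis. (?w \<bullet> b) * ?D b)"
        by (simp add: linear_sum[OF lin] linear_cmul[OF lin])
      also have "\<dots> = (\<Sum>b\<in>Basis. a v b x * ?D b)"
      proof (rule sum.cong)
        fix b :: 'a assume "b \<in> Basis"
        have "norm x powr (-3) = inverse (norm x) * inverse (norm x) * inverse (norm x)"
          using x by (simp add: powr_minus powr_numeral power3_eq_cube)
        moreover have "norm x powr (-1) = inverse (norm x)"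
          using x by (simp add: powr_minus)
        ultimately have "?w \<bullet> b = a v b x"
          unfolding a_def inner_add_left inner_scaleR_left
          by (simp add: sgn_div_norm inner_commute algebra_simps)
        then show "(?w \<bullet> b) * ?D b = a v b x * ?D b" by simp
      qed simp
      finally show "?D ?w = (\<Sum>b\<in>Basis. a v b x * ?D b)" .
    qed
    with has_derivative_compose[OF N D] show ?thesis by simp
  qed
  show "(\<lambda>x. g (x /\<^sub>R norm x)) \<in> ?B" using assms by auto
  show "b differentiable (at x)" if "b \<in> ?B" "x \<in> - {0}" for b x
    using that d unfolding differentiable_def by fastforce
  show "\<exists>I a c. finite (I :: 'a set) \<and> (\<forall>i\<in>I. Cinf_on (- {0}) (a i) \<and> c i \<in> ?B) \<and>
      (\<forall>x\<in>- {0}. frechet_derivative h (at x) v = (\<Sum>i\<in>I. a i x * c i x))"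
    if "h \<in> ?B" for h v
  proof -
    from that obtain g where h: "h = (\<lambda>x. g (x /\<^sub>R norm x))" and g: "Cinf_on (- {0}) g" by auto
    show ?thesis
      unfolding h
    proof (intro exI conjI)
      show "finite (Basis :: 'a set)" by simp
      show "\<forall>i\<in>Basis. Cinf_on (- {0}) (a v i) \<and> (\<lambda>x. (\<lambda>y. frechet_derivative g (at y) i) (x /\<^sub>R norm x)) \<in> ?B"
        using a Cinf_on_deriv[OF g] by auto
      show "\<forall>x\<in>- {0}. frechet_derivative (\<lambda>x. g (x /\<^sub>R norm x)) (at x) v =
          (\<Sum>i\<in>Basis. a v i x * frechet_derivative g (at (x /\<^sub>R norm x)) i)"
        using frechet_derivative_eq[OF d[OF g]] by simp
    qed
  qed
qed auto

section \<open>Functions flat at the origin and the radial bump\<close>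

definition flat_exp :: "nat \<Rightarrow> real \<Rightarrow> real" where
  "flat_exp k t = (if t > 0 then inverse t ^ k * exp (- inverse t) else 0)"

lemma power_le_fact_exp: "x \<ge> 0 \<Longrightarrow> x ^ m \<le> fact m * exp (x::real)"
proof -
  assume "x \<ge> 0"
  have "(\<Sum>n\<in>{m}. x ^ n /\<^sub>R fact n) \<le> (\<Sum>n. x ^ n /\<^sub>R fact n)"
    using \<open>x \<ge> 0\<close> by (intro sum_le_suminf summable_exp_generic) auto
  then show ?thesis by (simp add: exp_def field_simps)
qed

text \<open>One Taylor term of the exponential at \<open>1 / t\<close>, of order
  \<open>k + 2\<close>, is compared with the whole series. The quadratic vanishing makes the
  difference quotients at 0 tend to 0.\<close>

lemma flat_exp_le: "\<bar>flat_exp k t\<bar> \<le> fact (k + 2) * t\<^sup>2"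
proof (cases "t > 0")
  case True
  have "inverse t ^ (k + 2) \<le> fact (k + 2) * exp (inverse t)"
    using True by (intro power_le_fact_exp) auto
  with True show ?thesis
    by (simp add: flat_exp_def exp_minus power_add field_simps power2_eq_square)
qed (auto simp: flat_exp_def)

text \<open>The factors \<open>inverse t ^ k\<close> are there so that the family over all
  \<open>k\<close> is closed under differentiation up to sums; at the origin the quadratic bound
  replaces the product rule.\<close>

lemma flat_exp_deriv:
  "(flat_exp k has_real_derivative (- real k * flat_exp (k + 1) t + flat_exp (k + 2) t)) (at t)"
proof -
  consider "t > 0" | "t < 0" | "t = 0" by linarith
  then show ?thesis
  proof cases
    case 1
    have "((\<lambda>t. inverse t ^ k * exp (- inverse t)) has_real_derivative
      (- real k * flat_exp (k + 1) t + flat_exp (k + 2) t)) (at t)"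
    proof -
      have "real k * inverse t ^ (k - 1) * (inverse t * inverse t) = real k * inverse t ^ (k + 1)"
        by (cases k) (auto simp: algebra_simps)
      with 1 show ?thesis
        by (auto intro!: derivative_eq_intros simp: flat_exp_def algebra_simps)
    qed
    then show ?thesis
      by (rule has_field_derivative_transform_within_open[of _ _ _ "{0<..}"]) (use 1 in \<open>auto simp: flat_exp_def\<close>)
  next
    case 2
    have "((\<lambda>t. 0) has_real_derivative (- real k * flat_exp (k + 1) t + flat_exp (k + 2) t)) (at t)"
      using 2 by (simp add: flat_exp_def)
    then show ?thesis
      by (rule has_field_derivative_transform_within_open[of _ _ _ "{..<0}"]) (use 2 in \<open>auto simp: flat_exp_def\<close>)
  next
    case 3
    have "((\<lambda>h. flat_exp k h / h) \<longlongrightarrow> 0) (at 0)"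
    proof (rule Lim_null_comparison)
      show "\<forall>\<^sub>F h in at 0. norm (flat_exp k h / h) \<le> fact (k + 2) * \<bar>h\<bar>"
      proof (rule always_eventually, rule allI)
        fix h :: real
        show "norm (flat_exp k h / h) \<le> fact (k + 2) * \<bar>h\<bar>"
        proof (cases "h = 0")
          case False
          have "\<bar>flat_exp k h\<bar> \<le> fact (k + 2) * \<bar>h\<bar> * \<bar>h\<bar>"
            using flat_exp_le[of k h] by (simp only: power2_eq_square abs_mult_self_eq mult.assoc)
          with False show ?thesis
            unfolding real_norm_def abs_divide by (subst pos_divide_le_eq) auto
        qed simp
      qed
      show "((\<lambda>h. fact (k + 2) * \<bar>h\<bar>) \<longlongrightarrow> (0::real)) (at 0)"
        by (auto intro!: tendsto_eq_intros)
    qed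
    then show ?thesis using 3 by (simp add: DERIV_def flat_exp_def)
  qed
qed

lemma Cinf_on_flat_exp:
  fixes f :: "'a::real_normed_vector \<Rightarrow> real"
  assumes S: "open S" and f: "Cinf_on S f"
  shows "Cinf_on S (\<lambda>x. flat_exp k (f x))"
proof (rule Cinf_on_generators[OF S, where B = "range (\<lambda>k x. flat_exp k (f x))" and 'i = bool])
  let ?B = "range (\<lambda>k x. flat_exp k (f x))"
  have d: "((\<lambda>x. flat_exp k (f x)) has_derivative
      (\<lambda>v. frechet_derivative f (at x) v * (- real k * flat_exp (k + 1) (f x) + flat_exp (k + 2) (f x)))) (at x)"
    if "x \<in> S" for k x
    using DERIV_compose_FDERIV[OF flat_exp_deriv Cinf_on_has_derivative[OF f that]] .
  show "b differentiable (at x)" if "b \<in> ?B" "x \<in> S" for b x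
    using that d unfolding differentiable_def by blast
  show "\<exists>I a c. finite (I :: bool set) \<and> (\<forall>i\<in>I. Cinf_on S (a i) \<and> c i \<in> ?B) \<and>
      (\<forall>x\<in>S. frechet_derivative b (at x) v = (\<Sum>i\<in>I. a i x * c i x))" if "b \<in> ?B" for b v
  proof -
    from that obtain k where b: "b = (\<lambda>x. flat_exp k (f x))" by auto
    show ?thesis
      unfolding b
      by (rule exI[of _ UNIV], rule exI[of _ "\<lambda>i x. (if i then - real k else 1) * frechet_derivative f (at x) v"],
          rule exI[of _ "\<lambda>i x. flat_exp (if i then k + 1 else k + 2) (f x)"])
         (auto intro!: Cinf_on_minus Cinf_on_cmult Cinf_on_deriv S f simp: frechet_derivative_eq[OF d] UNIV_bool algebra_simps)
  qed
qed auto

text \<open>A bump positive exactly for \<open>1 < |r| < 2\<close>. It is written in terms of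
  \<open>r\<^sup>2\<close> so that its composition with the norm is smooth at the origin
  too.\<close>

definition shell :: "real \<Rightarrow> real" where
  "shell r = flat_exp 0 (r\<^sup>2 - 1) * flat_exp 0 (4 - r\<^sup>2)"

lemma shell_nonneg: "shell r \<ge> 0"
  by (auto simp: shell_def flat_exp_def)

lemma shell_eq_0: "r \<ge> 0 \<Longrightarrow> r \<le> 1 \<or> r \<ge> 2 \<Longrightarrow> shell r = 0"
  using power_mono[of r 1 2] power_mono[of 2 r 2] by (auto simp: shell_def flat_exp_def)

lemma shell_pos: "1 < r \<Longrightarrow> r < 2 \<Longrightarrow> shell r > 0"
  using power_strict_mono[of 1 r 2] power_strict_mono[of r 2 2] by (auto simp: shell_def flat_exp_def)

lemma continuous_on_shell: "continuous_on S shell"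
proof -
  have "isCont (flat_exp 0) t" for t using flat_exp_deriv DERIV_isCont by blast
  then have "continuous_on UNIV (flat_exp 0)" by (simp add: continuous_at_imp_continuous_on)
  then show ?thesis
    using continuous_on_compose2[of UNIV "flat_exp 0" S "\<lambda>r. r\<^sup>2 - 1"]
      continuous_on_compose2[of UNIV "flat_exp 0" S "\<lambda>r. 4 - r\<^sup>2"]
    by (auto simp: shell_def[abs_def] continuous_on_diff continuous_on_power intro!: continuous_on_mult)
qed

lemma Cinf_on_shell: "open S \<Longrightarrow> Cinf_on S (\<lambda>x::'a::euclidean_space. shell (norm x))"
proof -
  assume S: "open S"
  have "Cinf_on S (\<lambda>x::'a. \<Sum>b\<in>Basis. (x \<bullet> b) * (x \<bullet> b))"
    by (intro Cinf_on_sum Cinf_on_mult Cinf_on_inner_left S)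
  then have "Cinf_on S (\<lambda>x::'a. (norm x)\<^sup>2)"
    by (simp add: power2_norm_eq_inner euclidean_inner[symmetric])
  then show ?thesis
    unfolding shell_def by (intro Cinf_on_mult Cinf_on_flat_exp Cinf_on_diff S Cinf_on_const)
qed

subsection \<open>Test functions\<close>

lemma test_fun_UNIV_iff:
  "test_fun UNIV w \<longleftrightarrow> Cinf_on UNIV w \<and> (\<exists>R. \<forall>x. R < norm x \<longrightarrow> w x = 0)"
proof -
  have "compact (closure {x. w x \<noteq> 0}) \<longleftrightarrow> (\<exists>R. \<forall>x. R < norm x \<longrightarrow> w x = 0)"
    unfolding compact_closure bounded_iff by (metis (mono_tags) mem_Collect_eq not_le)
  then show ?thesis by (auto simp: test_fun_def)
qed

lemma test_fun_mono: "test_fun D w \<Longrightarrow> D \<subseteq> E \<Longrightarrow> test_fun E w"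
  by (auto simp: test_fun_def)

lemma test_fun_support: "test_fun UNIV w \<Longrightarrow> \<exists>R>0. \<forall>x. R < norm x \<longrightarrow> w x = 0"
  unfolding test_fun_UNIV_iff by (metis dual_order.strict_trans1 gt_ex le_cases linorder_not_less)

lemma test_fun_Cinf: "test_fun D w \<Longrightarrow> Cinf_on UNIV w"
  by (simp add: test_fun_def)

lemma test_fun_has_derivative:
  "test_fun D w \<Longrightarrow> (w has_derivative frechet_derivative w (at x)) (at x)"
  using Cinf_on_has_derivative test_fun_Cinf by blast

lemma continuous_on_test_fun: "test_fun D w \<Longrightarrow> continuous_on S w"
  by (metis continuous_on_subset differentiable_imp_continuous_on differentiable_on_def
      differentiable_at_withinI Cinf_on_differentiable test_fun_Cinf iso_tuple_UNIV_I subset_UNIV)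

lemma test_fun_deriv:
  fixes w :: "'a::euclidean_space \<Rightarrow> real"
  assumes "test_fun UNIV w" shows "test_fun UNIV (\<lambda>x. frechet_derivative w (at x) v)"
proof -
  from test_fun_support[OF assms] obtain R where R: "R > 0" "\<forall>x. R < norm x \<longrightarrow> w x = 0" by blast
  have "frechet_derivative w (at x) v = 0" if "R < norm x" for x
  proof -
    have "((\<lambda>_. 0) has_derivative (\<lambda>_. 0)) (at x)" by simp
    then have "(w has_derivative (\<lambda>_. 0)) (at x)"
      by (rule has_derivative_transform_within_open[where s = "{x. R < norm x}"])
        (use R that in \<open>auto intro!: open_Collect_less continuous_intros\<close>)
    from frechet_derivative_eq[OF this] show ?thesis by simp
  qed
  then show ?thesis
    using Cinf_on_deriv[OF test_fun_Cinf[OF assms]] unfolding test_fun_UNIV_iff by blast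
qed

lemma test_fun_Cinf_mult:
  assumes "Cinf_on UNIV a" "test_fun UNIV w" shows "test_fun UNIV (\<lambda>x. a x * w x)"
  using assms unfolding test_fun_UNIV_iff by (auto intro!: Cinf_on_mult)

lemma test_fun_add:
  assumes "test_fun UNIV v" "test_fun UNIV w" shows "test_fun UNIV (\<lambda>x. v x + w x)"
proof -
  from assms obtain R R' where "\<forall>x. R < norm x \<longrightarrow> v x = 0" "\<forall>x. R' < norm x \<longrightarrow> w x = 0"
    unfolding test_fun_UNIV_iff by blast
  then have "\<forall>x. max R R' < norm x \<longrightarrow> v x + w x = 0" by auto
  then show ?thesis using assms unfolding test_fun_UNIV_iff by (blast intro: Cinf_on_add)
qed

lemma test_fun_cmult: "test_fun UNIV w \<Longrightarrow> test_fun UNIV (\<lambda>x. c * w x)"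
  by (intro test_fun_Cinf_mult Cinf_on_const) auto

lemma test_fun_uminus: "test_fun UNIV w \<Longrightarrow> test_fun UNIV (\<lambda>x. - w x)"
  using test_fun_cmult[of w "-1"] by simp

lemma test_fun_sum:
  fixes w :: "'i \<Rightarrow> 'a::euclidean_space \<Rightarrow> real"
  assumes "\<And>i. i \<in> I \<Longrightarrow> test_fun UNIV (w i)" shows "test_fun UNIV (\<lambda>x. \<Sum>i\<in>I. w i x)"
proof -
  have 0: "test_fun UNIV (\<lambda>x::'a. 0)" unfolding test_fun_UNIV_iff by auto
  show ?thesis using assms
    by (induction I rule: infinite_finite_induct) (auto intro!: test_fun_add 0)
qed

section \<open>Integration of compactly supported functions and of their derivatives\<close>

lemma integrable_compact_support:
  fixes w :: "'a::euclidean_space \<Rightarrow> 'b::{banach, second_countable_topology}"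
  assumes "continuous_on UNIV w" "\<And>x. R < norm x \<Longrightarrow> w x = 0"
  shows "integrable lborel w"
proof -
  have "integrable lborel (\<lambda>x. indicator (cball 0 R) x *\<^sub>R w x)"
    by (intro borel_integrable_compact) (auto intro: continuous_on_subset[OF assms(1)])
  moreover have "(\<lambda>x. indicator (cball 0 R) x *\<^sub>R w x) = w"
    using assms(2) by (auto simp: fun_eq_iff indicator_def)
  ultimately show ?thesis by simp
qed

lemma bounded_compact_support:
  fixes w :: "'a::euclidean_space \<Rightarrow> real"
  assumes "continuous_on UNIV w" "\<And>x. R < norm x \<Longrightarrow> w x = 0"
  shows "\<exists>C\<ge>0. \<forall>x. \<bar>w x\<bar> \<le> C"
proof -
  have "bounded (w ` cball 0 R)"
    by (intro compact_imp_bounded compact_continuous_image continuous_on_subset[OF assms(1)]) auto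
  then obtain C where "\<forall>x\<in>cball 0 R. \<bar>w x\<bar> \<le> C" by (auto simp: bounded_iff)
  then have "\<bar>w x\<bar> \<le> max C 0" for x
    using assms(2)[of x] by (cases "R < norm x") (auto simp: not_less intro: max.coboundedI1)
  then show ?thesis by (intro exI[of _ "max C 0"]) auto
qed

lemma integrable_test_fun: "test_fun UNIV (w :: 'a::euclidean_space \<Rightarrow> real) \<Longrightarrow> integrable lborel w"
  using integrable_compact_support continuous_on_test_fun test_fun_support by metis

lemma integrable_continuous_mult_test_fun:
  fixes w :: "'a::euclidean_space \<Rightarrow> real"
  assumes "test_fun UNIV w" "continuous_on UNIV k"
  shows "integrable lborel (\<lambda>x. k x * w x)"
proof -
  from test_fun_support[OF assms(1)] obtain R where "\<forall>x. R < norm x \<longrightarrow> w x = 0" by blast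
  then show ?thesis
    by (intro integrable_compact_support[of _ R] continuous_on_mult assms continuous_on_test_fun[OF assms(1)]) auto
qed

lemma lborel_integral_translate:
  fixes f :: "'a::euclidean_space \<Rightarrow> real"
  assumes "f \<in> borel_measurable borel"
  shows "(\<integral>x. f (x + c) \<partial>lborel) = (\<integral>x. f x \<partial>lborel)"
proof -
  have "(\<integral>x. f x \<partial>lborel) = (\<integral>x. f x \<partial>distr lborel borel ((+) c))"
    by (simp add: lborel_distr_plus)
  also have "\<dots> = (\<integral>x. f (c + x) \<partial>lborel)" using assms by (intro integral_distr) auto
  finally show ?thesis by (simp add: add.commute)
qed

text \<open>Translation invariance makes every difference quotient integrate to 0, and dominated
  convergence passes to the derivative, with the mean value inequality supplying the bound. No
  coordinates enter, so the direction \<open>e\<close> is arbitrary.\<close>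

lemma integral_directional_derivative_eq_0:
  fixes w w' :: "'a::euclidean_space \<Rightarrow> real"
  assumes d: "\<And>y. ((\<lambda>t. w (y + t *\<^sub>R e)) has_real_derivative w' y) (at 0)"
    and w: "continuous_on UNIV w" "\<And>x. R < norm x \<Longrightarrow> w x = 0"
    and w': "continuous_on UNIV w'" "\<And>x. R < norm x \<Longrightarrow> w' x = 0"
  shows "(\<integral>y. w' y \<partial>lborel) = 0"
proof -
  have d': "((\<lambda>t. w (y + t *\<^sub>R e)) has_real_derivative w' (y + s *\<^sub>R e)) (at s)" for y s
  proof -
    have "((\<lambda>t. w (y + (t + s) *\<^sub>R e)) has_real_derivative w' (y + s *\<^sub>R e)) (at 0)"
      using d[of "y + s *\<^sub>R e"] by (simp add: algebra_simps)
    with DERIV_shift[of "\<lambda>t. w (y + t *\<^sub>R e)" _ 0 s] show ?thesis by simp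
  qed
  obtain C where C: "C \<ge> 0" "\<And>x. \<bar>w' x\<bar> \<le> C"
    using bounded_compact_support[OF w'] by metis
  have meas [measurable]: "w \<in> borel_measurable borel" "w' \<in> borel_measurable borel"
    using w(1) w'(1) by (auto intro: borel_measurable_continuous_onI)
  \<comment> \<open>Steps of length at most 1 keep the supports of all difference quotients inside
    the ball of radius \<open>R + norm e\<close>.\<close>
  define s where "s n = 1 / (real n + 1)" for n
  define D where "D n y = (w (y + s n *\<^sub>R e) - w y) / s n" for n y
  have s: "0 < s n" "s n \<le> 1" for n by (auto simp: s_def)
  have s_lim: "s \<longlonglongrightarrow> 0" unfolding s_def by real_asymp
  have int_w: "integrable lborel w" by (rule integrable_compact_support[OF w])
  have "(\<integral>y. D n y \<partial>lborel) = 0" for n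
  proof -
    have "integrable lborel (\<lambda>y. w (y + s n *\<^sub>R e))"
    proof (rule integrable_compact_support[where R = "R + norm (s n *\<^sub>R e)"])
      show "continuous_on UNIV (\<lambda>y. w (y + s n *\<^sub>R e))"
        by (rule continuous_on_compose2[OF w(1)]) (auto intro!: continuous_intros)
      show "w (x + s n *\<^sub>R e) = 0" if "R + norm (s n *\<^sub>R e) < norm x" for x
        using norm_diff_ineq[of x "s n *\<^sub>R e"] that by (intro w(2)) linarith
    qed
    with int_w have "(\<integral>y. w (y + s n *\<^sub>R e) - w y \<partial>lborel) = 0"
      by (simp add: lborel_integral_translate)
    then show ?thesis unfolding D_def by simp
  qed
  moreover have "(\<lambda>n. \<integral>y. D n y \<partial>lborel) \<longlonglongrightarrow> (\<integral>y. w' y \<partial>lborel)"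
  proof (rule integral_dominated_convergence[where w = "\<lambda>y. C * indicator (cball 0 (R + norm e)) y"])
    show "integrable lborel (\<lambda>y. C * indicator (cball 0 (R + norm e)) (y::'a))"
      using emeasure_compact_finite[of "cball (0::'a) (R + norm e)"]
      by (intro integrable_mult_right integrable_real_indicator) auto
    show "AE y in lborel. (\<lambda>n. D n y) \<longlonglongrightarrow> w' y"
    proof (rule AE_I2)
      fix y
      have "((\<lambda>h. (w (y + h *\<^sub>R e) - w y) / h) \<longlongrightarrow> w' y) (at 0)"
        using d[of y] by (simp add: DERIV_def)
      moreover have "filterlim s (at 0) sequentially"
        using s_lim s(1) by (auto simp: filterlim_at less_imp_neq[THEN not_sym] intro!: always_eventually)
      ultimately show "(\<lambda>n. D n y) \<longlonglongrightarrow> w' y"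
        unfolding D_def by (rule filterlim_compose)
    qed
    show "AE y in lborel. norm (D n y) \<le> C * indicator (cball 0 (R + norm e)) y" for n
    proof (rule AE_I2)
      fix y :: 'a
      have "norm (w (y + s n *\<^sub>R e) - w (y + 0 *\<^sub>R e)) \<le> C * norm (s n - 0)"
        using s[of n] C(2)
        by (intro field_differentiable_bound[of UNIV "\<lambda>t. w (y + t *\<^sub>R e)" "\<lambda>t. w' (y + t *\<^sub>R e)"])
           (auto intro: d' has_field_derivative_at_within)
      then have "norm (D n y) \<le> C"
        using s[of n] by (simp add: D_def abs_divide pos_divide_le_eq)
      moreover have "D n y = 0" if "y \<notin> cball 0 (R + norm e)"
      proof -
        have y: "R + norm e < norm y" using that by simp
        have "norm (s n *\<^sub>R e) \<le> norm e" using s[of n] by (simp add: mult_left_le_one_le)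
        then have "R < norm (y + s n *\<^sub>R e)"
          using norm_diff_ineq[of y "s n *\<^sub>R e"] y by linarith
        moreover have "R < norm y" using y norm_ge_zero[of e] by linarith
        ultimately show ?thesis by (simp add: D_def w(2))
      qed
      ultimately show "norm (D n y) \<le> C * indicator (cball 0 (R + norm e)) y"
        by (auto simp: indicator_def)
    qed
  qed (auto simp: D_def)
  ultimately show ?thesis by (simp add: LIMSEQ_const_iff)
qed

subsection \<open>Integrals of plane waves\<close>

text \<open>Differentiation under the integral sign. Compact support confines the integral to a box,
  where joint continuity of the derivative suffices; the factor \<open>v \<bullet> y\<close> turns
  \<open>w\<close> into another test function.\<close>

lemma plane_wave_integral_has_derivative:
  fixes w :: "'a::euclidean_space \<Rightarrow> real"
  assumes K1: "\<And>t. (K1 has_real_derivative K t) (at t)" and K: "continuous_on UNIV K"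
    and w: "test_fun UNIV w"
  shows "((\<lambda>x. \<integral>y. K1 (x \<bullet> y) * w y \<partial>lborel) has_derivative
    (\<lambda>v. \<integral>y. K (x \<bullet> y) * ((v \<bullet> y) * w y) \<partial>lborel)) (at x)"
proof -
  from test_fun_support[OF w] obtain R where R: "\<And>x. R < norm x \<Longrightarrow> w x = 0" by blast
  obtain a where a: "cball 0 R \<subseteq> cbox (-a) (a::'a)"
    using bounded_subset_cbox_symmetric[of "cball 0 R"] by auto
  have w0: "w y = 0" if "y \<notin> cbox (-a) a" for y
    using a that R[of y] by (meson in_mono mem_cball_0 not_le)
  have K1c: "continuous_on UNIV K1"
    using K1 DERIV_isCont continuous_at_imp_continuous_on by blast
  have cont: "continuous_on UNIV (\<lambda>y. k (x \<bullet> y))" if "continuous_on UNIV k" for k :: "real \<Rightarrow> real" and x :: 'a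
    by (rule continuous_on_compose2[OF that]) (auto intro!: continuous_intros)
  have to_box: "integral (cbox (-a) a) f = (\<integral>y. f y \<partial>lborel)"
    if "integrable lborel f" "\<And>y. y \<notin> cbox (-a) a \<Longrightarrow> f y = 0" for f :: "'a \<Rightarrow> 'b::euclidean_space"
  proof -
    have "integral (cbox (-a) a) f = integral UNIV f"
      using that(2) integral_restrict_UNIV[of "cbox (-a) a" f]
      by (smt (verit, best) integral_cong)
    then show ?thesis using integral_lborel[OF that(1)] by simp
  qed
  \<comment> \<open>The derivative in \<open>x\<close> as a bounded linear functional, the form in
    which the Leibniz rule takes it.\<close>
  define fx where "fx x y = (K (x \<bullet> y) * w y) *\<^sub>R blinfun_inner_left y" for x y :: 'a
  have fx_cont: "continuous_on (UNIV \<times> cbox (-a) a) (\<lambda>(x, t). fx x t)"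
  proof -
    have "continuous_on (UNIV \<times> cbox (-a) a) (\<lambda>p. K (fst p \<bullet> snd p))"
      by (rule continuous_on_compose2[OF K]) (auto intro!: continuous_intros)
    moreover have "continuous_on (UNIV \<times> cbox (-a) a) (\<lambda>p::'a\<times>'a. w (snd p))"
      by (rule continuous_on_compose2[OF continuous_on_test_fun[OF w, of UNIV]]) (auto intro!: continuous_intros)
    moreover have "continuous_on (UNIV \<times> cbox (-a) a) (\<lambda>p::'a\<times>'a. blinfun_inner_left (snd p))"
      by (rule bounded_linear.continuous_on[OF bounded_linear_blinfun_inner_left]) (auto intro!: continuous_intros)
    ultimately show ?thesis
      unfolding fx_def case_prod_beta by (intro continuous_on_scaleR continuous_on_mult)
  qed
  have "((\<lambda>x. integral (cbox (-a) a) (\<lambda>y. K1 (x \<bullet> y) * w y)) has_derivative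
      blinfun_apply (integral (cbox (-a) a) (fx x))) (at x within UNIV)"
  proof (rule leibniz_rule[OF _ _ fx_cont])
    fix x y :: 'a
    have "((\<lambda>x. x \<bullet> y) has_derivative (\<lambda>v. v \<bullet> y)) (at x)"
      by (auto intro!: derivative_eq_intros)
    from DERIV_compose_FDERIV[OF K1 this]
    have "((\<lambda>x. K1 (x \<bullet> y) * w y) has_derivative (\<lambda>v. v \<bullet> y * K (x \<bullet> y) * w y)) (at x)"
      by (rule has_derivative_mult_left)
    moreover have "blinfun_apply (fx x y) = (\<lambda>v. v \<bullet> y * K (x \<bullet> y) * w y)"
      by (simp add: fun_eq_iff fx_def blinfun.scaleR_left)
    ultimately show "((\<lambda>x. K1 (x \<bullet> y) * w y) has_derivative blinfun_apply (fx x y)) (at x within UNIV)"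
      by simp
  next
    fix x :: 'a
    show "(\<lambda>y. K1 (x \<bullet> y) * w y) integrable_on cbox (-a) a"
      by (intro integrable_continuous continuous_on_subset[OF continuous_on_mult[OF cont[OF K1c] continuous_on_test_fun[OF w]]]) auto
  qed auto
  moreover have "integral (cbox (-a) a) (\<lambda>y. K1 (x \<bullet> y) * w y) = (\<integral>y. K1 (x \<bullet> y) * w y \<partial>lborel)" for x
    by (intro to_box integrable_continuous_mult_test_fun w cont K1c) (simp add: w0)
  moreover
  have "blinfun_apply (integral (cbox (-a) a) (fx x)) v = (\<integral>y. K (x \<bullet> y) * ((v \<bullet> y) * w y) \<partial>lborel)" for v
  proof -
    have "fx x integrable_on cbox (-a) a"
      using continuous_on_compose2[OF fx_cont continuous_on_Pair[OF continuous_on_const continuous_on_id]]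
      by (intro integrable_continuous) auto
    from blinfun_apply_integral[OF this]
    have "blinfun_apply (integral (cbox (-a) a) (fx x)) v = integral (cbox (-a) a) (\<lambda>y. blinfun_apply (fx x y) v)" .
    also have "\<dots> = integral (cbox (-a) a) (\<lambda>y. K (x \<bullet> y) * ((v \<bullet> y) * w y))"
      by (simp add: fx_def blinfun.scaleR_left mult_ac)
    also have "\<dots> = (\<integral>y. K (x \<bullet> y) * ((v \<bullet> y) * w y) \<partial>lborel)"
      by (intro to_box integrable_continuous_mult_test_fun test_fun_Cinf_mult w cont K Cinf_on_inner_right)
        (simp_all add: w0)
    finally show ?thesis .
  qed
  then have "blinfun_apply (integral (cbox (-a) a) (fx x)) = (\<lambda>v. \<integral>y. K (x \<bullet> y) * ((v \<bullet> y) * w y) \<partial>lborel)"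
    by blast
  ultimately show ?thesis by simp
qed

lemma antiderivative_exists:
  assumes "continuous_on UNIV (K :: real \<Rightarrow> real)"
  shows "\<exists>K1. \<forall>t. (K1 has_real_derivative K t) (at t)"
proof -
  have "isCont K t" for t using assms by (simp add: continuous_on_eq_continuous_at)
  then have "\<exists>F. \<forall>x. -\<infinity> < ereal x \<longrightarrow> ereal x < \<infinity> \<longrightarrow> (F has_vector_derivative K x) (at x)"
    by (intro einterval_antiderivative) auto
  then show ?thesis by (simp add: has_real_derivative_iff_has_vector_derivative)
qed

lemma directional_derivative:
  assumes "(f has_derivative D) (at y)"
  shows "((\<lambda>t. f (y + t *\<^sub>R e)) has_real_derivative D e) (at 0)"
proof -
  have "((\<lambda>t. y + t *\<^sub>R e) has_derivative (\<lambda>t. t *\<^sub>R e)) (at 0)"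
    by (auto intro!: derivative_eq_intros)
  from has_derivative_compose[OF this, of f D] assms
  have "((\<lambda>t. f (y + t *\<^sub>R e)) has_derivative (\<lambda>t. D (t *\<^sub>R e))) (at 0)" by simp
  moreover have "D (t *\<^sub>R e) = D e * t" for t
    using linear_cmul[OF has_derivative_linear[OF assms]] by simp
  ultimately show ?thesis unfolding has_field_derivative_def by (simp add: mult_commute_abs)
qed

text \<open>The derivative of \<open>K1 (x \<bullet> y) * w y\<close> in \<open>y\<close> along
  \<open>e\<close> is \<open>x \<bullet> e\<close> times the first integrand plus the second, and it
  integrates to 0 by compact support.\<close>

lemma plane_wave_integral_by_parts:
  fixes w :: "'a::euclidean_space \<Rightarrow> real"
  assumes K1: "\<And>t. (K1 has_real_derivative K t) (at t)" and K: "continuous_on UNIV K"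
    and w: "test_fun UNIV w"
  shows "(x \<bullet> e) * (\<integral>y. K (x \<bullet> y) * w y \<partial>lborel) =
    - (\<integral>y. K1 (x \<bullet> y) * frechet_derivative w (at y) e \<partial>lborel)"
proof -
  from test_fun_support[OF w] obtain R where R: "\<And>x. R < norm x \<Longrightarrow> w x = 0" by blast
  have K1c: "continuous_on UNIV K1"
    using K1 DERIV_isCont continuous_at_imp_continuous_on by blast
  have cont: "continuous_on UNIV (\<lambda>y. k (x \<bullet> y))" if "continuous_on UNIV k" for k :: "real \<Rightarrow> real"
    by (rule continuous_on_compose2[OF that]) (auto intro!: continuous_intros)
  have int: "integrable lborel (\<lambda>y. k (x \<bullet> y) * v y)" if "continuous_on UNIV k" "test_fun UNIV v" for k v
    using that by (intro integrable_continuous_mult_test_fun cont)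
  have "(\<integral>y. (x \<bullet> e) * (K (x \<bullet> y) * w y) + K1 (x \<bullet> y) * frechet_derivative w (at y) e \<partial>lborel) = 0"
  proof (rule integral_directional_derivative_eq_0[where w = "\<lambda>y. K1 (x \<bullet> y) * w y" and e = e and R = R])
    fix y
    have "((\<lambda>y. x \<bullet> y) has_derivative (\<lambda>v. x \<bullet> v)) (at y)"
      by (auto intro!: derivative_eq_intros)
    from has_derivative_mult[OF DERIV_compose_FDERIV[OF K1 this] test_fun_has_derivative[OF w]]
    have "((\<lambda>y. K1 (x \<bullet> y) * w y) has_derivative
      (\<lambda>v. K1 (x \<bullet> y) * frechet_derivative w (at y) v + x \<bullet> v * K (x \<bullet> y) * w y)) (at y)" .
    from directional_derivative[OF this, of e]
    show "((\<lambda>t. K1 (x \<bullet> (y + t *\<^sub>R e)) * w (y + t *\<^sub>R e)) has_real_derivative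
       (x \<bullet> e) * (K (x \<bullet> y) * w y) + K1 (x \<bullet> y) * frechet_derivative w (at y) e) (at 0)"
      by (simp add: algebra_simps)
  next
    show "continuous_on UNIV (\<lambda>y. K1 (x \<bullet> y) * w y)"
      by (intro continuous_on_mult cont K1c continuous_on_test_fun[OF w])
    show "continuous_on UNIV (\<lambda>y. (x \<bullet> e) * (K (x \<bullet> y) * w y) + K1 (x \<bullet> y) * frechet_derivative w (at y) e)"
      by (intro continuous_on_add continuous_on_mult continuous_on_const cont K K1c continuous_on_test_fun[OF w]
          continuous_on_test_fun[OF test_fun_deriv[OF w]])
    fix y :: 'a assume y: "R < norm y"
    then show "K1 (x \<bullet> y) * w y = 0" using R by simp
    have "(w has_derivative (\<lambda>_. 0)) (at y)"
      by (rule has_derivative_transform_within_open[where s = "{x. R < norm x}" and f = "\<lambda>_. 0"])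
        (use R y in \<open>auto intro!: open_Collect_less continuous_intros\<close>)
    from frechet_derivative_eq[OF this]
    show "(x \<bullet> e) * (K (x \<bullet> y) * w y) + K1 (x \<bullet> y) * frechet_derivative w (at y) e = 0"
      using R y by simp
  qed
  then show ?thesis
    using int[OF K w] int[OF K1c test_fun_deriv[OF w]] by (simp add: eq_neg_iff_add_eq_0)
qed

text \<open>Integrating by parts in the direction of \<open>x\<close> trades the kernel for its antiderivative.\<close>

lemma plane_wave_integral_antiderivative:
  fixes w :: "'a::euclidean_space \<Rightarrow> real"
  assumes K1: "\<And>t. (K1 has_real_derivative K t) (at t)" and K: "continuous_on UNIV K"
    and w: "test_fun UNIV w" and x: "x \<noteq> 0"
  shows "(\<integral>y. K (x \<bullet> y) * w y \<partial>lborel) =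
    (\<Sum>b\<in>Basis. - ((norm x powr (-2)) * (x \<bullet> b)) * (\<integral>y. K1 (x \<bullet> y) * frechet_derivative w (at y) b \<partial>lborel))"
proof -
  note * = plane_wave_integral_by_parts[OF K1 K w]
  have "(\<Sum>b\<in>Basis. - ((norm x powr (-2)) * (x \<bullet> b)) * (\<integral>y. K1 (x \<bullet> y) * frechet_derivative w (at y) b \<partial>lborel))
      = (\<Sum>b\<in>Basis. (norm x powr (-2)) * (x \<bullet> b) * ((x \<bullet> b) * (\<integral>y. K (x \<bullet> y) * w y \<partial>lborel)))"
    by (intro sum.cong refl) (simp add: *)
  also have "\<dots> = norm x powr (-2) * (x \<bullet> x) * (\<integral>y. K (x \<bullet> y) * w y \<partial>lborel)"
    by (subst (3) euclidean_inner) (simp add: sum_distrib_left sum_distrib_right mult_ac)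
  also have "norm x powr (-2) * (x \<bullet> x) = 1"
    using x by (simp add: powr_minus powr_numeral power2_norm_eq_inner)
  finally show ?thesis by simp
qed

text \<open>The kernel is only continuous, so the integral is first rewritten with an antiderivative
  \<open>K1\<close>. Differentiating that expression gives \<open>K\<close> back where the integral
  is hit and keeps \<open>K1\<close> where a coefficient is hit, so plane wave integrals are closed
  under differentiation up to smooth coefficients. The coefficients carry \<open>1 / |x|^2\<close>,
  hence the excluded origin.\<close>

lemma Cinf_on_plane_wave_integral:
  fixes w :: "'a::euclidean_space \<Rightarrow> real"
  assumes "continuous_on UNIV K" "test_fun UNIV w"
  shows "Cinf_on (- {0}) (\<lambda>x. \<integral>y. K (x \<bullet> y) * w y \<partial>lborel)"
proof (rule Cinf_on_generators[where B = "{\<lambda>x. \<integral>y. K (x \<bullet> y) * w y \<partial>lborel | K w.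
      continuous_on UNIV K \<and> test_fun UNIV (w :: 'a \<Rightarrow> real)}" and 'i = "bool \<times> 'a"])
  let ?B = "{\<lambda>x. \<integral>y. K (x \<bullet> y) * w y \<partial>lborel | K w. continuous_on UNIV K \<and> test_fun UNIV (w :: 'a \<Rightarrow> real)}"
  define a where "a b x = - (norm x powr (-2) * (x \<bullet> b))" for b x :: 'a
  have a: "Cinf_on (- {0}) (a b)" for b
    unfolding a_def by (intro Cinf_on_minus Cinf_on_mult Cinf_on_norm_powr Cinf_on_inner_left) auto
  have d: "((\<lambda>x. \<integral>y. K (x \<bullet> y) * w y \<partial>lborel) has_derivative (\<lambda>v.
      \<Sum>b\<in>Basis. a b x * (\<integral>y. K (x \<bullet> y) * ((v \<bullet> y) * frechet_derivative w (at y) b) \<partial>lborel) +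
        frechet_derivative (a b) (at x) v * (\<integral>y. K1 (x \<bullet> y) * frechet_derivative w (at y) b \<partial>lborel))) (at x)"
    if K: "continuous_on UNIV K" and w: "test_fun UNIV w" and K1: "\<And>t. (K1 has_real_derivative K t) (at t)"
      and x: "x \<noteq> 0" for K K1 and w :: "'a \<Rightarrow> real" and x
  proof -
    have "((\<lambda>x. \<Sum>b\<in>Basis. a b x * (\<integral>y. K1 (x \<bullet> y) * frechet_derivative w (at y) b \<partial>lborel)) has_derivative (\<lambda>v.
      \<Sum>b\<in>Basis. a b x * (\<integral>y. K (x \<bullet> y) * ((v \<bullet> y) * frechet_derivative w (at y) b) \<partial>lborel) +
        frechet_derivative (a b) (at x) v * (\<integral>y. K1 (x \<bullet> y) * frechet_derivative w (at y) b \<partial>lborel))) (at x)"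
      using x by (intro has_derivative_sum has_derivative_mult Cinf_on_has_derivative[OF a]
          plane_wave_integral_has_derivative K K1 test_fun_deriv w) auto
    then show ?thesis
      by (rule has_derivative_transform_within_open[where s = "- {0}"])
        (use x in \<open>auto simp: a_def plane_wave_integral_antiderivative[OF K1 K w]\<close>)
  qed
  show "(\<lambda>x. \<integral>y. K (x \<bullet> y) * w y \<partial>lborel) \<in> ?B" using assms by auto
  show "h differentiable (at x)" if "h \<in> ?B" "x \<in> - {0}" for h x
  proof -
    from that obtain K w where h: "h = (\<lambda>x. \<integral>y. K (x \<bullet> y) * w y \<partial>lborel)"
      and K: "continuous_on UNIV K" and w: "test_fun UNIV w" by auto
    obtain K1 where K1: "\<And>t. (K1 has_real_derivative K t) (at t)"
      using antiderivative_exists[OF K] by auto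
    show ?thesis unfolding h differentiable_def using d[OF K w K1] that(2) by auto
  qed
  show "\<exists>I a c. finite (I :: (bool \<times> 'a) set) \<and> (\<forall>i\<in>I. Cinf_on (- {0}) (a i) \<and> c i \<in> ?B) \<and>
      (\<forall>x\<in>- {0}. frechet_derivative h (at x) v = (\<Sum>i\<in>I. a i x * c i x))"
    if "h \<in> ?B" for h v
  proof -
    from that obtain K w where h: "h = (\<lambda>x. \<integral>y. K (x \<bullet> y) * w y \<partial>lborel)"
      and K: "continuous_on UNIV K" and w: "test_fun UNIV w" by auto
    obtain K1 where K1: "\<And>t. (K1 has_real_derivative K t) (at t)"
      using antiderivative_exists[OF K] by auto
    have K1c: "continuous_on UNIV K1"
      using K1 DERIV_isCont continuous_at_imp_continuous_on by blast
    \<comment> \<open>Index \<open>True\<close> marks the terms in which the kernel was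
      differentiated, \<open>False\<close> those in which the coefficient was.\<close>
    define c where "c i = (\<lambda>x. \<integral>y. (if fst i then K else K1) (x \<bullet> y) *
        (if fst i then (v \<bullet> y) * frechet_derivative w (at y) (snd i) else frechet_derivative w (at y) (snd i)) \<partial>lborel)"
      for i :: "bool \<times> 'a"
    define a' where "a' i = (if fst i then a (snd i) else (\<lambda>x. frechet_derivative (a (snd i)) (at x) v))"
      for i :: "bool \<times> 'a"
    show ?thesis
    proof (intro exI conjI ballI)
      show "finite (UNIV \<times> Basis :: (bool \<times> 'a) set)" by simp
      show "Cinf_on (- {0}) (a' i)" for i
        unfolding a'_def by (auto intro: a Cinf_on_deriv)
      show "c i \<in> ?B" for i
      proof (cases "fst i")
        case True
        then show ?thesis unfolding c_def
          using K test_fun_Cinf_mult[OF Cinf_on_inner_right test_fun_deriv[OF w], of v "snd i"]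
          by (auto intro!: exI[of _ K] exI[of _ "\<lambda>y. (v \<bullet> y) * frechet_derivative w (at y) (snd i)"])
      next
        case False
        then show ?thesis unfolding c_def
          using K1c test_fun_deriv[OF w, of "snd i"]
          by (auto intro!: exI[of _ K1] exI[of _ "\<lambda>y. frechet_derivative w (at y) (snd i)"])
      qed
      fix x :: 'a assume "x \<in> - {0}"
      then have x: "x \<noteq> 0" by simp
      show "frechet_derivative h (at x) v = (\<Sum>i\<in>UNIV \<times> Basis. a' i x * c i x)"
      proof -
        have "(\<Sum>i\<in>UNIV \<times> Basis. a' i x * c i x) = (\<Sum>t\<in>UNIV. \<Sum>b\<in>Basis. a' (t, b) x * c (t, b) x)"
          by (simp add: sum.cartesian_product)
        then show ?thesis
          unfolding h frechet_derivative_eq[OF d[OF K w K1 x]]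
          by (simp add: UNIV_bool a'_def c_def sum.distrib)
      qed
    qed
  qed
qed (use assms in auto)

subsection \<open>The Fourier cosine transform\<close>

text \<open>The Fourier transform of the even part of \<open>w\<close>. Against even homogeneous
  densities nothing else survives, so the analysis can stay real-valued.\<close>

definition cos_ft :: "('a::euclidean_space \<Rightarrow> real) \<Rightarrow> 'a \<Rightarrow> real" where
  "cos_ft w x = (\<integral>y. cos (x \<bullet> y) * w y \<partial>lborel)"

lemma integrable_cos_ft: "test_fun UNIV w \<Longrightarrow> integrable lborel (\<lambda>y. cos (x \<bullet> y) * w y)"
  by (intro integrable_continuous_mult_test_fun continuous_intros)

lemma continuous_on_cos_ft:
  assumes "test_fun UNIV w" shows "continuous_on S (cos_ft w)"
proof -
  have "\<exists>D. (cos_ft w has_derivative D) (at x)" for x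
    unfolding cos_ft_def[abs_def]
    by (intro exI, rule plane_wave_integral_has_derivative[of cos "\<lambda>t. - sin t" w])
      (use assms in \<open>auto intro!: derivative_eq_intros continuous_intros\<close>)
  then show ?thesis
    by (meson continuous_at_imp_continuous_on has_derivative_continuous)
qed

lemma borel_measurable_cos_ft: "test_fun UNIV w \<Longrightarrow> cos_ft w \<in> borel_measurable borel"
  by (intro borel_measurable_continuous_onI continuous_on_cos_ft)

lemma cos_ft_minus [simp]: "cos_ft w (- x) = cos_ft w x"
  by (simp add: cos_ft_def)

lemma abs_cos_ft_le:
  assumes "test_fun UNIV w" shows "\<bar>cos_ft w x\<bar> \<le> (\<integral>y. \<bar>w y\<bar> \<partial>lborel)"
  unfolding cos_ft_def
proof (rule order_trans[OF integral_abs_bound integral_mono])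
  show "\<bar>cos (x \<bullet> y) * w y\<bar> \<le> \<bar>w y\<bar>" for y
    unfolding abs_mult by (intro mult_left_le_one_le) auto
qed (intro integrable_abs integrable_cos_ft integrable_test_fun assms)+

text \<open>Two integrations by parts, from cosine to sine and back; a single derivative would lead
  out of the cosine transforms.\<close>

lemma cos_ft_deriv2:
  assumes w: "test_fun UNIV w"
  shows "cos_ft (\<lambda>y. frechet_derivative (\<lambda>y. frechet_derivative w (at y) e) (at y) e) x = - ((x \<bullet> e)\<^sup>2 * cos_ft w x)"
proof -
  have "(x \<bullet> e) * cos_ft w x = - (\<integral>y. sin (x \<bullet> y) * frechet_derivative w (at y) e \<partial>lborel)"
    unfolding cos_ft_def using w
    by (intro plane_wave_integral_by_parts) (auto intro!: derivative_eq_intros continuous_intros)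
  moreover have "(x \<bullet> e) * (\<integral>y. sin (x \<bullet> y) * frechet_derivative w (at y) e \<partial>lborel) =
     - (\<integral>y. - cos (x \<bullet> y) * frechet_derivative (\<lambda>y. frechet_derivative w (at y) e) (at y) e \<partial>lborel)"
    using test_fun_deriv[OF w]
    by (intro plane_wave_integral_by_parts[of "\<lambda>t. - cos t" sin]) (auto intro!: derivative_eq_intros continuous_intros)
  ultimately show ?thesis
    unfolding cos_ft_def power2_eq_square mult.assoc by simp
qed

lemma sum_Basis_inner_sq: "(\<Sum>b\<in>Basis. (x \<bullet> b)\<^sup>2) = (norm (x::'a::euclidean_space))\<^sup>2"
  by (subst power2_norm_eq_inner, subst euclidean_inner) (simp add: power2_eq_square)

text \<open>This is the identity minus the Laplacian. On the Fourier side it multiplies by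
  \<open>1 + |x|^2\<close>, which has no zeros, so its powers can be divided out to give decay of
  any order.\<close>

definition bessel_op :: "('a::euclidean_space \<Rightarrow> real) \<Rightarrow> 'a \<Rightarrow> real" where
  "bessel_op w y = w y + (- (\<Sum>b\<in>Basis. frechet_derivative (\<lambda>y. frechet_derivative w (at y) b) (at y) b))"

lemma test_fun_bessel_op: "test_fun UNIV w \<Longrightarrow> test_fun UNIV (bessel_op w)"
  unfolding bessel_op_def[abs_def] by (intro test_fun_add test_fun_uminus test_fun_sum test_fun_deriv)

lemma cos_ft_add:
  "test_fun UNIV v \<Longrightarrow> test_fun UNIV w \<Longrightarrow> cos_ft (\<lambda>y. v y + w y) x = cos_ft v x + cos_ft w x"
  by (simp add: cos_ft_def distrib_left integrable_cos_ft)

lemma cos_ft_uminus: "cos_ft (\<lambda>y. - w y) x = - cos_ft w x"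
  by (simp add: cos_ft_def)

lemma cos_ft_sum:
  "(\<And>i. i \<in> I \<Longrightarrow> test_fun UNIV (w i)) \<Longrightarrow> cos_ft (\<lambda>y. \<Sum>i\<in>I. w i y) x = (\<Sum>i\<in>I. cos_ft (w i) x)"
  by (simp add: cos_ft_def sum_distrib_left integrable_cos_ft)

lemma cos_ft_bessel_op:
  assumes w: "test_fun UNIV w"
  shows "cos_ft (bessel_op w) x = (1 + (norm x)\<^sup>2) * cos_ft w x"
proof -
  show ?thesis
    unfolding bessel_op_def[abs_def]
    by (subst cos_ft_add) (simp_all add: cos_ft_uminus cos_ft_sum cos_ft_deriv2 w test_fun_uminus test_fun_sum test_fun_deriv
        sum_negf sum_distrib_right[symmetric] distrib_right sum_Basis_inner_sq)
qed

lemma test_fun_bessel_op_funpow: "test_fun UNIV w \<Longrightarrow> test_fun UNIV ((bessel_op ^^ N) w)"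
  by (induction N) (auto intro: test_fun_bessel_op)

lemma cos_ft_bessel_op_funpow:
  "test_fun UNIV w \<Longrightarrow> cos_ft ((bessel_op ^^ N) w) x = (1 + (norm x)\<^sup>2) ^ N * cos_ft w x"
  by (induction N) (simp_all add: cos_ft_bessel_op test_fun_bessel_op_funpow)

lemma one_plus_norm_sq_pos: "1 + (norm x)\<^sup>2 > 0"
  by (simp add: add_pos_nonneg)

lemma cos_ft_eq_bessel_op_funpow:
  "test_fun UNIV w \<Longrightarrow> cos_ft w x = cos_ft ((bessel_op ^^ N) w) x / (1 + (norm x)\<^sup>2) ^ N"
  using one_plus_norm_sq_pos[of x] by (simp add: cos_ft_bessel_op_funpow)

lemma cos_ft_decay:
  assumes "test_fun UNIV w" shows "\<exists>C\<ge>0. \<forall>x. \<bar>cos_ft w x\<bar> \<le> C / (1 + (norm x)\<^sup>2) ^ N"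
proof (intro exI conjI allI)
  show "0 \<le> (\<integral>y. \<bar>(bessel_op ^^ N) w y\<bar> \<partial>lborel)" by simp
  show "\<bar>cos_ft w x\<bar> \<le> (\<integral>y. \<bar>(bessel_op ^^ N) w y\<bar> \<partial>lborel) / (1 + (norm x)\<^sup>2) ^ N" for x
    using abs_cos_ft_le[OF test_fun_bessel_op_funpow[OF assms], of N x] one_plus_norm_sq_pos[of x]
    by (subst cos_ft_eq_bessel_op_funpow[OF assms, of _ N]) (simp add: abs_divide divide_right_mono)
qed

subsection \<open>Polar coordinates\<close>

text \<open>The image of this measure under \<open>x \<mapsto> x /\<^sub>R norm x\<close> is the
  surface measure, matching \<open>sphere_integral\<close>. Directions are represented by points of
  the ball, so that no measure on the sphere itself has to be constructed.\<close>

definition cone_measure :: "'a::euclidean_space measure" where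
  "cone_measure = density lborel (\<lambda>x. ennreal (if norm x < 1 then real DIM('a) else 0))"

definition radial :: "nat \<Rightarrow> real measure" where
  "radial n = density lborel (\<lambda>r. ennreal (if 0 < r then r ^ (n - 1) else 0))"

lemma sets_cone_measure [measurable_cong, simp]: "sets cone_measure = sets borel" by (simp add: cone_measure_def)
lemma space_cone_measure [simp]: "space cone_measure = UNIV" by (simp add: cone_measure_def)
lemma sets_radial [measurable_cong, simp]: "sets (radial n) = sets borel" by (simp add: radial_def)
lemma space_radial [simp]: "space (radial n) = UNIV" by (simp add: radial_def)

lemma finite_measure_cone_measure: "finite_measure (cone_measure :: 'a::euclidean_space measure)"
proof (rule finite_measureI)
  have "emeasure (cone_measure :: 'a measure) UNIV = (\<integral>\<^sup>+x. ennreal (real DIM('a)) * indicator (ball 0 1) (x::'a) \<partial>lborel)"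
    unfolding cone_measure_def
    by (subst emeasure_density) (auto intro!: nn_integral_cong simp: indicator_def)
  also have "\<dots> = ennreal (real DIM('a)) * emeasure lborel (ball (0::'a) 1)"
    by (rule nn_integral_cmult_indicator) simp
  also have "\<dots> < \<infinity>"
    using emeasure_bounded_finite[of "ball (0::'a) 1"] by (simp add: ennreal_mult_less_top)
  finally show "emeasure (cone_measure :: 'a measure) (space cone_measure) \<noteq> \<infinity>" by simp
qed

lemma sigma_finite_radial: "sigma_finite_measure (radial n)"
  unfolding radial_def
  by (subst sigma_finite_measure.sigma_finite_iff_density_finite[OF sigma_finite_lborel]) auto

lemma AE_cone_measure_nonzero: "AE x in cone_measure. x \<noteq> (0::'a::euclidean_space)"
proof -
  have "AE x in density lborel (\<lambda>x. ennreal (if norm x < 1 then real DIM('a) else 0)). x \<noteq> (0::'a)"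
    using AE_lborel_singleton[of "0::'a"] by (subst AE_density) (auto elim: AE_mp)
  then show ?thesis unfolding cone_measure_def .
qed

lemma nn_integral_lborel_scale:
  fixes f :: "'a::euclidean_space \<Rightarrow> ennreal"
  assumes [measurable]: "f \<in> borel_measurable borel" and "c \<noteq> 0"
  shows "(\<integral>\<^sup>+x. f x \<partial>lborel) = ennreal (\<bar>c\<bar> ^ DIM('a)) * (\<integral>\<^sup>+x. f (c *\<^sub>R x) \<partial>lborel)"
  using assms(2) by (subst lborel_affine[of c 0]) (simp_all add: nn_integral_density nn_integral_distr nn_integral_cmult)

text \<open>Normalises the auxiliary scale in the polar formula: for fixed \<open>y\<close>, with
  \<open>a = norm y\<close>, the density in \<open>s\<close> left over after both substitutions has
  total mass 1.\<close>

lemma nn_integral_power_tail: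
  assumes "a > 0" "n > 0"
  shows "(\<integral>\<^sup>+s. ennreal (if a < s then real n * a ^ n / s ^ (n + 1) else 0) \<partial>lborel) = 1"
proof -
  have "((\<lambda>x. x powr (- real n - 1)) has_integral -(a powr ((- real n - 1)+1)) / ((- real n - 1)+1)) {a..}"
    using assms by (intro has_integral_powr_to_inf) auto
  from has_integral_mult_right[OF this, of "real n * a ^ n"]
  have "((\<lambda>x. real n * a ^ n * x powr (- real n - 1)) has_integral 1) {a..}"
    using assms by (simp add: powr_minus powr_realpow)
  then have "((\<lambda>x. real n * a ^ n / x ^ (n + 1)) has_integral 1) {a..}"
    by (rule has_integral_eq[rotated]) (use assms in \<open>auto simp: powr_diff powr_minus powr_realpow field_simps\<close>)
  from nn_integral_has_integral_lebesgue[OF _ this]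
  have "(\<integral>\<^sup>+s. ennreal (indicator {a..} s * (real n * a ^ n / s ^ (n + 1))) \<partial>lborel) = 1"
    using assms by (auto simp: nn_integral_completion)
  moreover have "(\<integral>\<^sup>+s. ennreal (if a < s then real n * a ^ n / s ^ (n + 1) else 0) \<partial>lborel) =
      (\<integral>\<^sup>+s. ennreal (indicator {a..} s * (real n * a ^ n / s ^ (n + 1))) \<partial>lborel)"
    by (intro nn_integral_cong_AE eventually_mono[OF AE_lborel_singleton[of a]]) (auto simp: indicator_def)
  ultimately show ?thesis by simp
qed

text \<open>Polar coordinates need no differential geometry here: substitute \<open>r = s |x|\<close> in the inner
  integral, swap, rescale \<open>x\<close>, and swap back.\<close>

lemma nn_integral_polar:
  fixes F :: "'a::euclidean_space \<Rightarrow> ennreal"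
  assumes [measurable]: "F \<in> borel_measurable borel"
  shows "(\<integral>\<^sup>+x. \<integral>\<^sup>+r. F (r *\<^sub>R (x /\<^sub>R norm x)) \<partial>radial DIM('a) \<partial>cone_measure) = (\<integral>\<^sup>+x. F x \<partial>lborel)"
proof -
  let ?n = "DIM('a)"
  have n: "?n > 0" by simp
  define G where "G = (\<lambda>(x::'a, s::real). ennreal (if norm x < 1 \<and> 0 < s then real ?n * norm x ^ ?n * s ^ (?n - 1) else 0) * F (s *\<^sub>R x))"
  \<comment> \<open>\<open>H\<close> is \<open>G\<close> after \<open>x = y / s\<close>, with the
    Jacobian \<open>s^(-n)\<close> included: together with the homogeneity of
    \<open>norm x ^ n\<close> it turns \<open>s^(n-1)\<close> into \<open>s^(-n-1)\<close>.\<close>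
  define H where "H = (\<lambda>(y::'a, s::real). ennreal (if norm y < s then real ?n * norm y ^ ?n / s ^ (?n + 1) else 0) * F y)"
  have [measurable]: "G \<in> borel_measurable (borel \<Otimes>\<^sub>M borel)" unfolding G_def by measurable
  have [measurable]: "H \<in> borel_measurable (borel \<Otimes>\<^sub>M borel)" unfolding H_def by measurable
  have "(\<integral>\<^sup>+x. \<integral>\<^sup>+r. F (r *\<^sub>R (x /\<^sub>R norm x)) \<partial>radial ?n \<partial>cone_measure) =
      (\<integral>\<^sup>+x. ennreal (if norm x < 1 then real ?n else 0) * (\<integral>\<^sup>+r. ennreal (if 0 < r then r ^ (?n - 1) else 0) * F (r *\<^sub>R (x /\<^sub>R norm x)) \<partial>lborel) \<partial>lborel)"
    unfolding cone_measure_def radial_def by (simp add: nn_integral_density)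
  also have "\<dots> = (\<integral>\<^sup>+x. \<integral>\<^sup>+s. G (x, s) \<partial>lborel \<partial>lborel)"
  proof (intro nn_integral_cong_AE eventually_mono[OF AE_lborel_singleton[of 0]])
    fix x :: 'a assume x: "x \<noteq> 0"
    have "(\<integral>\<^sup>+r. ennreal (if 0 < r then r ^ (?n - 1) else 0) * F (r *\<^sub>R (x /\<^sub>R norm x)) \<partial>lborel) =
      \<bar>norm x\<bar> * (\<integral>\<^sup>+s. ennreal (if 0 < 0 + norm x * s then (0 + norm x * s) ^ (?n - 1) else 0) * F ((0 + norm x * s) *\<^sub>R (x /\<^sub>R norm x)) \<partial>lborel)"
      using x by (intro nn_integral_real_affine) auto
    also have "ennreal (if norm x < 1 then real ?n else 0) * \<dots> = (\<integral>\<^sup>+s. G (x, s) \<partial>lborel)"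
    proof -
      have "ennreal (if norm x < 1 then real ?n else 0) * (ennreal (norm x) *
          (ennreal (if 0 < norm x * s then (norm x * s) ^ (?n - 1) else 0) * F ((norm x * s) *\<^sub>R (x /\<^sub>R norm x)))) = G (x, s)" for s
      proof (cases "s > 0")
        case True
        have "real ?n * norm x ^ ?n * s ^ (?n - 1) = real ?n * (norm x * (norm x * s) ^ (?n - 1))"
          using n by (simp add: power_mult_distrib power_eq_if[of "norm x" ?n])
        then have "ennreal (real ?n * norm x ^ ?n * s ^ (?n - 1)) =
            ennreal (real ?n) * (ennreal (norm x) * ennreal ((norm x * s) ^ (?n - 1)))"
          by (simp only: ennreal_mult' norm_ge_zero of_nat_0_le_iff)
        moreover have "(norm x * s) *\<^sub>R (x /\<^sub>R norm x) = s *\<^sub>R x" using x by simp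
        ultimately show ?thesis using True x
          unfolding G_def by (simp add: mult.assoc del: scaleR_scaleR)
      next
        case False
        then show ?thesis using x by (simp add: G_def zero_less_mult_iff)
      qed
      then have "(\<integral>\<^sup>+s. G (x, s) \<partial>lborel) = (\<integral>\<^sup>+s. ennreal (if norm x < 1 then real ?n else 0) * (ennreal (norm x) *
          (ennreal (if 0 < norm x * s then (norm x * s) ^ (?n - 1) else 0) * F ((norm x * s) *\<^sub>R (x /\<^sub>R norm x)))) \<partial>lborel)"
        by simp
      also have "\<dots> = ennreal (if norm x < 1 then real ?n else 0) * (ennreal (norm x) * (\<integral>\<^sup>+s.
          ennreal (if 0 < norm x * s then (norm x * s) ^ (?n - 1) else 0) * F ((norm x * s) *\<^sub>R (x /\<^sub>R norm x)) \<partial>lborel))"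
        by (subst nn_integral_cmult, measurable, subst nn_integral_cmult, measurable)
      finally show ?thesis by (simp only: add_0 abs_norm_cancel)
    qed
    finally show "ennreal (if norm x < 1 then real ?n else 0) * (\<integral>\<^sup>+r. ennreal (if 0 < r then r ^ (?n - 1) else 0) * F (r *\<^sub>R (x /\<^sub>R norm x)) \<partial>lborel) =
       (\<integral>\<^sup>+s. G (x, s) \<partial>lborel)" .
  qed
  also have "\<dots> = (\<integral>\<^sup>+s. \<integral>\<^sup>+x. G (x, s) \<partial>lborel \<partial>lborel)"
    by (rule lborel_pair.Fubini'[symmetric]) measurable
  also have "\<dots> = (\<integral>\<^sup>+s. \<integral>\<^sup>+y. H (y, s) \<partial>lborel \<partial>lborel)"
  proof (rule nn_integral_cong)
    fix s :: real
    show "(\<integral>\<^sup>+x. G (x, s) \<partial>lborel) = (\<integral>\<^sup>+y. H (y, s) \<partial>lborel)"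
    proof (cases "s > 0")
      case True
      have "ennreal (\<bar>1 / s\<bar> ^ ?n) * G ((1 / s) *\<^sub>R y, s) = H (y, s)" for y
      proof -
        have "norm y < s \<longleftrightarrow> (1 / s) *\<^sub>R y \<in> ball 0 1" using True by (simp add: field_simps)
        moreover have "(1 / s) ^ ?n * (real ?n * (norm y / s) ^ ?n * s ^ (?n - 1)) = real ?n * norm y ^ ?n / s ^ (?n + 1)"
          using True n by (simp add: power_divide power_eq_if[of s ?n] field_simps)
        ultimately show ?thesis using True
          by (simp add: G_def H_def ennreal_mult'[symmetric] mult.assoc[symmetric])
      qed
      then show ?thesis
        using True by (subst nn_integral_lborel_scale[of _ "1 / s"]) (simp_all add: nn_integral_cmult[symmetric])
    next
      case False
      then have "\<not> norm y < s" for y :: 'a using norm_ge_zero[of y] by linarith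
      with False show ?thesis by (simp add: G_def H_def)
    qed
  qed
  also have "\<dots> = (\<integral>\<^sup>+y. \<integral>\<^sup>+s. H (y, s) \<partial>lborel \<partial>lborel)"
    by (rule lborel_pair.Fubini') measurable
  also have "\<dots> = (\<integral>\<^sup>+y. F y \<partial>lborel)"
  proof (intro nn_integral_cong_AE eventually_mono[OF AE_lborel_singleton[of 0]])
    fix y :: 'a assume "y \<noteq> 0"
    then show "(\<integral>\<^sup>+s. H (y, s) \<partial>lborel) = F y"
      using nn_integral_power_tail[of "norm y" ?n] by (simp add: H_def nn_integral_multc)
  qed
  finally show ?thesis .
qed

lemma pair_sigma_finite_polar: "pair_sigma_finite (cone_measure :: 'a::euclidean_space measure) (radial n)"
proof -
  interpret finite_measure "cone_measure :: 'a measure" by (rule finite_measure_cone_measure)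
  show ?thesis
    using sigma_finite_radial sigma_finite_measure_axioms by (simp add: pair_sigma_finite_def)
qed

text \<open>Stated as an identity of image measures, the polar formula extends from nonnegative to
  signed integrands and transfers integrability as well.\<close>

lemma lborel_eq_polar:
  "(lborel :: 'a::euclidean_space measure) =
    distr (cone_measure \<Otimes>\<^sub>M radial DIM('a)) borel (\<lambda>(x, r). r *\<^sub>R (x /\<^sub>R norm x))"
  (is "_ = distr ?P _ ?p")
proof (rule measure_eqI)
  interpret pair_sigma_finite "cone_measure :: 'a measure" "radial DIM('a)" by (rule pair_sigma_finite_polar)
  have p [measurable]: "?p \<in> ?P \<rightarrow>\<^sub>M borel" by measurable
  fix A :: "'a set" assume "A \<in> sets lborel"
  then have A [measurable]: "A \<in> sets borel" by simp
  have "emeasure (distr ?P borel ?p) A = (\<integral>\<^sup>+z. indicator A z \<partial>distr ?P borel ?p)"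
    by (subst nn_integral_indicator) auto
  also have "\<dots> = (\<integral>\<^sup>+z. indicator A (?p z) \<partial>?P)"
    by (rule nn_integral_distr) measurable
  also have "\<dots> = (\<integral>\<^sup>+x. \<integral>\<^sup>+r. indicator A (?p (x, r)) \<partial>radial DIM('a) \<partial>cone_measure)"
    by (rule M2.nn_integral_fst[symmetric]) measurable
  also have "\<dots> = (\<integral>\<^sup>+x. indicator A x \<partial>lborel)"
    using nn_integral_polar[of "indicator A"] by simp
  finally show "emeasure lborel A = emeasure (distr ?P borel ?p) A" by simp
qed simp

lemma sphere_integral_cone:
  fixes h :: "'a::euclidean_space \<Rightarrow> real"
  assumes [measurable]: "(\<lambda>x. h (x /\<^sub>R norm x)) \<in> borel_measurable borel"
  shows "sphere_integral h = (\<integral>x. h (x /\<^sub>R norm x) \<partial>cone_measure)"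
proof -
  have "(\<integral>x. h (x /\<^sub>R norm x) \<partial>cone_measure) = (\<integral>x. (if norm x < 1 then real DIM('a) else 0) *\<^sub>R h (x /\<^sub>R norm x) \<partial>lborel)"
    unfolding cone_measure_def by (rule integral_density) auto
  also have "\<dots> = (\<integral>x. real DIM('a) * (indicator (ball 0 1) x *\<^sub>R h (x /\<^sub>R norm x)) \<partial>lborel)"
    by (rule Bochner_Integration.integral_cong) (auto simp: indicator_def)
  also have "\<dots> = sphere_integral h"
    unfolding sphere_integral_def set_lebesgue_integral_def by (rule integral_mult_right_zero)
  finally show ?thesis by simp
qed

lemma normalize_scaled:
  "r > 0 \<Longrightarrow> x \<noteq> 0 \<Longrightarrow> (r *\<^sub>R (x /\<^sub>R norm x)) /\<^sub>R norm (r *\<^sub>R (x /\<^sub>R norm x)) = (x::'a::real_normed_vector) /\<^sub>R norm x"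
  "r > 0 \<Longrightarrow> x \<noteq> 0 \<Longrightarrow> norm (r *\<^sub>R (x /\<^sub>R norm x)) = r"
  "r > 0 \<Longrightarrow> x \<noteq> 0 \<Longrightarrow> (r *\<^sub>R (x /\<^sub>R norm x)) /\<^sub>R r = x /\<^sub>R norm x"
  by (auto simp: field_simps)

lemma AE_radial_pos: "AE r in radial n. r > 0"
  unfolding radial_def by (subst AE_density) auto

text \<open>Along a ray the factor \<open>H\<close> is constant and leaves the radial integral,
  while the homogeneous factor becomes \<open>r powr q\<close>.\<close>

lemma integral_homogeneous_polar:
  fixes H \<psi> :: "'a::euclidean_space \<Rightarrow> real"
  assumes int: "integrable lborel (\<lambda>x. norm x powr q * H (x /\<^sub>R norm x) * \<psi> x)"
    and H [measurable]: "(\<lambda>x. H (x /\<^sub>R norm x)) \<in> borel_measurable borel"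
    and \<psi> [measurable]: "\<psi> \<in> borel_measurable borel"
  shows "(\<integral>x. norm x powr q * H (x /\<^sub>R norm x) * \<psi> x \<partial>lborel) =
    sphere_integral (\<lambda>\<theta>. H \<theta> * (\<integral>r. r powr q * \<psi> (r *\<^sub>R \<theta>) \<partial>radial DIM('a)))"
proof -
  let ?n = "DIM('a)" and ?P = "cone_measure \<Otimes>\<^sub>M radial DIM('a) :: ('a \<times> real) measure"
  let ?p = "\<lambda>(x::'a, r::real). r *\<^sub>R (x /\<^sub>R norm x)"
  let ?F = "\<lambda>x. norm x powr q * H (x /\<^sub>R norm x) * \<psi> x"
  interpret pair_sigma_finite "cone_measure :: 'a measure" "radial DIM('a)" by (rule pair_sigma_finite_polar)
  have p [measurable]: "?p \<in> ?P \<rightarrow>\<^sub>M borel" by measurable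
  have F [measurable]: "?F \<in> borel_measurable borel" by measurable
  have "integrable (distr ?P borel ?p) ?F" using int by (subst lborel_eq_polar[symmetric])
  then have i: "integrable ?P (\<lambda>z. ?F (?p z))" by (rule integrable_distr[OF p])
  have "(\<integral>x. ?F x \<partial>lborel) = (\<integral>x. ?F x \<partial>distr ?P borel ?p)" by (subst lborel_eq_polar[symmetric]) (rule refl)
  also have "\<dots> = (\<integral>z. ?F (?p z) \<partial>?P)" by (rule integral_distr) measurable
  also have "\<dots> = (\<integral>x. \<integral>r. ?F (?p (x, r)) \<partial>radial ?n \<partial>cone_measure)"
    using integral_fst'[OF i] by simp
  also have "\<dots> = (\<integral>x. H (x /\<^sub>R norm x) * (\<integral>r. r powr q * \<psi> (r *\<^sub>R (x /\<^sub>R norm x)) \<partial>radial ?n) \<partial>cone_measure)"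
  proof (rule integral_cong_AE)
    show "AE x in cone_measure. (\<integral>r. ?F (?p (x, r)) \<partial>radial ?n) =
       H (x /\<^sub>R norm x) * (\<integral>r. r powr q * \<psi> (r *\<^sub>R (x /\<^sub>R norm x)) \<partial>radial ?n)"
    proof (rule eventually_mono[OF AE_cone_measure_nonzero])
      fix x :: 'a assume x: "x \<noteq> 0"
      have "(\<integral>r. ?F (?p (x, r)) \<partial>radial ?n) = (\<integral>r. H (x /\<^sub>R norm x) * (r powr q * \<psi> (r *\<^sub>R (x /\<^sub>R norm x))) \<partial>radial ?n)"
      proof (rule integral_cong_AE)
        show "AE r in radial ?n. ?F (?p (x, r)) = H (x /\<^sub>R norm x) * (r powr q * \<psi> (r *\<^sub>R (x /\<^sub>R norm x)))"
          by (rule eventually_mono[OF AE_radial_pos])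
            (use x in \<open>simp add: normalize_scaled mult_ac del: scaleR_scaleR norm_scaleR\<close>)
        show "(\<lambda>r. ?F (?p (x, r))) \<in> borel_measurable (radial ?n)"
        proof -
          have "(\<lambda>r. ?p (x, r)) \<in> radial ?n \<rightarrow>\<^sub>M borel" by simp
          from measurable_compose[OF this F] show ?thesis .
        qed
      qed measurable
      then show "(\<integral>r. ?F (?p (x, r)) \<partial>radial ?n) =
         H (x /\<^sub>R norm x) * (\<integral>r. r powr q * \<psi> (r *\<^sub>R (x /\<^sub>R norm x)) \<partial>radial ?n)" by simp
    qed
    show "(\<lambda>x. \<integral>r. ?F (?p (x, r)) \<partial>radial ?n) \<in> borel_measurable cone_measure"
      using integrable_fst'[OF i] by (rule borel_measurable_integrable)
    show "(\<lambda>x. H (x /\<^sub>R norm x) * (\<integral>r. r powr q * \<psi> (r *\<^sub>R (x /\<^sub>R norm x)) \<partial>radial ?n)) \<in> borel_measurable cone_measure"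
      using M2.borel_measurable_lebesgue_integral[of "\<lambda>x r. r powr q * \<psi> (r *\<^sub>R (x /\<^sub>R norm x))" "cone_measure :: 'a measure"]
      by measurable
  qed
  also have "\<dots> = sphere_integral (\<lambda>\<theta>. H \<theta> * (\<integral>r. r powr q * \<psi> (r *\<^sub>R \<theta>) \<partial>radial ?n))"
  proof (rule sphere_integral_cone[symmetric])
    show "(\<lambda>x. H (x /\<^sub>R norm x) * (\<integral>r. r powr q * \<psi> (r *\<^sub>R (x /\<^sub>R norm x)) \<partial>radial ?n)) \<in> borel_measurable borel"
      using M2.borel_measurable_lebesgue_integral[of "\<lambda>x r. r powr q * \<psi> (r *\<^sub>R (x /\<^sub>R norm x))" "borel :: 'a measure"]
      by measurable
  qed
  finally show ?thesis .
qed

section \<open>Integrability of powers against rapid decay\<close>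

lemma integrable_powr_split:
  fixes a b :: real
  assumes "a > -1" "b < -1"
  shows "integrable lborel (\<lambda>r. if 0 < r then if r \<le> 1 then r powr a else r powr b else 0)"
proof -
  have lb: "integrable lborel (\<lambda>r. indicator S r *\<^sub>R f r)" if "f integrable_on S" "\<And>x. x \<in> S \<Longrightarrow> 0 \<le> f x"
    "f \<in> borel_measurable borel" "S \<in> sets borel" for f :: "real \<Rightarrow> real" and S
    using nonnegative_absolutely_integrable_1[OF that(1,2)] that(3,4)
    by (simp add: set_integrable_def integrable_completion)
  have "integrable lborel (\<lambda>r. indicator {0..1} r *\<^sub>R r powr a)"
    using assms by (intro lb integrable_on_powr_from_0) auto
  moreover have "(\<lambda>r. r powr b) integrable_on {1..}"
    using has_integral_powr_to_inf[of b 1] assms by (auto simp: integrable_on_def)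
  then have "integrable lborel (\<lambda>r. indicator {1..} r *\<^sub>R r powr b)"
    by (intro lb) auto
  ultimately have "integrable lborel (\<lambda>r. indicator {0..1} r *\<^sub>R r powr a + indicator {1..} r *\<^sub>R r powr b)"
    by (rule Bochner_Integration.integrable_add)
  then show ?thesis
    by (rule Bochner_Integration.integrable_bound) (auto simp: indicator_def)
qed

lemma integrable_radial_iff:
  fixes f :: "real \<Rightarrow> real"
  assumes [measurable]: "f \<in> borel_measurable borel"
  shows "integrable (radial n) f \<longleftrightarrow> integrable lborel (\<lambda>r. (if 0 < r then r ^ (n - 1) else 0) * f r)"
  unfolding radial_def by (subst integrable_density) auto

text \<open>The condition on \<open>N\<close> bounds the exponent \<open>n - 1 + q - 2 N\<close> of
  the tail by -2; near 0 the factor \<open>r powr q\<close> is already integrable.\<close>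

lemma integrable_radial_decay:
  assumes "q > 0" "n > 0" "q + real n + 1 \<le> 2 * real N"
  shows "integrable (radial n) (\<lambda>r. r powr q / (1 + r\<^sup>2) ^ N)"
proof (subst integrable_radial_iff)
  show "integrable lborel (\<lambda>r. (if 0 < r then r ^ (n - 1) else 0) * (r powr q / (1 + r\<^sup>2) ^ N))"
  proof (rule Bochner_Integration.integrable_bound)
    show "integrable lborel (\<lambda>r::real. if 0 < r then if r \<le> 1 then r powr q else r powr (-2) else 0)"
      using assms by (intro integrable_powr_split) auto
    have "r ^ (n - 1) * (r powr q / (1 + r\<^sup>2) ^ N) \<le> (if r \<le> 1 then r powr q else r powr (-2))" if "r > 0" for r :: real
    proof (cases "r \<le> 1")
      case True
      have "1 \<le> (1 + r\<^sup>2) ^ N" by (rule one_le_power) simp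
      then have "r powr q / (1 + r\<^sup>2) ^ N \<le> r powr q / 1" by (intro frac_le) auto
      then show ?thesis
        using True that mult_mono[OF power_le_one[of r "n - 1"], of "r powr q / (1 + r\<^sup>2) ^ N" "r powr q"] by simp
    next
      case False
      have "(r\<^sup>2) ^ N \<le> (1 + r\<^sup>2) ^ N" by (rule power_mono) auto
      then have "r powr q / (1 + r\<^sup>2) ^ N \<le> r powr q / (r\<^sup>2) ^ N"
        using that by (intro frac_le) auto
      then have "r ^ (n - 1) * (r powr q / (1 + r\<^sup>2) ^ N) \<le> r ^ (n - 1) * (r powr q / (r\<^sup>2) ^ N)"
        using that by (intro mult_left_mono) auto
      also have "\<dots> = r powr (real (n - 1) + q - real (2 * N))"
        using that by (simp add: powr_add powr_diff powr_realpow power_mult[symmetric] field_simps del: of_nat_mult of_nat_diff)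
      also have "\<dots> \<le> r powr (-2)"
        using False assms by (intro powr_mono) (auto simp: of_nat_diff)
      finally show ?thesis using False by simp
    qed
    then show "AE r in lborel. norm ((if 0 < r then r ^ (n - 1) else 0) * (r powr q / (1 + r\<^sup>2) ^ N))
       \<le> norm (if 0 < r then if r \<le> 1 then r powr q else r powr (-2) else 0)"
      by (auto simp: abs_mult)
  qed auto
qed auto

lemma integrable_norm_powr_decay:
  assumes "q > 0" "q + real DIM('a) + 1 \<le> 2 * real N"
  shows "integrable lborel (\<lambda>x::'a::euclidean_space. norm x powr q / (1 + (norm x)\<^sup>2) ^ N)"
proof (rule integrableI_bounded)
  interpret finite_measure "cone_measure :: 'a measure" by (rule finite_measure_cone_measure)
  let ?I = "\<integral>\<^sup>+r. ennreal (r powr q / (1 + r\<^sup>2) ^ N) \<partial>radial DIM('a)"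
  have "(\<integral>\<^sup>+x. ennreal (norm (norm x powr q / (1 + (norm x)\<^sup>2) ^ N)) \<partial>(lborel :: 'a measure)) =
     (\<integral>\<^sup>+x. \<integral>\<^sup>+r. ennreal (norm (norm (r *\<^sub>R (x /\<^sub>R norm x)) powr q / (1 + (norm (r *\<^sub>R ((x::'a) /\<^sub>R norm x)))\<^sup>2) ^ N)) \<partial>radial DIM('a) \<partial>cone_measure)"
    by (rule nn_integral_polar[symmetric]) measurable
  also have "\<dots> = (\<integral>\<^sup>+(x::'a). ?I \<partial>cone_measure)"
  proof (rule nn_integral_cong_AE, rule eventually_mono[OF AE_cone_measure_nonzero])
    fix x :: 'a assume x: "x \<noteq> 0"
    show "(\<integral>\<^sup>+r. ennreal (norm (norm (r *\<^sub>R (x /\<^sub>R norm x)) powr q / (1 + (norm (r *\<^sub>R (x /\<^sub>R norm x)))\<^sup>2) ^ N)) \<partial>radial DIM('a)) = ?I"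
      using x by (intro nn_integral_cong_AE eventually_mono[OF AE_radial_pos])
        (simp add: normalize_scaled abs_divide power_abs del: scaleR_scaleR norm_scaleR)
  qed
  also have "\<dots> = ?I * emeasure (cone_measure :: 'a measure) UNIV" by simp
  also have "\<dots> < \<infinity>"
  proof -
    have "?I < \<infinity>"
      using integrable_radial_decay[of q "DIM('a)" N] assms by (simp add: integrable_iff_bounded)
    moreover have "emeasure (cone_measure :: 'a measure) UNIV < \<infinity>"
      using iffD1[OF less_top emeasure_finite] by simp
    ultimately show ?thesis by (simp add: ennreal_mult_less_top)
  qed
  finally show "(\<integral>\<^sup>+x. ennreal (norm (norm x powr q / (1 + (norm x)\<^sup>2) ^ N)) \<partial>(lborel :: 'a measure)) < \<infinity>" .
qed measurable

text \<open>Polynomial growth against rapid decay. The sum \<open>1 + norm x powr q\<close> is at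
  most 2 on the unit ball and at most \<open>2 * norm x powr q\<close> outside, which reduces
  everything to the pure power.\<close>

lemma integrable_powr_cos_ft:
  fixes w :: "'a::euclidean_space \<Rightarrow> real"
  assumes w: "test_fun UNIV w" and q: "q > 0"
    and k: "k \<in> borel_measurable borel" and bound: "\<And>x. \<bar>k x\<bar> \<le> C * (1 + norm x powr q)"
  shows "integrable lborel (\<lambda>x. k x * cos_ft w x)"
proof -
  obtain N :: nat where N: "(q + 1) + real DIM('a) + 1 \<le> 2 * real N"
    using real_arch_simple[of "(q + real DIM('a) + 2) / 2"] by (auto simp: field_simps)
  obtain D where D: "D \<ge> 0" "\<And>x. \<bar>cos_ft w x\<bar> \<le> D / (1 + (norm x)\<^sup>2) ^ N"
    using cos_ft_decay[OF w, of N] by auto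
  have [measurable]: "cos_ft w \<in> borel_measurable borel" by (rule borel_measurable_cos_ft[OF w])
  note [measurable] = k
  have C: "C \<ge> 0" using bound[of 0] by simp
  show ?thesis
  proof (rule Bochner_Integration.integrable_bound)
    let ?B = "\<lambda>x::'a. C * D * (indicator (cball 0 1) x * 2 + 2 * (norm x powr q / (1 + (norm x)\<^sup>2) ^ N))"
    have "emeasure lborel (cball (0::'a) 1) < \<infinity>" by (rule emeasure_compact_finite) simp
    then show "integrable lborel ?B"
      using q N by (intro integrable_mult_right Bochner_Integration.integrable_add integrable_norm_powr_decay
          integrable_mult_left integrable_real_indicator) auto
    have "\<bar>k x * cos_ft w x\<bar> \<le> ?B x" for x
    proof -
      have "\<bar>k x * cos_ft w x\<bar> \<le> (C * (1 + norm x powr q)) * (D / (1 + (norm x)\<^sup>2) ^ N)"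
        unfolding abs_mult using bound D C by (intro mult_mono) auto
      also have "\<dots> = C * D * ((1 + norm x powr q) / (1 + (norm x)\<^sup>2) ^ N)" by simp
      also have "\<dots> \<le> ?B x"
      proof (intro mult_left_mono)
        have p: "1 \<le> (1 + (norm x)\<^sup>2) ^ N" by (rule one_le_power) simp
        show "(1 + norm x powr q) / (1 + (norm x)\<^sup>2) ^ N \<le> indicator (cball 0 1) x * 2 + 2 * (norm x powr q / (1 + (norm x)\<^sup>2) ^ N)"
        proof (cases "norm x \<le> 1")
          case True
          then have "norm x powr q \<le> 1" using q by (intro powr_le1) auto
          then have "(1 + norm x powr q) / (1 + (norm x)\<^sup>2) ^ N \<le> 2 / 1"
            using p by (intro frac_le) auto
          moreover have "0 \<le> norm x powr q / (1 + (norm x)\<^sup>2) ^ N" by simp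
          moreover have "indicator (cball 0 1) x = (1::real)" using True by simp
          ultimately show ?thesis by linarith
        next
          case False
          then have "1 \<le> norm x powr q" using q by (intro ge_one_powr_ge_zero) auto
          then have "(1 + norm x powr q) / (1 + (norm x)\<^sup>2) ^ N \<le> (2 * norm x powr q) / (1 + (norm x)\<^sup>2) ^ N"
            using p by (intro divide_right_mono) auto
          then show ?thesis using False by simp
        qed
      qed (use C D in auto)
      finally show ?thesis .
    qed
    then show "AE x in lborel. norm (k x * cos_ft w x) \<le> norm (?B x)"
      by (intro AE_I2) (smt (verit) real_norm_def)
  qed measurable
qed

subsection \<open>Fourier inversion\<close>

text \<open>Licenses the exchanges of integrals with a bounded kernel: cosines in the Fourier
  arguments, and \<open>|x \<bullet> y|\<close> to the power \<open>q\<close> on pairs of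
  directions.\<close>

lemma (in pair_sigma_finite) integrable_pair_bounded:
  fixes a :: "'a \<Rightarrow> real" and b :: "'b \<Rightarrow> real" and k :: "'a \<Rightarrow> 'b \<Rightarrow> real"
  assumes a: "integrable M1 a" and b: "integrable M2 b"
    and k [measurable]: "(\<lambda>(x, y). k x y) \<in> borel_measurable (M1 \<Otimes>\<^sub>M M2)"
    and bound: "AE x in M1. AE y in M2. \<bar>k x y\<bar> \<le> C"
  shows "integrable (M1 \<Otimes>\<^sub>M M2) (\<lambda>(x, y). k x y * (a x * b y))"
proof -
  have [measurable]: "a \<in> borel_measurable M1" "b \<in> borel_measurable M2"
    using a b by auto
  have i: "AE x in M1. integrable M2 (\<lambda>y. k x y * (a x * b y)) \<and>
      norm (\<integral>y. norm (k x y * (a x * b y)) \<partial>M2) \<le> norm (\<bar>a x\<bar> * (\<bar>C\<bar> * (\<integral>y. \<bar>b y\<bar> \<partial>M2)))"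
    using bound AE_space
  proof eventually_elim
    fix x assume x: "AE y in M2. \<bar>k x y\<bar> \<le> C" "x \<in> space M1"
    have [measurable]: "(\<lambda>y. k x y) \<in> borel_measurable M2"
      using measurable_Pair2[OF k x(2)] by simp
    have le: "AE y in M2. norm (k x y * (a x * b y)) \<le> \<bar>a x\<bar> * (\<bar>C\<bar> * \<bar>b y\<bar>)"
      using x(1)
    proof eventually_elim
      fix y assume "\<bar>k x y\<bar> \<le> C"
      then have "\<bar>k x y\<bar> * (\<bar>a x\<bar> * \<bar>b y\<bar>) \<le> \<bar>C\<bar> * (\<bar>a x\<bar> * \<bar>b y\<bar>)"
        by (intro mult_right_mono) auto
      then show "norm (k x y * (a x * b y)) \<le> \<bar>a x\<bar> * (\<bar>C\<bar> * \<bar>b y\<bar>)" by (simp add: abs_mult mult_ac)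
    qed
    have ib: "integrable M2 (\<lambda>y. \<bar>a x\<bar> * (\<bar>C\<bar> * \<bar>b y\<bar>))" using b by auto
    have 1: "integrable M2 (\<lambda>y. k x y * (a x * b y))"
      by (rule Bochner_Integration.integrable_bound[OF ib]) (use le in \<open>auto simp: abs_mult\<close>)
    have "(\<integral>y. norm (k x y * (a x * b y)) \<partial>M2) \<le> (\<integral>y. \<bar>a x\<bar> * (\<bar>C\<bar> * \<bar>b y\<bar>) \<partial>M2)"
      using 1 ib le by (intro integral_mono_AE) auto
    then show "integrable M2 (\<lambda>y. k x y * (a x * b y)) \<and>
      norm (\<integral>y. norm (k x y * (a x * b y)) \<partial>M2) \<le> norm (\<bar>a x\<bar> * (\<bar>C\<bar> * (\<integral>y. \<bar>b y\<bar> \<partial>M2)))"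
      using 1 by (simp add: abs_mult integral_nonneg_AE)
  qed
  show ?thesis
  proof (rule Fubini_integrable)
    show "AE x in M1. integrable M2 (\<lambda>y. case (x, y) of (x, y) \<Rightarrow> k x y * (a x * b y))"
      using i by (auto elim: eventually_mono)
    show "integrable M1 (\<lambda>x. \<integral>y. norm (case (x, y) of (x, y) \<Rightarrow> k x y * (a x * b y)) \<partial>M2)"
    proof (rule Bochner_Integration.integrable_bound)
      show "integrable M1 (\<lambda>x. \<bar>a x\<bar> * (\<bar>C\<bar> * (\<integral>y. \<bar>b y\<bar> \<partial>M2)))" using a by auto
      show "AE x in M1. norm (\<integral>y. norm (case (x, y) of (x, y) \<Rightarrow> k x y * (a x * b y)) \<partial>M2)
          \<le> norm (\<bar>a x\<bar> * (\<bar>C\<bar> * (\<integral>y. \<bar>b y\<bar> \<partial>M2)))"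
        using i by (auto elim: eventually_mono)
    qed measurable
  qed measurable
qed

section \<open>The Gaussian and Fourier inversion\<close>

definition gauss :: "'a::euclidean_space \<Rightarrow> real" where
  "gauss x = exp (- ((norm x)\<^sup>2) / 2)"

text \<open>The integral of \<open>gauss\<close> in dimension \<open>n\<close>; its square is the
  constant of Fourier inversion.\<close>

definition gauss_mass :: "nat \<Rightarrow> real" where
  "gauss_mass n = sqrt (2 * pi) ^ n"

lemma gauss_mass_pos: "gauss_mass n > 0"
  by (simp add: gauss_mass_def)

lemma borel_measurable_gauss [measurable]: "gauss \<in> borel_measurable borel"
  unfolding gauss_def[abs_def] by measurable

lemma gauss_le_1: "gauss x \<le> 1" and gauss_pos: "gauss x > 0"
  by (auto simp: gauss_def)

lemma prod_exp_gauss: "(\<Prod>b\<in>Basis. exp (- (x \<bullet> b)\<^sup>2 / 2)) = gauss (x::'a::euclidean_space)"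
  unfolding gauss_def by (subst exp_sum[symmetric]) (simp_all add: sum_negf sum_divide_distrib[symmetric] sum_Basis_inner_sq)

lemma prod_std_normal_density:
  "(\<Prod>b\<in>Basis. std_normal_density (x \<bullet> b)) = gauss (x::'a::euclidean_space) / gauss_mass DIM('a)"
  using prod_exp_gauss[of x] by (simp add: std_normal_density_def prod.distrib prod_dividef gauss_mass_def)

text \<open>The Gaussian and the character both factor over the coordinates, which leaves the
  characteristic function of the standard normal distribution in each of them.\<close>

lemma gauss_fourier:
  fixes z :: "'a::euclidean_space"
  shows "integrable lborel (\<lambda>x. complex_of_real (gauss x) * cis (x \<bullet> z))"
    and "(\<integral>x. complex_of_real (gauss x) * cis (x \<bullet> z) \<partial>lborel) = of_real (gauss_mass DIM('a) * gauss z)"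
proof -
  interpret product_sigma_finite "\<lambda>_::'a. lborel :: real measure" ..
  define f where "f b t = complex_of_real (std_normal_density t) * cis (t * (z \<bullet> b))" for b :: 'a and t :: real
  have [measurable]: "f b \<in> borel_measurable borel" for b unfolding f_def[abs_def] cis_conv_exp by measurable
  have intf: "integrable lborel (f b)" for b
    by (rule Bochner_Integration.integrable_bound[OF integrable_normal_density[of 1 0]])
      (auto simp: f_def norm_mult)
  have f1: "(\<integral>t. f b t \<partial>lborel) = complex_of_real (exp (- ((z \<bullet> b)\<^sup>2) / 2))" for b
  proof -
    have "char std_normal_distribution (z \<bullet> b) = (\<integral>t. f b t \<partial>lborel)"
      unfolding char_def f_def cis_conv_exp
      by (subst integral_density) (auto simp: scaleR_conv_of_real mult_ac)
    then show ?thesis by (simp add: char_std_normal_distribution)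
  qed
  let ?P = "Pi\<^sub>M Basis (\<lambda>_::'a. lborel :: real measure)"
  let ?e = "\<lambda>g. \<Sum>b\<in>Basis. g b *\<^sub>R (b::'a)"
  let ?F = "\<lambda>x::'a. \<Prod>b\<in>Basis. f b (x \<bullet> b)"
  have m: "?e \<in> ?P \<rightarrow>\<^sub>M borel" by measurable
  have coord: "?F (?e g) = (\<Prod>b\<in>Basis. f b (g b))" for g by simp
  have F: "?F x = complex_of_real (gauss x / gauss_mass DIM('a)) * cis (x \<bullet> z)" for x
  proof -
    have "?F x = complex_of_real (\<Prod>b\<in>Basis. std_normal_density (x \<bullet> b)) * (\<Prod>b\<in>Basis. cis ((x \<bullet> b) * (z \<bullet> b)))"
      by (simp add: f_def prod.distrib)
    also have "(\<Prod>b\<in>Basis. cis ((x \<bullet> b) * (z \<bullet> b))) = cis (x \<bullet> z)"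
      by (subst euclidean_inner) (simp add: cis_conv_exp exp_sum[symmetric] sum_distrib_left)
    finally show ?thesis by (simp only: prod_std_normal_density)
  qed
  have "integrable ?P (\<lambda>g. \<Prod>b\<in>Basis. f b (g b))"
    by (rule product_integrable_prod) (auto intro: intf)
  then have "integrable lborel ?F"
    by (subst lborel_eq, subst integrable_distr_eq[OF m]) (simp_all add: coord)
  then have "integrable lborel (\<lambda>x. of_real (gauss_mass DIM('a)) * ?F x)" by (rule integrable_mult_right)
  then show "integrable lborel (\<lambda>x. complex_of_real (gauss x) * cis (x \<bullet> z))"
    using gauss_mass_pos[of "DIM('a)"] by (simp add: F)
  have "(\<integral>x. ?F x \<partial>lborel) = (\<integral>g. ?F (?e g) \<partial>?P)"
    by (subst lborel_eq, subst integral_distr[OF m]) simp_all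
  also have "\<dots> = (\<Prod>b\<in>Basis. \<integral>t. f b t \<partial>lborel)"
    unfolding coord by (rule product_integral_prod) (auto intro: intf)
  also have "\<dots> = of_real (gauss z)"
    unfolding f1 prod_exp_gauss[symmetric] by (simp only: of_real_prod)
  finally have "of_real (gauss_mass DIM('a)) * (\<integral>x. ?F x \<partial>lborel) = of_real (gauss_mass DIM('a) * gauss z)" by simp
  moreover have "complex_of_real (gauss x) * cis (x \<bullet> z) = of_real (gauss_mass DIM('a)) * ?F x" for x
    using gauss_mass_pos[of "DIM('a)"] by (simp add: F)
  ultimately show "(\<integral>x. complex_of_real (gauss x) * cis (x \<bullet> z) \<partial>lborel) = of_real (gauss_mass DIM('a) * gauss z)"
    by (simp only: integral_mult_right_zero)
qed

lemma integrable_gauss: "integrable lborel (gauss :: 'a::euclidean_space \<Rightarrow> real)"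
  using integrable_Re[OF gauss_fourier(1)[of 0]] by simp

lemma cos_ft_gauss: "cos_ft gauss (z::'a::euclidean_space) = gauss_mass DIM('a) * gauss z"
proof -
  have "cos_ft gauss z = (\<integral>x. Re (complex_of_real (gauss x) * cis (x \<bullet> z)) \<partial>lborel)"
    unfolding cos_ft_def by (simp add: inner_commute mult.commute)
  also have "\<dots> = Re (\<integral>x. complex_of_real (gauss x) * cis (x \<bullet> z) \<partial>lborel)"
    by (rule integral_Re[OF gauss_fourier(1)])
  finally show ?thesis by (simp add: gauss_fourier(2))
qed

lemma lborel_integral_scale:
  fixes f :: "'a::euclidean_space \<Rightarrow> real"
  assumes [measurable]: "f \<in> borel_measurable borel" and "c > 0"
  shows "(\<integral>x. f x \<partial>lborel) = c ^ DIM('a) * (\<integral>x. f (c *\<^sub>R x) \<partial>lborel)"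
  using assms(2) by (subst lborel_affine[of c 0]) (simp_all add: integral_density integral_distr)

text \<open>Gaussian regularisation: pairing \<open>cos_ft v\<close> with the Gaussian dilated by
  \<open>e n\<close> equals, up to a constant, pairing the dilated \<open>v\<close> with the
  Gaussian. As \<open>e n\<close> tends to 0, one side gives the integral of \<open>cos_ft v\<close>
  and the other \<open>v 0\<close> times the mass of the Gaussian.\<close>

lemma gauss_inversion_at_0:
  fixes v :: "'a::euclidean_space \<Rightarrow> real"
  assumes v: "continuous_on UNIV v" "\<And>x. R < norm x \<Longrightarrow> v x = 0" and i: "integrable lborel (cos_ft v)"
  shows "(\<integral>x. cos_ft v x \<partial>lborel) = (gauss_mass DIM('a))\<^sup>2 * v 0"
proof -
  let ?n = "DIM('a)"
  let ?G = "gauss_mass ?n"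
  define e where "e n = 1 / (real n + 1)" for n
  have e: "e n > 0" for n by (simp add: e_def)
  have e_lim: "e \<longlonglongrightarrow> 0" unfolding e_def by real_asymp
  have [measurable]: "v \<in> borel_measurable borel" using v(1) by (rule borel_measurable_continuous_onI)
  have [measurable]: "cos_ft v \<in> borel_measurable borel" using i by auto
  have iv: "integrable lborel v" by (rule integrable_compact_support[OF v])
  obtain C where C: "C \<ge> 0" "\<And>x. \<bar>v x\<bar> \<le> C" using bounded_compact_support[OF v] by metis
  have cont_gauss: "continuous_on UNIV (gauss :: 'a \<Rightarrow> real)"
    unfolding gauss_def[abs_def] by (intro continuous_intros) auto
  have to_0: "(\<lambda>n. e n *\<^sub>R x) \<longlonglongrightarrow> 0" for x :: 'a
    using tendsto_scaleR[OF e_lim tendsto_const[of x]] by simp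
  have cont0: "(\<lambda>n. k (e n *\<^sub>R x)) \<longlonglongrightarrow> k 0" if "continuous_on UNIV k" for k :: "'a \<Rightarrow> real" and x
    using continuous_on_tendsto_compose[OF that to_0] by simp
  have "(\<lambda>n. \<integral>x. cos_ft v x * gauss (e n *\<^sub>R x) \<partial>lborel) \<longlonglongrightarrow> (\<integral>x. cos_ft v x \<partial>lborel)"
  proof (rule integral_dominated_convergence[where w = "\<lambda>x. \<bar>cos_ft v x\<bar>"])
    show "AE x in lborel. (\<lambda>n. cos_ft v x * gauss (e n *\<^sub>R x)) \<longlonglongrightarrow> cos_ft v x"
    proof (rule AE_I2)
      fix x show "(\<lambda>n. cos_ft v x * gauss (e n *\<^sub>R x)) \<longlonglongrightarrow> cos_ft v x"
        using tendsto_mult[OF tendsto_const cont0[OF cont_gauss, of x]] by (simp add: gauss_def)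
    qed
    show "AE x in lborel. norm (cos_ft v x * gauss (e n *\<^sub>R x)) \<le> \<bar>cos_ft v x\<bar>" for n
      by (intro AE_I2) (simp add: abs_mult abs_of_pos[OF gauss_pos] mult_left_le gauss_le_1)
  qed (use i in auto)
  moreover have "(\<integral>x. cos_ft v x * gauss (e n *\<^sub>R x) \<partial>lborel) = ?G * (\<integral>u. v (e n *\<^sub>R u) * gauss u \<partial>lborel)" for n
  proof -
    have ig: "integrable lborel (\<lambda>x::'a. gauss (e n *\<^sub>R x))"
    proof -
      have "integrable (density (distr lborel borel (\<lambda>x. 0 + e n *\<^sub>R x)) (\<lambda>_. \<bar>e n\<bar>^DIM('a))) (gauss :: 'a \<Rightarrow> real)"
        using lborel_affine[of "e n" "0::'a"] e[of n] integrable_gauss by simp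
      then show ?thesis using e[of n] by (simp add: integrable_density integrable_distr_eq)
    qed
    have i2: "integrable (lborel \<Otimes>\<^sub>M lborel) (\<lambda>(x, y). cos (x \<bullet> y) * (gauss (e n *\<^sub>R x) * v y))"
      by (rule lborel_pair.integrable_pair_bounded[OF ig iv, where C = 1]) auto
    have "(\<integral>x. cos_ft v x * gauss (e n *\<^sub>R x) \<partial>lborel) = (\<integral>x. \<integral>y. cos (x \<bullet> y) * (gauss (e n *\<^sub>R x) * v y) \<partial>lborel \<partial>lborel)"
      unfolding cos_ft_def by (simp add: mult_ac flip: integral_mult_right_zero)
    also have "\<dots> = (\<integral>y. \<integral>x. cos (x \<bullet> y) * (gauss (e n *\<^sub>R x) * v y) \<partial>lborel \<partial>lborel)"
      by (rule lborel_pair.Fubini_integral[OF i2, symmetric])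
    \<comment> \<open>The inner integral is the transform of a dilated Gaussian, hence explicit;
      rescaling \<open>y\<close> afterwards cancels its Jacobian.\<close>
    also have "\<dots> = (\<integral>y. v y * ((1 / e n) ^ ?n * (?G * gauss ((1 / e n) *\<^sub>R y))) \<partial>lborel)"
    proof (rule Bochner_Integration.integral_cong[OF refl])
      fix y :: 'a
      have "(\<integral>x. cos (x \<bullet> y) * (gauss (e n *\<^sub>R x) * v y) \<partial>lborel) = v y * (\<integral>x. cos (x \<bullet> y) * gauss (e n *\<^sub>R x) \<partial>lborel)"
        by (simp add: mult_ac flip: integral_mult_right_zero)
      also have "(\<integral>x. cos (x \<bullet> y) * gauss (e n *\<^sub>R x) \<partial>lborel) =
          (1 / e n) ^ ?n * (\<integral>x. cos (((1 / e n) *\<^sub>R x) \<bullet> y) * gauss (e n *\<^sub>R ((1 / e n) *\<^sub>R x)) \<partial>lborel)"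
        using e[of n] by (intro lborel_integral_scale) auto
      also have "(\<integral>x. cos (((1 / e n) *\<^sub>R x) \<bullet> y) * gauss (e n *\<^sub>R ((1 / e n) *\<^sub>R x)) \<partial>lborel) = cos_ft gauss ((1 / e n) *\<^sub>R y)"
        using e[of n] unfolding cos_ft_def by (simp add: inner_commute)
      finally show "(\<integral>x. cos (x \<bullet> y) * (gauss (e n *\<^sub>R x) * v y) \<partial>lborel) = v y * ((1 / e n) ^ ?n * (?G * gauss ((1 / e n) *\<^sub>R y)))"
        by (simp add: cos_ft_gauss)
    qed
    also have "\<dots> = e n ^ ?n * (\<integral>u. v (e n *\<^sub>R u) * ((1 / e n) ^ ?n * (?G * gauss ((1 / e n) *\<^sub>R (e n *\<^sub>R u)))) \<partial>lborel)"
      using e[of n] by (intro lborel_integral_scale) auto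
    also have "\<dots> = e n ^ ?n * (\<integral>u. ((1 / e n) ^ ?n * ?G) * (v (e n *\<^sub>R u) * gauss u) \<partial>lborel)"
      using e[of n] by (simp add: mult_ac)
    also have "\<dots> = ?G * (\<integral>u. v (e n *\<^sub>R u) * gauss u \<partial>lborel)"
      using e[of n] by (subst integral_mult_right_zero) (simp add: power_divide)
    finally show ?thesis .
  qed
  moreover have "(\<lambda>n. \<integral>u. v (e n *\<^sub>R u) * gauss u \<partial>lborel) \<longlonglongrightarrow> (\<integral>u. v 0 * gauss (u::'a) \<partial>lborel)"
  proof (rule integral_dominated_convergence[where w = "\<lambda>u. C * gauss u"])
    show "AE u in lborel. (\<lambda>n. v (e n *\<^sub>R u) * gauss u) \<longlonglongrightarrow> v 0 * gauss u"
      by (intro AE_I2 tendsto_mult cont0[OF v(1)] tendsto_const)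
    show "AE u in lborel. norm (v (e n *\<^sub>R u) * gauss u) \<le> C * gauss u" for n
      by (intro AE_I2) (simp add: abs_mult abs_of_pos[OF gauss_pos] mult_right_mono C(2) less_imp_le[OF gauss_pos])
  qed (use integrable_gauss in auto)
  moreover have "(\<integral>u. gauss (u::'a) \<partial>lborel) = ?G"
    using cos_ft_gauss[of "0::'a"] by (simp add: cos_ft_def gauss_def)
  ultimately have "(\<lambda>n. ?G * (\<integral>u. v (e n *\<^sub>R u) * gauss u \<partial>lborel)) \<longlonglongrightarrow> (\<integral>x. cos_ft v x \<partial>lborel)"
    "(\<lambda>n. ?G * (\<integral>u. v (e n *\<^sub>R u) * gauss u \<partial>lborel)) \<longlonglongrightarrow> ?G * (v 0 * ?G)"
    by (simp_all add: tendsto_mult_left)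
  from LIMSEQ_unique[OF this] show ?thesis by (simp add: power2_eq_square)
qed

text \<open>Inversion at \<open>a\<close> is inversion at 0 for the symmetrised translate
  \<open>v\<close>, whose transform is \<open>cos (x \<bullet> a) * cos_ft w x\<close>. Only the
  even part of \<open>w\<close> can be recovered.\<close>

lemma cos_ft_inversion:
  fixes w :: "'a::euclidean_space \<Rightarrow> real"
  assumes w: "test_fun UNIV w"
  shows "(\<integral>x. cos (x \<bullet> a) * cos_ft w x \<partial>lborel) = (gauss_mass DIM('a))\<^sup>2 * ((w a + w (- a)) / 2)"
proof -
  from test_fun_support[OF w] obtain R where R: "\<And>x. R < norm x \<Longrightarrow> w x = 0" by blast
  have shift: "continuous_on UNIV (\<lambda>y. w (y + c))" "\<And>y. R + norm c < norm y \<Longrightarrow> w (y + c) = 0" for c :: 'a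
  proof -
    show "continuous_on UNIV (\<lambda>y. w (y + c))"
      by (rule continuous_on_compose2[OF continuous_on_test_fun[OF w, of UNIV]]) (auto intro!: continuous_intros)
    fix y :: 'a assume "R + norm c < norm y"
    then show "w (y + c) = 0" using norm_diff_ineq[of y c] by (intro R) linarith
  qed
  have [measurable]: "w \<in> borel_measurable borel"
    by (rule borel_measurable_continuous_onI[OF continuous_on_test_fun[OF w]])
  have int: "integrable lborel (\<lambda>y. cos (x \<bullet> y) * w (y + c))" for x c
    by (rule integrable_compact_support[where R = "R + norm c"])
      (auto intro!: continuous_intros shift)
  have tr: "(\<integral>y. cos (x \<bullet> y) * w (y + c) \<partial>lborel) = (\<integral>y. cos (x \<bullet> y - x \<bullet> c) * w y \<partial>lborel)" for x c
    using lborel_integral_translate[of "\<lambda>y. cos (x \<bullet> y) * w (y + c)" "- c"] by (simp add: inner_diff_right)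
  define v where "v y = (w (y + a) + w (y + (- a))) / 2" for y
  have cos_v: "cos_ft v x = cos (x \<bullet> a) * cos_ft w x" for x
  proof -
    have "cos_ft v x = ((\<integral>y. cos (x \<bullet> y) * w (y + a) \<partial>lborel) + (\<integral>y. cos (x \<bullet> y) * w (y + (- a)) \<partial>lborel)) / 2"
      using int[of x a] int[of x "- a"] by (simp add: cos_ft_def v_def distrib_left)
    also have "\<dots> = (\<integral>y. cos (x \<bullet> y - x \<bullet> a) * w y + cos (x \<bullet> y - x \<bullet> (- a)) * w y \<partial>lborel) / 2"
      unfolding tr using w
      by (subst Bochner_Integration.integral_add) (auto intro!: integrable_continuous_mult_test_fun continuous_intros)
    also have "\<dots> = (\<integral>y. (2 * cos (x \<bullet> a)) * (cos (x \<bullet> y) * w y) \<partial>lborel) / 2"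
      by (simp add: cos_add cos_diff algebra_simps)
    also have "\<dots> = cos (x \<bullet> a) * cos_ft w x" by (simp add: cos_ft_def)
    finally show ?thesis .
  qed
  have "integrable lborel (\<lambda>x. cos (x \<bullet> a) * cos_ft w x)"
    by (rule integrable_powr_cos_ft[OF w, of 1 _ 1]) (auto intro: order_trans[OF abs_cos_le_one])
  then have "integrable lborel (cos_ft v)" by (simp add: cos_v[abs_def])
  moreover have "continuous_on UNIV v" unfolding v_def[abs_def]
    by (intro continuous_intros shift(1)) auto
  ultimately have "(\<integral>x. cos_ft v x \<partial>lborel) = (gauss_mass DIM('a))\<^sup>2 * v 0"
    by (intro gauss_inversion_at_0[where R = "R + norm a"]) (auto simp: v_def shift(2) shift(2)[of "- a", simplified])
  then show ?thesis by (simp add: cos_v v_def)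
qed

section \<open>Even moments of the Fourier transform\<close>

definition deriv2 :: "'a::euclidean_space \<Rightarrow> ('a \<Rightarrow> real) \<Rightarrow> 'a \<Rightarrow> real" where
  "deriv2 e w = (\<lambda>y. frechet_derivative (\<lambda>y. frechet_derivative w (at y) e) (at y) e)"

lemma test_fun_deriv2_funpow: "test_fun UNIV w \<Longrightarrow> test_fun UNIV ((deriv2 e ^^ j) w)"
  by (induction j) (auto simp: deriv2_def intro: test_fun_deriv)

lemma cos_ft_deriv2_funpow:
  "test_fun UNIV w \<Longrightarrow> cos_ft ((deriv2 e ^^ j) w) x = (-1) ^ j * ((x \<bullet> e) ^ (2 * j) * cos_ft w x)"
  by (induction j) (simp_all add: deriv2_def[of e "(deriv2 e ^^ _) w"] cos_ft_deriv2 test_fun_deriv2_funpow power2_eq_square mult.assoc)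

lemma deriv2_funpow_eq_0:
  assumes U: "open U" and w: "\<And>y. y \<in> U \<Longrightarrow> w y = 0"
  shows "y \<in> U \<Longrightarrow> (deriv2 e ^^ j) w y = 0"
proof (induction j arbitrary: y)
  case 0 then show ?case by (simp add: w)
next
  case (Suc j)
  have d0: "frechet_derivative k (at y) e = 0" if "\<And>y. y \<in> U \<Longrightarrow> k y = 0" "y \<in> U" for k :: "'a \<Rightarrow> real" and y
  proof -
    have "(k has_derivative (\<lambda>_. 0)) (at y)"
      by (rule has_derivative_transform_within_open[where s = U and f = "\<lambda>_. 0"]) (use that U in auto)
    from frechet_derivative_eq[OF this] show ?thesis by simp
  qed
  show ?case using Suc.prems by (simp add: deriv2_def) (intro d0; simp add: Suc.IH[unfolded deriv2_def])
qed

lemma test_fun_punctured_vanishes: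
  assumes "test_fun (- {0}) \<phi>" shows "\<exists>U. open U \<and> 0 \<in> U \<and> (\<forall>y\<in>U. \<phi> y = 0)"
proof (intro exI[of _ "- closure {x. \<phi> x \<noteq> 0}"] conjI ballI)
  show "\<phi> y = 0" if "y \<in> - closure {x. \<phi> x \<noteq> 0}" for y
    using that closure_subset[of "{x. \<phi> x \<noteq> 0}"] by auto
qed (use assms in \<open>auto simp: test_fun_def\<close>)

text \<open>By Fourier inversion the moment is, up to a constant, the value at 0 of a derivative of
  \<open>\<phi>\<close> of order \<open>2 * j\<close>, and \<open>\<phi>\<close> vanishes near
  0.\<close>

lemma moment_cos_ft_eq_0:
  assumes \<phi>: "test_fun (- {0}) (\<phi> :: 'a::euclidean_space \<Rightarrow> real)"
  shows "(\<integral>x. (x \<bullet> e) ^ (2 * j) * cos_ft \<phi> x \<partial>lborel) = 0"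
proof -
  have t: "test_fun UNIV \<phi>" by (rule test_fun_mono[OF \<phi>]) simp
  obtain U where U: "open U" "0 \<in> U" "\<And>y. y \<in> U \<Longrightarrow> \<phi> y = 0"
    using test_fun_punctured_vanishes[OF \<phi>] by auto
  have "(\<integral>x. (-1) ^ j * ((x \<bullet> e) ^ (2 * j) * cos_ft \<phi> x) \<partial>lborel) = 0"
    using cos_ft_inversion[OF test_fun_deriv2_funpow[OF t, of j e], of 0] deriv2_funpow_eq_0[OF U(1,3,2)]
    by (simp add: cos_ft_deriv2_funpow[OF t])
  then show ?thesis by simp
qed

lemma integrable_power_cos_ft:
  fixes w :: "'a::euclidean_space \<Rightarrow> real"
  assumes w: "test_fun UNIV w" and m: "m > 0"
  shows "integrable lborel (\<lambda>x. (x \<bullet> e) ^ m * cos_ft w x)"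
proof (rule integrable_powr_cos_ft[OF w, of "real m" _ "norm e ^ m"])
  fix x :: 'a
  have "\<bar>(x \<bullet> e) ^ m\<bar> \<le> (norm x * norm e) ^ m"
    unfolding power_abs by (intro power_mono Cauchy_Schwarz_ineq2) auto
  also have "\<dots> = norm e ^ m * norm x powr real m"
    using m by (cases "x = 0") (auto simp: power_mult_distrib powr_realpow)
  also have "\<dots> \<le> norm e ^ m * (1 + norm x powr real m)" by (intro mult_left_mono) auto
  finally show "\<bar>(x \<bullet> e) ^ m\<bar> \<le> norm e ^ m * (1 + norm x powr real m)" .
qed (use m in auto)

subsection \<open>Taylor remainders of the cosine\<close>

text \<open>Up to sign, the remainders of the Taylor expansions of cosine and sine at 0, of orders
  \<open>2 k + 2\<close> and \<open>2 k + 3\<close>.\<close>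

primrec cos_rem :: "nat \<Rightarrow> real \<Rightarrow> real" where
  "cos_rem 0 s = 1 - cos s"
| "cos_rem (Suc k) s = s ^ (2 * k + 2) / fact (2 * k + 2) - cos_rem k s"

primrec sin_rem :: "nat \<Rightarrow> real \<Rightarrow> real" where
  "sin_rem 0 s = s - sin s"
| "sin_rem (Suc k) s = s ^ (2 * k + 3) / fact (2 * k + 3) - sin_rem k s"

lemma DERIV_power_fact:
  "((\<lambda>s. s ^ Suc m / fact (Suc m)) has_real_derivative s ^ m / fact m) (at s)"
proof -
  have "((\<lambda>s. s ^ Suc m / fact (Suc m)) has_real_derivative (real (Suc m) * s ^ m) / fact (Suc m)) (at s)"
    by (rule DERIV_cdivide) (use DERIV_pow[of "Suc m" s] in simp)
  moreover have "(real (Suc m) * s ^ m) / fact (Suc m) = s ^ m / fact m"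
    by (simp add: fact_Suc del: of_nat_Suc)
  ultimately show ?thesis by simp
qed

lemma DERIV_sin_rem: "(sin_rem k has_real_derivative cos_rem k s) (at s)"
proof (induction k)
  case 0 show ?case by (auto simp: sin_rem.simps[abs_def] intro!: derivative_eq_intros)
next
  case (Suc k)
  from DERIV_diff[OF DERIV_power_fact[of "2 * k + 2" s] Suc]
  show ?case by (simp add: sin_rem.simps(2)[abs_def] numeral_3_eq_3 del: fact_Suc)
qed

lemma DERIV_cos_rem: "(cos_rem (Suc k) has_real_derivative sin_rem k s) (at s)"
proof (induction k)
  case 0 show ?case by (auto simp: cos_rem.simps[abs_def] fact_2 intro!: derivative_eq_intros)
next
  case (Suc k)
  from DERIV_diff[OF DERIV_power_fact[of "2 * k + 3" s] Suc]
  show ?case by (subst cos_rem.simps(2)[abs_def]) (simp add: numeral_eq_Suc del: fact_Suc cos_rem.simps)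
qed

lemma cos_rem_0 [simp]: "cos_rem k 0 = 0" by (induction k) auto
lemma sin_rem_0 [simp]: "sin_rem k 0 = 0" by (induction k) auto
lemma cos_rem_minus [simp]: "cos_rem k (- s) = cos_rem k s" by (induction k) auto
lemma cos_rem_abs: "cos_rem k \<bar>s\<bar> = cos_rem k s" by (simp add: abs_if)

lemma continuous_on_cos_rem: "continuous_on S (cos_rem k)"
  by (induction k) (auto simp: cos_rem.simps[abs_def] intro!: continuous_intros simp del: fact_Suc)

lemma borel_measurable_cos_rem [measurable]: "cos_rem k \<in> borel_measurable borel"
  by (intro borel_measurable_continuous_onI continuous_on_cos_rem)

lemma nonneg_if_DERIV_nonneg:
  fixes f f' :: "real \<Rightarrow> real"
  assumes "f 0 = 0" "\<And>s. (f has_real_derivative f' s) (at s)" "\<And>s. s \<ge> 0 \<Longrightarrow> f' s \<ge> 0" "s \<ge> 0"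
  shows "f s \<ge> 0"
  using DERIV_nonneg_imp_nondecreasing[of 0 s f] assms by (metis)

text \<open>Every remainder vanishes at 0 and has the preceding one as derivative:
  \<open>sin_rem k\<close> has derivative \<open>cos_rem k\<close>, and
  \<open>cos_rem (Suc k)\<close> has derivative \<open>sin_rem k\<close>.\<close>

lemma rem_nonneg: "s \<ge> 0 \<Longrightarrow> cos_rem k s \<ge> 0 \<and> sin_rem k s \<ge> 0"
proof (induction k arbitrary: s)
  case 0
  have "sin_rem 0 s \<ge> 0"
    by (rule nonneg_if_DERIV_nonneg[OF _ DERIV_sin_rem _ 0]) auto
  then show ?case by simp
next
  case (Suc k)
  have c: "cos_rem (Suc k) s \<ge> 0" if "s \<ge> 0" for s
    by (rule nonneg_if_DERIV_nonneg[OF _ DERIV_cos_rem _ that]) (use Suc.IH in auto)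
  moreover have "sin_rem (Suc k) s \<ge> 0"
    by (rule nonneg_if_DERIV_nonneg[OF _ DERIV_sin_rem _ Suc.prems]) (use c in auto)
  ultimately show ?case using Suc.prems by blast
qed

lemma cos_rem_nonneg: "cos_rem k s \<ge> 0"
  using rem_nonneg[of "\<bar>s\<bar>" k] by (simp add: cos_rem_abs)

lemma power_div_fact_le: "s \<ge> 0 \<Longrightarrow> s ^ m / fact m \<le> (s::real) ^ m"
  by (simp add: divide_le_eq mult_le_cancel_left1 fact_ge_1 not_less)

text \<open>Nonnegativity of the next remainder is exactly the bound by the leading Taylor
  term.\<close>

lemma cos_rem_le_small: "s \<ge> 0 \<Longrightarrow> cos_rem k s \<le> s ^ (2 * k + 2)"
  using cos_rem_nonneg[of "Suc k" s] power_div_fact_le[of s "2 * k + 2"] by simp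

text \<open>For positive \<open>k\<close> this comes from nonnegativity of the preceding remainder;
  the factor 2 covers \<open>1 - cos s\<close> at \<open>k = 0\<close>.\<close>

lemma cos_rem_le_large: "s \<ge> 0 \<Longrightarrow> cos_rem k s \<le> 2 * s ^ (2 * k)"
proof (cases k)
  case 0
  have "1 - cos s \<le> 2" using cos_ge_minus_one[of s] by linarith
  with 0 show ?thesis by simp
next
  case (Suc m)
  assume s: "s \<ge> 0"
  have "s ^ (2 * m + 2) / fact (2 * m + 2) \<le> s ^ (2 * m + 2)" using s by (rule power_div_fact_le)
  moreover have "0 \<le> s ^ (2 * m + 2)" using s by simp
  ultimately show ?thesis using Suc cos_rem_nonneg[of m s] by (simp del: fact_Suc)
qed

text \<open>The remainder is its leading Taylor term minus the next remainder, which is at most the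
  following Taylor term; on the unit interval that term is strictly smaller.\<close>

lemma cos_rem_pos:
  assumes "0 < s" "s < 1" shows "cos_rem k s > 0"
proof -
  let ?m = "2 * k + 2"
  have "cos_rem k s = s ^ ?m / fact ?m - cos_rem (Suc k) s" by simp
  moreover have "cos_rem (Suc k) s \<le> s ^ (?m + 2) / fact (?m + 2)"
    using cos_rem_nonneg[of "Suc (Suc k)" s] by (simp del: fact_Suc cos_rem.simps(2) add: cos_rem.simps(2)[of "Suc k"])
  moreover have "s ^ (?m + 2) / fact (?m + 2) < s ^ ?m / fact ?m"
  proof -
    have "s ^ (?m + 2) < s ^ ?m" using assms by (intro power_strict_decreasing) auto
    then have "s ^ (?m + 2) / fact (?m + 2) < s ^ ?m / fact (?m + 2)" by (intro divide_strict_right_mono) auto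
    also have "\<dots> \<le> s ^ ?m / fact ?m" using assms by (intro divide_left_mono fact_mono) auto
    finally show ?thesis .
  qed
  ultimately show ?thesis by linarith
qed

text \<open>All even moments of \<open>cos_ft \<phi>\<close> vanish, so only the cosine inside the
  remainder contributes, with a sign alternating in \<open>k\<close>, and Fourier inversion
  evaluates it.\<close>

lemma integral_cos_rem_cos_ft:
  assumes \<phi>: "test_fun (- {0}) (\<phi> :: 'a::euclidean_space \<Rightarrow> real)"
  shows "integrable lborel (\<lambda>x. cos_rem k (s * (x \<bullet> e)) * cos_ft \<phi> x) \<and>
    (\<integral>x. cos_rem k (s * (x \<bullet> e)) * cos_ft \<phi> x \<partial>lborel) =
    (-1) ^ (k + 1) * (gauss_mass DIM('a))\<^sup>2 * ((\<phi> (s *\<^sub>R e) + \<phi> (- (s *\<^sub>R e))) / 2)"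
proof (induction k)
  have t: "test_fun UNIV \<phi>" by (rule test_fun_mono[OF \<phi>]) simp
  {
    case 0
    have 1: "integrable lborel (\<lambda>x. cos_ft \<phi> x)"
      using integrable_powr_cos_ft[OF t, of 1 "\<lambda>_. 1" 1] by simp
    have 2: "integrable lborel (\<lambda>x. cos (x \<bullet> (s *\<^sub>R e)) * cos_ft \<phi> x)"
      by (rule integrable_powr_cos_ft[OF t, of 1 _ 1]) (auto intro: order_trans[OF abs_cos_le_one])
    have 3: "(\<integral>x. cos_ft \<phi> x \<partial>lborel) = 0"
      using moment_cos_ft_eq_0[OF \<phi>, of _ 0] by simp
    show ?case
      using Bochner_Integration.integrable_diff[OF 1 2] Bochner_Integration.integral_diff[OF 1 2] 3
        cos_ft_inversion[OF t, of "s *\<^sub>R e"]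
      by (simp add: left_diff_distrib)
  next
    case (Suc k)
    let ?m = "2 * k + 2" and ?a = "s ^ (2 * k + 2) / fact (2 * k + 2)"
    have 1: "integrable lborel (\<lambda>x. ?a * ((x \<bullet> e) ^ ?m * cos_ft \<phi> x))"
      by (intro integrable_mult_right integrable_power_cos_ft t) simp
    have 2: "(\<integral>x. ?a * ((x \<bullet> e) ^ ?m * cos_ft \<phi> x) \<partial>lborel) = 0"
      using moment_cos_ft_eq_0[OF \<phi>, of e "k + 1"] by (simp del: fact_Suc)
    have "(\<lambda>x. cos_rem (Suc k) (s * (x \<bullet> e)) * cos_ft \<phi> x) =
       (\<lambda>x. ?a * ((x \<bullet> e) ^ ?m * cos_ft \<phi> x) - cos_rem k (s * (x \<bullet> e)) * cos_ft \<phi> x)"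
      by (simp add: fun_eq_iff left_diff_distrib power_mult_distrib del: fact_Suc power_Suc)
    then show ?case
      using Bochner_Integration.integrable_diff[OF 1, of "\<lambda>x. cos_rem k (s * (x \<bullet> e)) * cos_ft \<phi> x"]
        Bochner_Integration.integral_diff[OF 1, of "\<lambda>x. cos_rem k (s * (x \<bullet> e)) * cos_ft \<phi> x"] 2 Suc
      by (simp del: fact_Suc cos_rem.simps)
  }
qed

subsection \<open>The Fourier transform of powers of a linear form\<close>

text \<open>The density whose scaling makes a superposition of \<open>F (s * t)\<close> over
  \<open>s\<close> homogeneous of degree \<open>q\<close> in \<open>t > 0\<close>.\<close>

definition power_weight :: "real \<Rightarrow> real \<Rightarrow> real" where
  "power_weight q s = (if s > 0 then s powr (-1 - q) else 0)"

text \<open>Up to a constant, and away from the origin, the Fourier transform of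
  \<open>|x \<bullet> e|\<close> to the power \<open>q\<close> acting on \<open>\<phi>\<close>: a
  measure on the line through \<open>e\<close>, symmetric under reflection.\<close>

definition ray_integral :: "real \<Rightarrow> ('a::real_vector \<Rightarrow> real) \<Rightarrow> 'a \<Rightarrow> real" where
  "ray_integral q \<phi> e = (\<integral>s. power_weight q s * ((\<phi> (s *\<^sub>R e) + \<phi> (- (s *\<^sub>R e))) / 2) \<partial>lborel)"

lemma borel_measurable_power_weight [measurable]: "power_weight q \<in> borel_measurable borel"
  unfolding power_weight_def[abs_def] by measurable

lemma power_weight_nonneg: "power_weight q s \<ge> 0"
  by (simp add: power_weight_def)

text \<open>The remainder is at most \<open>s ^ (2 * k + 2)\<close>, used near 0, and at most
  \<open>2 * s ^ (2 * k)\<close>, used at infinity. Convergence at the two ends accounts for the two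
  strict bounds on \<open>q\<close>.\<close>

lemma integrable_power_weight_cos_rem:
  assumes "2 * real k < q" "q < 2 * real k + 2"
  shows "integrable lborel (\<lambda>s. power_weight q s * cos_rem k s)"
proof (rule Bochner_Integration.integrable_bound)
  let ?f = "\<lambda>s::real. if 0 < s then if s \<le> 1 then s powr (2 * real k + 1 - q) else s powr (2 * real k - 1 - q) else 0"
  show "integrable lborel (\<lambda>s. 2 * ?f s)"
    using assms by (intro integrable_mult_right integrable_powr_split) auto
  have "power_weight q s * cos_rem k s \<le> 2 * ?f s" for s
  proof (cases "s > 0")
    case True
    have pw: "s powr (-1 - q) * s ^ m = s powr (real m - 1 - q)" for m
      using True powr_add[of s "real m" "-1 - q"] by (simp add: powr_realpow algebra_simps)
    have "s powr (-1 - q) * cos_rem k s \<le> s powr (-1 - q) * s ^ (2 * k + 2)"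
      using True by (intro mult_left_mono cos_rem_le_small) auto
    moreover have "s powr (-1 - q) * cos_rem k s \<le> s powr (-1 - q) * (2 * s ^ (2 * k))"
      using True by (intro mult_left_mono cos_rem_le_large) auto
    moreover have "s powr (-1 - q) * s ^ (2 * k + 2) = s powr (2 * real k + 1 - q)"
      by (subst pw) (simp add: algebra_simps)
    moreover have "s powr (-1 - q) * (2 * s ^ (2 * k)) = 2 * s powr (2 * real k - 1 - q)"
      using pw[of "2 * k"] by (simp add: algebra_simps)
    moreover have "0 \<le> s powr (2 * real k + 1 - q)" by simp
    ultimately have "s powr (-1 - q) * cos_rem k s \<le> 2 * s powr (2 * real k + 1 - q)"
      "s powr (-1 - q) * cos_rem k s \<le> 2 * s powr (2 * real k - 1 - q)" by linarith+
    then show ?thesis using True by (simp add: power_weight_def)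
  qed (simp add: power_weight_def)
  then show "AE s in lborel. norm (power_weight q s * cos_rem k s) \<le> norm (2 * ?f s)"
    by (intro AE_I2) (auto simp: abs_mult power_weight_nonneg cos_rem_nonneg)
qed measurable

lemma integral_pos_if_pos_on_interval:
  fixes g :: "real \<Rightarrow> real"
  assumes i: "integrable lborel g" and nn: "\<And>s. g s \<ge> 0" and "a < b"
    and pos: "\<And>s. a < s \<Longrightarrow> s < b \<Longrightarrow> g s > 0"
  shows "(\<integral>s. g s \<partial>lborel) > 0"
proof -
  have "(\<integral>s. g s \<partial>lborel) \<noteq> 0"
  proof
    assume "(\<integral>s. g s \<partial>lborel) = 0"
    then have "AE s in lborel. g s = 0"
      using integral_nonneg_eq_0_iff_AE[OF i] nn by simp
    then have "AE s in lborel. s \<notin> {a<..<b}"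
      by (rule eventually_mono) (use pos in force)
    then have "emeasure lborel {a<..<b} = 0"
      by (subst (asm) AE_iff_measurable[of "{a<..<b}"]) auto
    then show False using \<open>a < b\<close> by simp
  qed
  moreover have "(\<integral>s. g s \<partial>lborel) \<ge> 0" by (intro integral_nonneg_AE AE_I2 nn)
  ultimately show ?thesis by simp
qed

lemma integral_power_weight_cos_rem_pos:
  assumes "2 * real k < q" "q < 2 * real k + 2"
  shows "(\<integral>s. power_weight q s * cos_rem k s \<partial>lborel) > 0"
  by (rule integral_pos_if_pos_on_interval[OF integrable_power_weight_cos_rem[OF assms], of 0 1])
    (auto simp: power_weight_def intro!: mult_nonneg_nonneg mult_pos_pos cos_rem_nonneg cos_rem_pos)

text \<open>The substitution of \<open>s / |t|\<close> for \<open>s\<close>. Evenness of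
  \<open>cos_rem\<close> disposes of the sign of \<open>t\<close>, and at \<open>t = 0\<close> both
  sides vanish.\<close>

lemma power_weight_cos_rem_scale:
  assumes "2 * real k < q" "q < 2 * real k + 2"
  shows "integrable lborel (\<lambda>s. power_weight q s * cos_rem k (s * t))"
    and "(\<integral>s. power_weight q s * cos_rem k (s * t) \<partial>lborel) =
      (\<integral>s. power_weight q s * cos_rem k s \<partial>lborel) * \<bar>t\<bar> powr q"
proof -
  let ?g = "\<lambda>s. power_weight q s * cos_rem k s"
  have g: "power_weight q s * cos_rem k (s * t) = \<bar>t\<bar> powr (q + 1) * ?g (0 + \<bar>t\<bar> * s)" if "t \<noteq> 0" for s
  proof (cases "s > 0")
    case True
    have "\<bar>t\<bar> powr (q + 1) * (\<bar>t\<bar> * s) powr (-1 - q) = s powr (-1 - q)"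
      using that True by (simp add: powr_mult powr_add[symmetric] mult.assoc[symmetric])
    moreover have "cos_rem k (s * t) = cos_rem k (\<bar>t\<bar> * s)"
      using cos_rem_abs[of k "s * t"] True by (simp add: abs_mult mult.commute)
    ultimately show ?thesis using True that by (simp add: power_weight_def mult.assoc[symmetric])
  next
    case False
    then show ?thesis using that by (simp add: power_weight_def zero_less_mult_iff)
  qed
  show "integrable lborel (\<lambda>s. power_weight q s * cos_rem k (s * t))"
  proof (cases "t = 0")
    case False
    then have "integrable lborel (\<lambda>s. ?g (0 + \<bar>t\<bar> * s))"
      using integrable_power_weight_cos_rem[OF assms] by (subst lborel_integrable_real_affine_iff) auto
    then show ?thesis unfolding g[OF False] by (rule integrable_mult_right)
  qed simp
  show "(\<integral>s. power_weight q s * cos_rem k (s * t) \<partial>lborel) = (\<integral>s. ?g s \<partial>lborel) * \<bar>t\<bar> powr q"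
  proof (cases "t = 0")
    case False
    have "(\<integral>s. ?g s \<partial>lborel) = \<bar>t\<bar> * (\<integral>s. ?g (0 + \<bar>t\<bar> * s) \<partial>lborel)"
      using lborel_integral_real_affine[of "\<bar>t\<bar>" ?g 0] False by simp
    then show ?thesis
      unfolding g[OF False] integral_mult_right_zero using False by (simp add: powr_add)
  qed simp
qed

lemma integrable_abs_inner_powr_cos_ft:
  fixes w :: "'a::euclidean_space \<Rightarrow> real"
  assumes w: "test_fun UNIV w" and q: "q > 0"
  shows "integrable lborel (\<lambda>x. \<bar>x \<bullet> e\<bar> powr q * cos_ft w x)"
proof (rule integrable_powr_cos_ft[OF w q, of _ "norm e powr q"])
  fix x :: 'a
  have "\<bar>x \<bullet> e\<bar> powr q \<le> (norm x * norm e) powr q"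
    using q by (intro powr_mono2 Cauchy_Schwarz_ineq2) auto
  also have "\<dots> \<le> norm e powr q * (1 + norm x powr q)" by (simp add: powr_mult algebra_simps)
  finally show "\<bar>\<bar>x \<bullet> e\<bar> powr q\<bar> \<le> norm e powr q * (1 + norm x powr q)" by simp
qed measurable

text \<open>The Fourier transform of \<open>|x \<bullet> e| powr q\<close> is supported on the line spanned by \<open>e\<close>:
  expand \<open>|t| powr q\<close> as a superposition of Taylor remainders of cosines and apply Fourier inversion;
  the Taylor polynomials contribute derivatives of \<open>\<phi>\<close> at 0, which vanish.\<close>

lemma integral_abs_inner_powr_cos_ft_aux:
  fixes \<phi> :: "'a::euclidean_space \<Rightarrow> real"
  assumes \<phi>: "test_fun (- {0}) \<phi>" and q: "q > 0" "2 * real k < q" "q < 2 * real k + 2"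
  shows "(\<integral>s. power_weight q s * cos_rem k s \<partial>lborel) * (\<integral>x. \<bar>x \<bullet> e\<bar> powr q * cos_ft \<phi> x \<partial>lborel) =
    (-1) ^ (k + 1) * (gauss_mass DIM('a))\<^sup>2 * ray_integral q \<phi> e"
proof -
  have t: "test_fun UNIV \<phi>" by (rule test_fun_mono[OF \<phi>]) simp
  have [measurable]: "cos_ft \<phi> \<in> borel_measurable borel" by (rule borel_measurable_cos_ft[OF t])
  let ?D = "\<integral>s. power_weight q s * cos_rem k s \<partial>lborel"
  let ?f = "\<lambda>x s. power_weight q s * cos_rem k (s * (x \<bullet> e)) * cos_ft \<phi> x"
  have i: "integrable lborel (\<lambda>x. \<bar>x \<bullet> e\<bar> powr q * cos_ft \<phi> x)"
    by (rule integrable_abs_inner_powr_cos_ft[OF t q(1)])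
  have inner: "(\<integral>s. ?f x s \<partial>lborel) = ?D * (\<bar>x \<bullet> e\<bar> powr q * cos_ft \<phi> x)" for x
    using power_weight_cos_rem_scale(2)[OF q(2,3), of "x \<bullet> e"] by simp
  \<comment> \<open>Weight and remainder are nonnegative, so the integral of the norm is explicit as
    well; this yields joint integrability for Fubini.\<close>
  have norm_inner: "(\<integral>s. norm (?f x s) \<partial>lborel) = \<bar>?D * (\<bar>x \<bullet> e\<bar> powr q * cos_ft \<phi> x)\<bar>" for x
  proof -
    have "(\<integral>s. norm (?f x s) \<partial>lborel) = (\<integral>s. power_weight q s * cos_rem k (s * (x \<bullet> e)) * \<bar>cos_ft \<phi> x\<bar> \<partial>lborel)"
      by (simp add: abs_mult power_weight_nonneg cos_rem_nonneg)
    also have "\<dots> = ?D * \<bar>x \<bullet> e\<bar> powr q * \<bar>cos_ft \<phi> x\<bar>"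
      using power_weight_cos_rem_scale(2)[OF q(2,3), of "x \<bullet> e"] by simp
    finally show ?thesis using integral_power_weight_cos_rem_pos[OF q(2,3)] by (simp add: abs_mult mult.assoc)
  qed
  have i2: "integrable (lborel \<Otimes>\<^sub>M lborel) (\<lambda>(x, s). ?f x s)"
  proof (rule lborel_pair.Fubini_integrable)
    show "integrable lborel (\<lambda>x. \<integral>s. norm (case (x, s) of (x, s) \<Rightarrow> ?f x s) \<partial>lborel)"
      unfolding prod.case norm_inner by (intro integrable_abs integrable_mult_right i)
    show "AE x in lborel. integrable lborel (\<lambda>s. case (x, s) of (x, s) \<Rightarrow> ?f x s)"
      unfolding prod.case by (intro AE_I2 integrable_mult_left power_weight_cos_rem_scale(1)[OF q(2,3)])
  qed measurable
  have "?D * (\<integral>x. \<bar>x \<bullet> e\<bar> powr q * cos_ft \<phi> x \<partial>lborel) = (\<integral>x. \<integral>s. ?f x s \<partial>lborel \<partial>lborel)"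
    unfolding inner by simp
  also have "\<dots> = (\<integral>s. \<integral>x. ?f x s \<partial>lborel \<partial>lborel)"
    by (rule lborel_pair.Fubini_integral[OF i2, symmetric])
  also have "\<dots> = (\<integral>s. ((-1) ^ (k + 1) * (gauss_mass DIM('a))\<^sup>2) * (power_weight q s * ((\<phi> (s *\<^sub>R e) + \<phi> (- (s *\<^sub>R e))) / 2)) \<partial>lborel)"
  proof (rule Bochner_Integration.integral_cong[OF refl])
    fix s :: real
    have "(\<integral>x. ?f x s \<partial>lborel) = power_weight q s * (\<integral>x. cos_rem k (s * (x \<bullet> e)) * cos_ft \<phi> x \<partial>lborel)"
      unfolding mult.assoc by (rule integral_mult_right_zero)
    then show "(\<integral>x. ?f x s \<partial>lborel) = ((-1) ^ (k + 1) * (gauss_mass DIM('a))\<^sup>2) * (power_weight q s * ((\<phi> (s *\<^sub>R e) + \<phi> (- (s *\<^sub>R e))) / 2))"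
      using integral_cos_rem_cos_ft[OF \<phi>, of k s e] by simp
  qed
  finally show ?thesis unfolding ray_integral_def by (simp only: integral_mult_right_zero)
qed

text \<open>For negative \<open>y\<close> the relation \<open>Gamma (y + 1) = y * Gamma y\<close>
  flips the sign at every unit step to the left.\<close>

lemma Gamma_neg_sign:
  "- real k - 1 < y \<Longrightarrow> y < - real k \<Longrightarrow> (-1) ^ (k + 1) * Gamma y > (0::real)"
proof (induction k arbitrary: y)
  case 0
  have ni: "y \<notin> \<int>\<^sub>\<le>\<^sub>0" using 0 by (auto elim!: nonpos_Ints_cases)
  have "y * Gamma y > 0"
    unfolding Gamma_plus1[OF ni, symmetric] using 0 by (intro Gamma_real_pos) auto
  then show ?case using 0 by (simp add: zero_less_mult_iff)
next
  case (Suc k)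
  have ni: "y \<notin> \<int>\<^sub>\<le>\<^sub>0"
  proof
    assume "y \<in> \<int>\<^sub>\<le>\<^sub>0"
    then obtain n where "y = of_int n" by (auto elim!: nonpos_Ints_cases)
    then have "- int (Suc k) - 1 < n" "n < - int (Suc k)" using Suc.prems by linarith+
    then show False by simp
  qed
  have "(-1) ^ (k + 1) * (y * Gamma y) > 0"
    unfolding Gamma_plus1[OF ni, symmetric] using Suc.prems by (intro Suc.IH) auto
  then have "0 < y * ((-1) ^ (k + 1) * Gamma y)" by (simp add: mult_ac)
  moreover have "y < 0" using Suc.prems by linarith
  ultimately have "(-1) ^ (k + 1) * Gamma y < 0" by (simp only: zero_less_mult_iff) linarith
  then show ?case by simp
qed

text \<open>Only the sign of the constant matters later. For \<open>2 * k < q < 2 * k + 2\<close> it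
  is \<open>(-1) ^ (k + 1)\<close>, which is the sign of \<open>Gamma\<close> on the interval from
  \<open>- k - 1\<close> to \<open>- k\<close> containing \<open>- q / 2\<close>.\<close>

lemma integral_abs_inner_powr_cos_ft:
  assumes q: "q > 0" "\<forall>k::nat. q \<noteq> 2 * (real k + 1)"
  shows "\<exists>c. c / Gamma (- q / 2) > 0 \<and> (\<forall>\<phi> e. test_fun (- {0}) (\<phi> :: 'a::euclidean_space \<Rightarrow> real) \<longrightarrow>
    (\<integral>x. \<bar>x \<bullet> e\<bar> powr q * cos_ft \<phi> x \<partial>lborel) =
      c * ray_integral q \<phi> e)"
proof -
  define k where "k = nat \<lfloor>q / 2\<rfloor>"
  have "real k \<le> q / 2" "q / 2 < real k + 1"
    using q(1) unfolding k_def by linarith+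
  moreover have "q \<noteq> 2 * real k"
    using q by (cases k) (auto simp: add.commute)
  ultimately have k: "2 * real k < q" "q < 2 * real k + 2" by auto
  define D where "D = (\<integral>s. power_weight q s * cos_rem k s \<partial>lborel)"
  define c where "c = (-1) ^ (k + 1) * (gauss_mass DIM('a))\<^sup>2 / D"
  have D: "D > 0" unfolding D_def by (rule integral_power_weight_cos_rem_pos[OF k])
  have G: "(-1) ^ (k + 1) * Gamma (- q / 2) > 0"
    using k by (intro Gamma_neg_sign) auto
  have "c / Gamma (- q / 2) = (gauss_mass DIM('a))\<^sup>2 / D * ((-1) ^ (k + 1) / Gamma (- q / 2))"
    by (simp add: c_def)
  also have "\<dots> > 0"
  proof (rule mult_pos_pos)
    have "(-1) ^ (k + 1) / Gamma (- q / 2) = ((-1) ^ (k + 1) * Gamma (- q / 2)) / (Gamma (- q / 2))\<^sup>2"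
      by (simp add: power2_eq_square)
    also have "\<dots> > 0" using G by (intro divide_pos_pos) auto
    finally show "(-1) ^ (k + 1) / Gamma (- q / 2) > 0" .
  qed (intro divide_pos_pos zero_less_power gauss_mass_pos D)
  finally have "c / Gamma (- q / 2) > 0" .
  moreover have "X = c * Y" if "D * X = (-1) ^ (k + 1) * (gauss_mass DIM('a))\<^sup>2 * Y" for X Y
  proof -
    have "X = (D * X) / D" using D by simp
    then show ?thesis unfolding that c_def by simp
  qed
  ultimately show ?thesis
    using integral_abs_inner_powr_cos_ft_aux[OF _ q(1) k, folded D_def] by blast
qed

subsection \<open>Homogeneous extensions and the sphere\<close>

lemma continuous_on_sphere_normalize:
  fixes h :: "'a::euclidean_space \<Rightarrow> real"
  assumes "continuous_on (sphere 0 1) h"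
  shows "continuous_on (- {0}) (\<lambda>x. h (x /\<^sub>R norm x))"
  by (rule continuous_on_compose2[OF assms]) (auto intro!: continuous_intros simp: field_simps split: if_splits)

lemma measurable_sphere_normalize:
  fixes h :: "'a::euclidean_space \<Rightarrow> real"
  assumes "continuous_on (sphere 0 1) h"
  shows "(\<lambda>x. h (x /\<^sub>R norm x)) \<in> borel_measurable borel"
  by (rule borel_measurable_continuous_countable_exceptions[where X = "{0}"])
    (auto intro: continuous_on_sphere_normalize[OF assms])

lemma bounded_on_sphere:
  fixes h :: "'a::euclidean_space \<Rightarrow> real"
  assumes "continuous_on (sphere 0 1) h"
  shows "\<exists>C\<ge>0. \<forall>x\<in>sphere 0 1. \<bar>h x\<bar> \<le> C"
proof -
  have "bounded (h ` sphere 0 1)"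
    by (intro compact_imp_bounded compact_continuous_image assms compact_sphere)
  then obtain C where "\<forall>x\<in>sphere 0 1. \<bar>h x\<bar> \<le> C" by (auto simp: bounded_iff)
  then have "\<forall>x\<in>sphere 0 1. \<bar>h x\<bar> \<le> max C 0" by (meson max.coboundedI1)
  then show ?thesis by (intro exI[of _ "max C 0"]) auto
qed

lemma normalize_in_sphere: "x \<noteq> 0 \<Longrightarrow> x /\<^sub>R norm x \<in> sphere (0::'a::real_normed_vector) 1"
  by simp

lemma integrable_cone_sphere:
  fixes h :: "'a::euclidean_space \<Rightarrow> real"
  assumes "continuous_on (sphere 0 1) h"
  shows "integrable cone_measure (\<lambda>x. h (x /\<^sub>R norm x))"
proof -
  interpret finite_measure "cone_measure :: 'a measure" by (rule finite_measure_cone_measure)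
  obtain C where C: "\<forall>x\<in>sphere 0 1. \<bar>h x\<bar> \<le> C" using bounded_on_sphere[OF assms] by auto
  have [measurable]: "(\<lambda>x. h (x /\<^sub>R norm x)) \<in> borel_measurable borel"
    by (rule measurable_sphere_normalize[OF assms])
  show ?thesis
  proof (rule integrable_const_bound[where B = C])
    show "AE x in cone_measure. norm (h (x /\<^sub>R norm x)) \<le> C"
      using AE_cone_measure_nonzero by eventually_elim (use C normalize_in_sphere in fastforce)
  qed measurable
qed

lemma sphere_integral_cont:
  fixes h :: "'a::euclidean_space \<Rightarrow> real"
  assumes "continuous_on (sphere 0 1) h"
  shows "sphere_integral h = (\<integral>x. h (x /\<^sub>R norm x) \<partial>cone_measure)"
  by (rule sphere_integral_cone[OF measurable_sphere_normalize[OF assms]])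

text \<open>At \<open>x = 0\<close> the normalised vector is 0, the only value off the sphere;
  changing the integrand at this single point does not affect the integral.\<close>

lemma sphere_integral_cong:
  fixes h k :: "'a::euclidean_space \<Rightarrow> real"
  assumes "\<And>x. x \<in> sphere 0 1 \<Longrightarrow> h x = k x"
  shows "sphere_integral h = sphere_integral k"
proof -
  have "(\<integral>x. indicator (ball 0 1) x *\<^sub>R h (x /\<^sub>R norm x) \<partial>lborel) = (\<integral>x. indicator (ball 0 1) x *\<^sub>R k (x /\<^sub>R norm x) \<partial>lborel)"
  proof -
    define k' where "k' x = (if x = 0 then h 0 else k (x /\<^sub>R norm x))" for x
    have 1: "(\<lambda>x. indicator (ball 0 1) x *\<^sub>R h (x /\<^sub>R norm x)) = (\<lambda>x. indicator (ball 0 1) x *\<^sub>R k' x)"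
      using assms normalize_in_sphere by (auto simp: fun_eq_iff k'_def indicator_def)
    have "(\<integral>x. indicator (ball 0 1) x *\<^sub>R k' x \<partial>lborel) = (\<integral>x. indicator (ball 0 1) x *\<^sub>R k (x /\<^sub>R norm x) \<partial>lborel)"
      by (rule integral_discrete_difference[where X = "{0}"]) (auto simp: k'_def)
    with 1 show ?thesis by simp
  qed
  then show ?thesis unfolding sphere_integral_def set_lebesgue_integral_def by simp
qed

lemma sphere_integral_add:
  fixes h k :: "'a::euclidean_space \<Rightarrow> real"
  assumes "continuous_on (sphere 0 1) h" "continuous_on (sphere 0 1) k"
  shows "sphere_integral (\<lambda>x. h x + k x) = sphere_integral h + sphere_integral k"
  using assms by (simp add: sphere_integral_cont continuous_on_add integrable_cone_sphere)

lemma sphere_integral_cmult: "sphere_integral (\<lambda>x. c * h x) = c * sphere_integral h"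
  unfolding sphere_integral_def by simp

lemma sphere_integral_diff:
  fixes h k :: "'a::euclidean_space \<Rightarrow> real"
  assumes "continuous_on (sphere 0 1) h" "continuous_on (sphere 0 1) k"
  shows "sphere_integral (\<lambda>x. h x - k x) = sphere_integral h - sphere_integral k"
  using sphere_integral_add[of h "\<lambda>x. (-1) * k x"] sphere_integral_cmult[of "-1" k] assms
  by (simp add: continuous_on_minus)

lemma sphere_integral_mono:
  fixes h k :: "'a::euclidean_space \<Rightarrow> real"
  assumes "continuous_on (sphere 0 1) h" "continuous_on (sphere 0 1) k"
    and "\<And>x. x \<in> sphere 0 1 \<Longrightarrow> h x \<le> k x"
  shows "sphere_integral h \<le> sphere_integral k"
  unfolding sphere_integral_cont[OF assms(1)] sphere_integral_cont[OF assms(2)]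
  using AE_cone_measure_nonzero
  by (intro integral_mono_AE integrable_cone_sphere assms) (auto elim!: eventually_mono intro!: assms(3))

lemma Ce_inf_continuous:
  assumes "Ce_inf f" shows "continuous_on (sphere 0 1) f"
proof -
  have "continuous_on (- {0}) (\<lambda>x. f (x /\<^sub>R norm x))"
    using assms unfolding Ce_inf_def
    by (blast intro: continuous_at_imp_continuous_on differentiable_imp_continuous_within Cinf_on_differentiable)
  then have "continuous_on (sphere 0 1) (\<lambda>x. f (x /\<^sub>R norm x))" by (rule continuous_on_subset) auto
  then show ?thesis by (rule continuous_on_eq) auto
qed

section \<open>The sine part and the action of even homogeneous distributions\<close>

lemma lborel_integral_minus:
  fixes f :: "'a::euclidean_space \<Rightarrow> real"
  assumes [measurable]: "f \<in> borel_measurable borel"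
  shows "(\<integral>x. f (- x) \<partial>lborel) = (\<integral>x. f x \<partial>lborel)"
  by (subst (2) lborel_affine[of "-1" 0]) (simp_all add: density_1 integral_distr)

definition sin_ft :: "('a::euclidean_space \<Rightarrow> real) \<Rightarrow> 'a \<Rightarrow> real" where
  "sin_ft w x = (\<integral>y. sin (x \<bullet> y) * w y \<partial>lborel)"

lemma borel_measurable_sin_ft:
  assumes "test_fun UNIV w" shows "sin_ft w \<in> borel_measurable borel"
proof -
  have "\<exists>D. (sin_ft w has_derivative D) (at x)" for x
    unfolding sin_ft_def[abs_def]
    by (intro exI, rule plane_wave_integral_has_derivative[of sin cos w])
      (use assms in \<open>auto intro!: derivative_eq_intros continuous_intros\<close>)
  then show ?thesis
    by (intro borel_measurable_continuous_onI)
      (meson continuous_at_imp_continuous_on has_derivative_continuous)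
qed

lemma inner_mult_sin_ft:
  assumes "test_fun UNIV w"
  shows "(x \<bullet> e) * sin_ft w x = cos_ft (\<lambda>y. frechet_derivative w (at y) e) x"
proof -
  have "(x \<bullet> e) * (\<integral>y. sin (x \<bullet> y) * w y \<partial>lborel) = - (\<integral>y. - cos (x \<bullet> y) * frechet_derivative w (at y) e \<partial>lborel)"
    using assms by (intro plane_wave_integral_by_parts[of "\<lambda>t. - cos t" sin]) (auto intro!: derivative_eq_intros continuous_intros)
  then show ?thesis by (simp add: sin_ft_def cos_ft_def)
qed

lemma abs_sin_ft_le:
  assumes "test_fun UNIV w" shows "\<bar>sin_ft w x\<bar> \<le> (\<integral>y. \<bar>w y\<bar> \<partial>lborel)"
  unfolding sin_ft_def
proof (rule order_trans[OF integral_abs_bound integral_mono])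
  show "\<bar>sin (x \<bullet> y) * w y\<bar> \<le> \<bar>w y\<bar>" for y
    unfolding abs_mult by (intro mult_left_le_one_le) auto
qed (intro integrable_abs integrable_continuous_mult_test_fun integrable_test_fun assms continuous_intros)+

text \<open>The sine transform inherits its decay from cosine transforms: outside the unit ball it
  is the sum over the basis of \<open>(x \<bullet> b) / |x|^2\<close> times \<open>cos_ft\<close> of
  the \<open>b\<close>-derivative of \<open>w\<close>. Inside the ball it is bounded.\<close>

lemma integrable_powr_sin_ft:
  fixes w :: "'a::euclidean_space \<Rightarrow> real"
  assumes w: "test_fun UNIV w" and q: "q > 0"
    and k [measurable]: "k \<in> borel_measurable borel" and bound: "\<And>x. \<bar>k x\<bar> \<le> C * (1 + norm x powr q)"
  shows "integrable lborel (\<lambda>x. k x * sin_ft w x)"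
proof -
  have [measurable]: "sin_ft w \<in> borel_measurable borel" by (rule borel_measurable_sin_ft[OF w])
  have C: "C \<ge> 0" using bound[of 0] by simp
  define near where "near x = (if norm x \<le> 1 then k x * sin_ft w x else 0)" for x
  define kb where "kb b x = (if norm x \<le> 1 then 0 else k x * (x \<bullet> b) / (norm x)\<^sup>2)" for b x :: 'a
  have [measurable]: "near \<in> borel_measurable borel" "kb b \<in> borel_measurable borel" for b
    unfolding near_def[abs_def] kb_def[abs_def] by measurable
  have "integrable lborel near"
  proof (rule Bochner_Integration.integrable_bound)
    let ?M = "C * 2 * (\<integral>y. \<bar>w y\<bar> \<partial>lborel)"
    have "emeasure lborel (cball (0::'a) 1) < \<infinity>" by (rule emeasure_compact_finite) simp
    then show "integrable lborel (\<lambda>x::'a. ?M * indicator (cball 0 1) x)"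
      by (intro integrable_mult_right integrable_real_indicator) auto
    have "\<bar>near x\<bar> \<le> ?M * indicator (cball 0 1) x" for x
    proof (cases "norm x \<le> 1")
      case True
      then have "norm x powr q \<le> 1" using q by (intro powr_le1) auto
      then have "\<bar>k x\<bar> \<le> C * 2" using C by (intro order_trans[OF bound] mult_left_mono) auto
      then have "\<bar>k x * sin_ft w x\<bar> \<le> ?M"
        unfolding abs_mult using C by (intro mult_mono abs_sin_ft_le w) auto
      then show ?thesis using True by (simp add: near_def)
    qed (simp add: near_def)
    then show "AE x in lborel. norm (near x) \<le> norm (?M * indicator (cball 0 1) x)"
      by (intro AE_I2) (metis abs_ge_self order_trans real_norm_def)
  qed measurable
  moreover have "integrable lborel (\<lambda>x. \<Sum>b\<in>Basis. kb b x * cos_ft (\<lambda>y. frechet_derivative w (at y) b) x)"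
  proof (intro Bochner_Integration.integrable_sum integrable_powr_cos_ft[OF test_fun_deriv[OF w] q, of _ C])
    fix b x :: 'a assume b: "b \<in> Basis"
    show "\<bar>kb b x\<bar> \<le> C * (1 + norm x powr q)"
    proof (cases "norm x \<le> 1")
      case False
      have "\<bar>x \<bullet> b\<bar> \<le> norm x" using b by (rule Basis_le_norm)
      also have "\<dots> \<le> (norm x)\<^sup>2" using False by (intro self_le_power) auto
      finally have "\<bar>k x\<bar> * (\<bar>x \<bullet> b\<bar> / (norm x)\<^sup>2) \<le> \<bar>k x\<bar> * 1"
        using False by (intro mult_left_mono) (auto simp: divide_le_eq_1)
      then have "\<bar>kb b x\<bar> \<le> \<bar>k x\<bar>" using False by (simp add: kb_def abs_mult)
      then show ?thesis using bound[of x] by linarith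
    qed (use C in \<open>simp add: kb_def\<close>)
  qed measurable
  ultimately have "integrable lborel (\<lambda>x. near x + (\<Sum>b\<in>Basis. kb b x * cos_ft (\<lambda>y. frechet_derivative w (at y) b) x))"
    by (rule Bochner_Integration.integrable_add)
  moreover have "near x + (\<Sum>b\<in>Basis. kb b x * cos_ft (\<lambda>y. frechet_derivative w (at y) b) x) = k x * sin_ft w x" for x
  proof (cases "norm x \<le> 1")
    case False
    have "(\<Sum>b\<in>Basis. kb b x * cos_ft (\<lambda>y. frechet_derivative w (at y) b) x) =
       (\<Sum>b\<in>Basis. (k x * sin_ft w x / (norm x)\<^sup>2) * ((x \<bullet> b) * (x \<bullet> b)))"
      using False by (intro sum.cong refl) (simp add: kb_def inner_mult_sin_ft[OF w, symmetric])
    also have "\<dots> = (k x * sin_ft w x / (norm x)\<^sup>2) * (norm x)\<^sup>2"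
      unfolding sum_distrib_left[symmetric] power2_norm_eq_inner[of x] by (subst (4) euclidean_inner) simp
    also have "\<dots> = k x * sin_ft w x" using False by auto
    finally show ?thesis using False by (simp add: near_def)
  qed (simp add: near_def kb_def)
  ultimately show ?thesis by simp
qed

lemma fourier_test_eq:
  assumes w: "test_fun UNIV (w :: 'a::euclidean_space \<Rightarrow> real)"
  shows "fourier_test w x = Complex (cos_ft w x) (- sin_ft w x)"
proof -
  from test_fun_support[OF w] obtain R where R: "\<And>x. R < norm x \<Longrightarrow> w x = 0" by blast
  have i: "integrable lborel (\<lambda>y. complex_of_real (w y) * cis (- (x \<bullet> y)))"
    by (rule integrable_compact_support[of _ R])
      (auto simp: R cis_conv_exp intro!: continuous_intros continuous_on_test_fun[OF w])
  show ?thesis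
    unfolding fourier_test_def
    by (rule complex_eqI) (simp_all add: integral_Re[OF i, symmetric] integral_Im[OF i, symmetric] cos_ft_def sin_ft_def mult.commute)
qed

lemma sin_ft_minus: "sin_ft w (- x) = - sin_ft w x"
  by (simp add: sin_ft_def)

text \<open>The \<open>M \<phi>\<close> of the overview, with the Fourier transform reduced to its
  cosine part; for fixed \<open>\<theta>\<close> it is a Mellin transform along the ray.\<close>

definition radial_mellin :: "real \<Rightarrow> ('a::euclidean_space \<Rightarrow> real) \<Rightarrow> 'a \<Rightarrow> real" where
  "radial_mellin q w \<theta> = (\<integral>r. r powr q * cos_ft w (r *\<^sub>R \<theta>) \<partial>radial DIM('a))"

text \<open>The cosine part is evaluated in polar coordinates. The sine part is odd while
  \<open>h\<close> is even, so it integrates to 0; integrability of both parts justifies splitting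
  the complex integral.\<close>

lemma FT_homog_eq:
  fixes h w :: "'a::euclidean_space \<Rightarrow> real"
  assumes w: "test_fun UNIV w" and q: "q > 0" and h: "continuous_on (sphere 0 1) h"
    and even: "\<And>x. x \<in> sphere 0 1 \<Longrightarrow> h (- x) = h x"
  shows "FT_homog h q w = complex_of_real (sphere_integral (\<lambda>\<theta>. h \<theta> * radial_mellin q w \<theta>))"
proof -
  have hm [measurable]: "(\<lambda>x. h (x /\<^sub>R norm x)) \<in> borel_measurable borel"
    by (rule measurable_sphere_normalize[OF h])
  note [measurable] = borel_measurable_cos_ft[OF w] borel_measurable_sin_ft[OF w]
  obtain C where C: "C \<ge> 0" "\<forall>x\<in>sphere 0 1. \<bar>h x\<bar> \<le> C" using bounded_on_sphere[OF h] by auto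
  define k where "k x = norm x powr q * h (x /\<^sub>R norm x)" for x
  have [measurable]: "k \<in> borel_measurable borel" unfolding k_def[abs_def] by measurable
  have k: "\<bar>k x\<bar> \<le> C * (1 + norm x powr q)" for x
  proof (cases "x = 0")
    case False
    then have "\<bar>k x\<bar> \<le> norm x powr q * C"
      unfolding k_def abs_mult using C(2) normalize_in_sphere[OF False] by (intro mult_mono) auto
    also have "\<dots> \<le> C * (1 + norm x powr q)" using C(1) by (simp add: algebra_simps)
    finally show ?thesis .
  qed (use C in \<open>simp add: k_def\<close>)
  have ic: "integrable lborel (\<lambda>x. k x * cos_ft w x)" and isn: "integrable lborel (\<lambda>x. k x * sin_ft w x)"
    using integrable_powr_cos_ft[OF w q _ k] integrable_powr_sin_ft[OF w q _ k] by auto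
  have eq: "complex_of_real (norm x powr q * h (x /\<^sub>R norm x)) * fourier_test w x =
      complex_of_real (k x * cos_ft w x) + \<i> * complex_of_real (- (k x * sin_ft w x))" for x
    unfolding fourier_test_eq[OF w] k_def by (simp add: complex_eq_iff)
  have "(\<integral>x. k (- x) * sin_ft w (- x) \<partial>lborel) = (\<integral>x. k x * sin_ft w x \<partial>lborel)"
    by (rule lborel_integral_minus) measurable
  moreover have "k (- x) * sin_ft w (- x) = - (k x * sin_ft w x)" for x
    using even[OF normalize_in_sphere[of x]] by (cases "x = 0") (auto simp: k_def sin_ft_minus)
  ultimately have odd: "(\<integral>x. k x * sin_ft w x \<partial>lborel) = 0" by simp
  have "FT_homog h q w = complex_of_real (\<integral>x. k x * cos_ft w x \<partial>lborel) + \<i> * complex_of_real (\<integral>x. - (k x * sin_ft w x) \<partial>lborel)"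
  proof -
    have "complex_integrable lborel (\<lambda>x. complex_of_real (k x * cos_ft w x))"
      using ic by (simp only: complex_of_real_integrable_eq)
    moreover have "complex_integrable lborel (\<lambda>x. \<i> * complex_of_real (- (k x * sin_ft w x)))"
      using Bochner_Integration.integrable_minus[OF isn]
      by (intro integrable_mult_right) (simp only: complex_of_real_integrable_eq)
    ultimately show ?thesis
      unfolding FT_homog_def eq by (subst Bochner_Integration.integral_add)
        (simp_all only: integral_mult_right_zero integral_complex_of_real)
  qed
  also have "\<dots> = complex_of_real (\<integral>x. k x * cos_ft w x \<partial>lborel)" using odd by simp
  also have "(\<integral>x. k x * cos_ft w x \<partial>lborel) = sphere_integral (\<lambda>\<theta>. h \<theta> * radial_mellin q w \<theta>)"
    using ic unfolding k_def radial_mellin_def by (intro integral_homogeneous_polar) auto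
  finally show ?thesis .
qed

lemma cosine_transform_radial_mellin:
  fixes w :: "'a::euclidean_space \<Rightarrow> real"
  assumes w: "test_fun UNIV w" and q: "q > 0"
  shows "cosine_transform q (radial_mellin q w) e = (\<integral>x. \<bar>x \<bullet> e\<bar> powr q * cos_ft w x \<partial>lborel)"
proof -
  have eq: "norm x powr q * \<bar>(x /\<^sub>R norm x) \<bullet> e\<bar> powr q = \<bar>x \<bullet> e\<bar> powr q" for x
    by (cases "x = 0") (auto simp: powr_mult[symmetric] abs_mult mult.assoc[symmetric])
  have i: "integrable lborel (\<lambda>x. \<bar>x \<bullet> e\<bar> powr q * cos_ft w x)"
    by (rule integrable_abs_inner_powr_cos_ft[OF w q])
  have "(\<integral>x. norm x powr q * \<bar>(x /\<^sub>R norm x) \<bullet> e\<bar> powr q * cos_ft w x \<partial>lborel) =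
    sphere_integral (\<lambda>\<theta>. \<bar>\<theta> \<bullet> e\<bar> powr q * (\<integral>r. r powr q * cos_ft w (r *\<^sub>R \<theta>) \<partial>radial DIM('a)))"
    by (rule integral_homogeneous_polar, unfold eq) (use i borel_measurable_cos_ft[OF w] in auto)
  then show ?thesis unfolding cosine_transform_def radial_mellin_def eq by simp
qed

lemma continuous_on_cos_integral:
  assumes "integrable M a" and sets: "sets M = sets borel"
  shows "continuous_on UNIV (\<lambda>t::real. \<integral>r. a r * cos (r * t) \<partial>M)"
proof -
  have [measurable_cong]: "sets M = sets borel" by (rule sets)
  have [measurable]: "a \<in> borel_measurable M" using assms(1) by auto
  show ?thesis
    unfolding continuous_on_sequentially comp_def
  proof (intro allI ballI impI, elim conjE)
    fix u :: "nat \<Rightarrow> real" and t assume u: "u \<longlonglongrightarrow> t"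
    show "(\<lambda>n. \<integral>r. a r * cos (r * u n) \<partial>M) \<longlonglongrightarrow> (\<integral>r. a r * cos (r * t) \<partial>M)"
    proof (rule integral_dominated_convergence[where w = "\<lambda>r. \<bar>a r\<bar>"])
      show "AE r in M. (\<lambda>n. a r * cos (r * u n)) \<longlonglongrightarrow> a r * cos (r * t)"
        by (intro AE_I2 tendsto_intros u)
      show "AE r in M. norm (a r * cos (r * u n)) \<le> \<bar>a r\<bar>" for n
        by (intro AE_I2) (simp add: abs_mult mult_left_le)
    qed (use assms(1) in auto)
  qed
qed

text \<open>The weight \<open>r powr q\<close> alone is not integrable, so decay is drawn from
  \<open>cos_ft w\<close> first: applying \<open>bessel_op\<close> repeatedly to \<open>w\<close>
  leaves an integrable weight \<open>a\<close>. Exchanging integrals then gives a plane wave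
  integral with continuous kernel \<open>K\<close>. The identity is obtained on the unit sphere,
  hence the normalisation at the end.\<close>

lemma Ce_inf_radial_mellin:
  fixes w :: "'a::euclidean_space \<Rightarrow> real"
  assumes w: "test_fun UNIV w" and q: "q > 0"
  shows "Ce_inf (radial_mellin q w)"
proof -
  obtain N :: nat where N: "q + real DIM('a) + 1 \<le> 2 * real N"
    using real_arch_simple[of "(q + real DIM('a) + 1) / 2"] by (auto simp: field_simps)
  define a where "a r = r powr q / (1 + r\<^sup>2) ^ N" for r :: real
  define v where "v = (bessel_op ^^ N) w"
  define K where "K t = (\<integral>r. a r * cos (r * t) \<partial>radial DIM('a))" for t
  have a: "integrable (radial DIM('a)) a"
    unfolding a_def[abs_def] using q N by (intro integrable_radial_decay) auto
  have v: "test_fun UNIV v" unfolding v_def by (rule test_fun_bessel_op_funpow[OF w])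
  have K: "continuous_on UNIV K" unfolding K_def by (rule continuous_on_cos_integral[OF a]) simp
  have eq: "radial_mellin q w \<theta> = (\<integral>y. K (\<theta> \<bullet> y) * v y \<partial>lborel)" if \<theta>: "\<theta> \<in> sphere 0 1" for \<theta>
  proof -
    interpret pair_sigma_finite "radial DIM('a)" "lborel :: 'a measure"
      using sigma_finite_radial sigma_finite_lborel by (simp add: pair_sigma_finite_def)
    have i2: "integrable (radial DIM('a) \<Otimes>\<^sub>M lborel) (\<lambda>(r, y). cos (r * (\<theta> \<bullet> y)) * (a r * v y))"
      by (rule integrable_pair_bounded[OF a integrable_test_fun[OF v], where C = 1]) auto
    have "radial_mellin q w \<theta> = (\<integral>r. a r * cos_ft v (r *\<^sub>R \<theta>) \<partial>radial DIM('a))"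
      unfolding radial_mellin_def
    proof (rule Bochner_Integration.integral_cong[OF refl])
      fix r
      have "(norm (r *\<^sub>R \<theta>))\<^sup>2 = r\<^sup>2" using \<theta> by simp
      then show "r powr q * cos_ft w (r *\<^sub>R \<theta>) = a r * cos_ft v (r *\<^sub>R \<theta>)"
        unfolding v_def a_def by (subst cos_ft_eq_bessel_op_funpow[OF w, of _ N]) simp
    qed
    also have "\<dots> = (\<integral>r. \<integral>y. cos (r * (\<theta> \<bullet> y)) * (a r * v y) \<partial>lborel \<partial>radial DIM('a))"
      unfolding cos_ft_def by (simp add: mult_ac flip: integral_mult_right_zero)
    also have "\<dots> = (\<integral>y. \<integral>r. cos (r * (\<theta> \<bullet> y)) * (a r * v y) \<partial>radial DIM('a) \<partial>lborel)"
      by (rule Fubini_integral[OF i2, symmetric])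
    also have "\<dots> = (\<integral>y. K (\<theta> \<bullet> y) * v y \<partial>lborel)"
      unfolding K_def by (simp add: mult_ac flip: integral_mult_right_zero)
    finally show ?thesis .
  qed
  have "Cinf_on (- {0}) (\<lambda>x. \<integral>y. K ((x /\<^sub>R norm x) \<bullet> y) * v y \<partial>lborel)"
    by (rule Cinf_on_normalize[OF Cinf_on_plane_wave_integral[OF K v]])
  then have "Cinf_on (- {0}) (\<lambda>x. radial_mellin q w (x /\<^sub>R norm x))"
    by (rule Cinf_on_cong[rotated]) (auto simp: eq[OF normalize_in_sphere] simp del: inner_scaleR_left)
  moreover have "radial_mellin q w (- \<theta>) = radial_mellin q w \<theta>" for \<theta>
    by (simp add: radial_mellin_def)
  ultimately show ?thesis unfolding Ce_inf_def by blast
qed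

subsection \<open>The cosine transform\<close>

text \<open>Near the origin, where \<open>F\<close> may fail to be smooth, the bump vanishes
  identically; the punctured space and the unit ball cover everything.\<close>

lemma test_fun_shell:
  fixes F :: "'a::euclidean_space \<Rightarrow> real"
  assumes F: "Cinf_on (- {0}) F"
  shows "test_fun (- {0}) (\<lambda>x. shell (norm x) * F x)"
proof -
  let ?\<phi> = "\<lambda>x. shell (norm x) * F x"
  have "Cinf_on (- {0}) ?\<phi>" by (intro Cinf_on_mult Cinf_on_shell F) auto
  moreover have "Cinf_on (ball 0 1) ?\<phi>"
    by (rule Cinf_on_cong[OF open_ball Cinf_on_const[of _ 0]]) (auto simp: shell_eq_0)
  ultimately have "Cinf_on (- {0} \<union> ball 0 1) ?\<phi>" by (rule Cinf_on_Un)
  moreover have "- {0} \<union> ball 0 1 = (UNIV :: 'a set)" by auto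
  ultimately have "Cinf_on UNIV ?\<phi>" by simp
  moreover have sub: "closure {x. ?\<phi> x \<noteq> 0} \<subseteq> cball 0 2 - ball 0 1"
  proof (rule closure_minimal)
    show "{x. ?\<phi> x \<noteq> 0} \<subseteq> cball 0 2 - ball 0 1"
    proof
      fix x assume "x \<in> {x. ?\<phi> x \<noteq> 0}"
      then have "\<not> (norm x \<le> 1 \<or> norm x \<ge> 2)" using shell_eq_0[of "norm x"] by auto
      then show "x \<in> cball 0 2 - ball 0 1" by auto
    qed
  qed (simp add: closed_Diff)
  moreover have "compact (closure {x. ?\<phi> x \<noteq> 0})"
    using sub by (simp add: compact_eq_bounded_closed) (meson bounded_cball bounded_subset Diff_subset)
  ultimately show ?thesis unfolding test_fun_def by auto
qed

lemma shell_integral_pos: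
  fixes \<omega> :: "real \<Rightarrow> real"
  assumes c: "continuous_on {1..2} \<omega>" and pos: "\<And>s. s > 0 \<Longrightarrow> \<omega> s > 0" and 0: "\<And>s. s \<le> 0 \<Longrightarrow> \<omega> s = 0"
  shows "(\<integral>s. \<omega> s * shell s \<partial>lborel) > 0"
proof -
  have eq: "\<omega> s * shell s = indicator {1..2} s *\<^sub>R (\<omega> s * shell s)" for s
  proof (cases "s \<in> {1..2}")
    case False
    then have "s \<le> 0 \<or> shell s = 0" using shell_eq_0[of s] by (metis atLeastAtMost_iff linear)
    with False show ?thesis using 0[of s] by auto
  qed simp
  have i: "integrable lborel (\<lambda>s. \<omega> s * shell s)"
    by (subst eq, rule borel_integrable_compact) (auto intro!: continuous_on_mult c continuous_on_shell)
  have nn: "\<omega> s * shell s \<ge> 0" for s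
    using 0[of s] pos[of s] shell_nonneg[of s] by (cases "s \<le> 0") auto
  show ?thesis
    by (rule integral_pos_if_pos_on_interval[OF i nn, of 1 2]) (auto intro!: mult_pos_pos pos shell_pos)
qed

lemma radial_shell_pos: "(\<integral>r. r powr q * shell r \<partial>radial n) > 0"
proof -
  have [measurable]: "shell \<in> borel_measurable borel"
    by (intro borel_measurable_continuous_onI continuous_on_shell)
  have "(\<integral>r. r powr q * shell r \<partial>radial n) = (\<integral>r. (if 0 < r then r ^ (n - 1) else 0) *\<^sub>R (r powr q * shell r) \<partial>lborel)"
    unfolding radial_def by (rule integral_density) auto
  also have "\<dots> = (\<integral>r. ((if 0 < r then r ^ (n - 1) else 0) * r powr q) * shell r \<partial>lborel)"
    by (simp add: mult.assoc)
  also have "\<dots> > 0"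
  proof (rule shell_integral_pos)
    have "continuous_on {1..2::real} (\<lambda>r. r ^ (n - 1) * r powr q)" by (intro continuous_intros) auto
    then show "continuous_on {1..2} (\<lambda>r. (if 0 < r then r ^ (n - 1) else 0) * r powr q)"
      by (rule continuous_on_eq) auto
  qed auto
  finally show ?thesis .
qed

lemma power_weight_shell_pos: "(\<integral>s. power_weight q s * shell s \<partial>lborel) > 0"
proof (rule shell_integral_pos)
  have "continuous_on {1..2::real} (\<lambda>r. r powr (-1 - q))" by (intro continuous_intros) auto
  then show "continuous_on {1..2} (power_weight q)"
    by (rule continuous_on_eq) (auto simp: power_weight_def)
qed (auto simp: power_weight_def)

lemma continuous_on_cosine_kernel:
  fixes f :: "'a::euclidean_space \<Rightarrow> real"
  assumes "continuous_on (sphere 0 1) f" "q > 0"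
  shows "continuous_on (sphere 0 1) (\<lambda>x. \<bar>x \<bullet> \<xi>\<bar> powr q * f x)"
  using assms by (intro continuous_on_mult continuous_on_powr' continuous_intros) auto

lemma cosine_transform_lincomb:
  fixes f g :: "'a::euclidean_space \<Rightarrow> real"
  assumes "continuous_on (sphere 0 1) f" "continuous_on (sphere 0 1) g" "q > 0"
  shows "cosine_transform q (\<lambda>x. f x - t * g x) \<xi> = cosine_transform q f \<xi> - t * cosine_transform q g \<xi>"
proof -
  have "cosine_transform q (\<lambda>x. f x - t * g x) \<xi> =
      sphere_integral (\<lambda>x. \<bar>x \<bullet> \<xi>\<bar> powr q * f x - t * (\<bar>x \<bullet> \<xi>\<bar> powr q * g x))"
    unfolding cosine_transform_def by (rule sphere_integral_cong) (simp add: algebra_simps)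
  also have "\<dots> = cosine_transform q f \<xi> - sphere_integral (\<lambda>x. t * (\<bar>x \<bullet> \<xi>\<bar> powr q * g x))"
    unfolding cosine_transform_def using assms
    by (intro sphere_integral_diff continuous_on_mult_left continuous_on_cosine_kernel)
  finally show ?thesis by (simp add: sphere_integral_cmult cosine_transform_def)
qed

lemma Ce_inf_lincomb:
  assumes "Ce_inf f" "Ce_inf g" shows "Ce_inf (\<lambda>x. f x - t * g x)"
  using assms unfolding Ce_inf_def by (auto intro!: Cinf_on_diff Cinf_on_cmult)

text \<open>The bump turns the homogeneous extension of \<open>u\<close> into a test function
  \<open>v\<close>. By polar coordinates the plane wave integral of \<open>v\<close> with kernel
  \<open>|t|\<close> to the power \<open>q\<close> is the transform of \<open>u\<close> times the
  positive constant \<open>K\<close>.\<close>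

lemma Ce_inf_cosine_transform:
  fixes u :: "'a::euclidean_space \<Rightarrow> real"
  assumes u: "Ce_inf u" and q: "q > 0"
  shows "Ce_inf (cosine_transform q u)"
proof -
  define v where "v x = shell (norm x) * u (x /\<^sub>R norm x)" for x
  define K where "K = (\<integral>r. r powr q * shell r \<partial>radial DIM('a))"
  have K: "K > 0" unfolding K_def by (rule radial_shell_pos)
  have v: "test_fun UNIV v"
    unfolding v_def[abs_def] using u by (intro test_fun_mono[OF test_fun_shell]) (auto simp: Ce_inf_def)
  have uc: "continuous_on (sphere 0 1) u" by (rule Ce_inf_continuous[OF u])
  have pc: "continuous_on UNIV (\<lambda>t::real. \<bar>t\<bar> powr q)"
    using q by (intro continuous_on_powr' continuous_intros) auto
  have eq: "(\<integral>y. \<bar>\<xi> \<bullet> y\<bar> powr q * v y \<partial>lborel) = K * cosine_transform q u \<xi>" for \<xi>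
  proof -
    have e: "norm y powr q * (\<bar>(y /\<^sub>R norm y) \<bullet> \<xi>\<bar> powr q * u (y /\<^sub>R norm y)) * shell (norm y) = \<bar>\<xi> \<bullet> y\<bar> powr q * v y" for y
    proof (cases "y = 0")
      case False
      have "norm y powr q * \<bar>(y /\<^sub>R norm y) \<bullet> \<xi>\<bar> powr q = \<bar>\<xi> \<bullet> y\<bar> powr q"
        using False by (simp add: powr_mult[symmetric] abs_mult mult.assoc[symmetric] inner_commute)
      then show ?thesis by (simp add: v_def mult_ac)
    qed simp
    have "(\<integral>y. norm y powr q * (\<bar>(y /\<^sub>R norm y) \<bullet> \<xi>\<bar> powr q * u (y /\<^sub>R norm y)) * shell (norm y) \<partial>lborel) =
      sphere_integral (\<lambda>\<theta>. (\<bar>\<theta> \<bullet> \<xi>\<bar> powr q * u \<theta>) * (\<integral>r. r powr q * shell (norm (r *\<^sub>R \<theta>)) \<partial>radial DIM('a)))"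
    proof (rule integral_homogeneous_polar)
      show "integrable lborel (\<lambda>y. norm y powr q * (\<bar>(y /\<^sub>R norm y) \<bullet> \<xi>\<bar> powr q * u (y /\<^sub>R norm y)) * shell (norm y))"
        unfolding e using q
        by (intro integrable_continuous_mult_test_fun[OF v] continuous_on_powr' continuous_intros) auto
      show "(\<lambda>y. \<bar>(y /\<^sub>R norm y) \<bullet> \<xi>\<bar> powr q * u (y /\<^sub>R norm y)) \<in> borel_measurable borel"
        by (rule measurable_sphere_normalize[OF continuous_on_cosine_kernel[OF uc q]])
      show "(\<lambda>y. shell (norm y)) \<in> borel_measurable borel"
        by (intro measurable_compose[OF borel_measurable_norm] borel_measurable_continuous_onI continuous_on_shell)
    qed
    also have "\<dots> = sphere_integral (\<lambda>\<theta>. K * (\<bar>\<theta> \<bullet> \<xi>\<bar> powr q * u \<theta>))"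
    proof (rule sphere_integral_cong)
      fix \<theta> :: 'a assume "\<theta> \<in> sphere 0 1"
      then have "(\<integral>r. r powr q * shell (norm (r *\<^sub>R \<theta>)) \<partial>radial DIM('a)) = K"
        unfolding K_def by (simp add: shell_def)
      then show "(\<bar>\<theta> \<bullet> \<xi>\<bar> powr q * u \<theta>) * (\<integral>r. r powr q * shell (norm (r *\<^sub>R \<theta>)) \<partial>radial DIM('a)) = K * (\<bar>\<theta> \<bullet> \<xi>\<bar> powr q * u \<theta>)"
        by simp
    qed
    finally show ?thesis unfolding e cosine_transform_def by (simp add: sphere_integral_cmult)
  qed
  have "Cinf_on (- {0}) (\<lambda>x. (1 / K) * (\<integral>y. \<bar>(x /\<^sub>R norm x) \<bullet> y\<bar> powr q * v y \<partial>lborel))"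
    by (intro Cinf_on_cmult Cinf_on_normalize[OF Cinf_on_plane_wave_integral[OF pc v]]) auto
  then have "Cinf_on (- {0}) (\<lambda>x. cosine_transform q u (x /\<^sub>R norm x))"
    unfolding eq using K by simp
  moreover have "cosine_transform q u (- \<xi>) = cosine_transform q u \<xi>" for \<xi>
    by (simp add: cosine_transform_def)
  ultimately show ?thesis unfolding Ce_inf_def by blast
qed

lemma cosine_transform_selfadjoint:
  fixes a b :: "'a::euclidean_space \<Rightarrow> real"
  assumes a: "Ce_inf a" and b: "Ce_inf b" and q: "q > 0"
  shows "sphere_integral (\<lambda>x. cosine_transform q a x * b x) = sphere_integral (\<lambda>x. a x * cosine_transform q b x)"
proof -
  interpret finite_measure "cone_measure :: 'a measure" by (rule finite_measure_cone_measure)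
  interpret pair_sigma_finite "cone_measure :: 'a measure" "cone_measure :: 'a measure"
    using sigma_finite_measure_axioms by (simp add: pair_sigma_finite_def)
  let ?n = "\<lambda>x::'a. x /\<^sub>R norm x"
  note cont = a[THEN Ce_inf_continuous] b[THEN Ce_inf_continuous]
    Ce_inf_cosine_transform[OF a q, THEN Ce_inf_continuous] Ce_inf_cosine_transform[OF b q, THEN Ce_inf_continuous]
  have C: "cosine_transform q f \<xi> = (\<integral>y. \<bar>?n y \<bullet> \<xi>\<bar> powr q * f (?n y) \<partial>cone_measure)"
    if "continuous_on (sphere 0 1) f" for f \<xi>
    unfolding cosine_transform_def by (rule sphere_integral_cont[OF continuous_on_cosine_kernel[OF that q]])
  have le: "AE x in cone_measure. AE y in cone_measure. \<bar>\<bar>?n y \<bullet> ?n x\<bar> powr q\<bar> \<le> 1"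
  proof (rule eventually_mono[OF AE_cone_measure_nonzero], rule eventually_mono[OF AE_cone_measure_nonzero])
    fix x y :: 'a assume "x \<noteq> 0" "y \<noteq> 0"
    then have "\<bar>?n y \<bullet> ?n x\<bar> \<le> 1" using Cauchy_Schwarz_ineq2[of "?n y" "?n x"] by simp
    then show "\<bar>\<bar>?n y \<bullet> ?n x\<bar> powr q\<bar> \<le> 1" using q by (simp add: powr_le1)
  qed
  have i: "integrable (cone_measure \<Otimes>\<^sub>M cone_measure) (\<lambda>(x, y). \<bar>?n y \<bullet> ?n x\<bar> powr q * (b (?n x) * a (?n y)))"
    by (rule integrable_pair_bounded[OF integrable_cone_sphere[OF cont(2)] integrable_cone_sphere[OF cont(1)] _ le])
      measurable
  have "sphere_integral (\<lambda>x. cosine_transform q a x * b x) = (\<integral>x. cosine_transform q a (?n x) * b (?n x) \<partial>cone_measure)"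
    by (intro sphere_integral_cont continuous_on_mult cont)
  also have "\<dots> = (\<integral>x. \<integral>y. \<bar>?n y \<bullet> ?n x\<bar> powr q * (b (?n x) * a (?n y)) \<partial>cone_measure \<partial>cone_measure)"
    unfolding C[OF cont(1)] integral_mult_left_zero[symmetric] by (simp only: mult_ac)
  also have "\<dots> = (\<integral>y. \<integral>x. \<bar>?n y \<bullet> ?n x\<bar> powr q * (b (?n x) * a (?n y)) \<partial>cone_measure \<partial>cone_measure)"
    by (rule Fubini_integral[OF i, symmetric])
  also have "\<dots> = (\<integral>y. a (?n y) * cosine_transform q b (?n y) \<partial>cone_measure)"
    unfolding C[OF cont(2)] integral_mult_right_zero[symmetric] by (simp only: mult_ac inner_commute)
  also have "\<dots> = sphere_integral (\<lambda>x. a x * cosine_transform q b x)"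
    by (intro sphere_integral_cont[symmetric] continuous_on_mult cont)
  finally show ?thesis .
qed

text \<open>Pointwise Young inequality with exponents \<open>p / (p - 1)\<close> and
  \<open>p\<close>. The additive form suffices: in both applications the multiple
  \<open>1 - 1 / p\<close> of the integral for \<open>a\<close> is absorbed on the other
  side.\<close>

lemma young_sphere:
  fixes a b :: "'a::euclidean_space \<Rightarrow> real"
  assumes a: "continuous_on (sphere 0 1) a" "\<And>x. x \<in> sphere 0 1 \<Longrightarrow> a x \<ge> 0"
    and b: "continuous_on (sphere 0 1) b" "\<And>x. x \<in> sphere 0 1 \<Longrightarrow> b x \<ge> 0" and p: "p > 1"
  shows "sphere_integral (\<lambda>x. a x powr (p - 1) * b x) \<le>
    (1 - 1 / p) * sphere_integral (\<lambda>x. \<bar>a x\<bar> powr p) + (1 / p) * sphere_integral (\<lambda>x. \<bar>b x\<bar> powr p)"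
proof -
  have c: "continuous_on (sphere 0 1) (\<lambda>x. \<bar>a x\<bar> powr p)" "continuous_on (sphere 0 1) (\<lambda>x. \<bar>b x\<bar> powr p)"
    "continuous_on (sphere 0 1) (\<lambda>x. a x powr (p - 1) * b x)"
    by (intro continuous_on_mult continuous_on_powr' continuous_on_rabs continuous_on_const a(1) b(1);
        use a(2) p in auto)+
  have "sphere_integral (\<lambda>x. a x powr (p - 1) * b x) \<le>
      sphere_integral (\<lambda>x. (1 - 1 / p) * \<bar>a x\<bar> powr p + (1 / p) * \<bar>b x\<bar> powr p)"
  proof (rule sphere_integral_mono)
    fix x :: 'a assume x: "x \<in> sphere 0 1"
    have "a x powr (p - 1) * b x \<le> (a x powr (p - 1)) powr (p / (p - 1)) / (p / (p - 1)) + b x powr p / p"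
      using p x b by (intro Youngs_inequality) (auto simp: field_simps)
    also have "\<dots> = (1 - 1 / p) * \<bar>a x\<bar> powr p + (1 / p) * \<bar>b x\<bar> powr p"
    proof -
      have "(p - 1) * (p / (p - 1)) = p" using p by simp
      then have "(a x powr (p - 1)) powr (p / (p - 1)) = \<bar>a x\<bar> powr p"
        using a(2)[OF x] by (simp add: powr_powr)
      moreover have "y / (p / (p - 1)) = (1 - 1 / p) * y" for y using p by (simp add: field_simps)
      ultimately show ?thesis using b(2)[OF x] by simp
    qed
    finally show "a x powr (p - 1) * b x \<le> (1 - 1 / p) * \<bar>a x\<bar> powr p + (1 / p) * \<bar>b x\<bar> powr p" .
  qed (intro continuous_on_add continuous_on_mult_left c)+
  then show ?thesis
    by (subst (asm) sphere_integral_add) (simp_all only: sphere_integral_cmult c continuous_on_mult_left)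
qed

lemma sphere_integral_powr_self:
  fixes f :: "'a::euclidean_space \<Rightarrow> real"
  assumes "\<And>x. x \<in> sphere 0 1 \<Longrightarrow> f x \<ge> 0"
  shows "sphere_integral (\<lambda>x. f x powr (p - 1) * f x) = sphere_integral (\<lambda>x. \<bar>f x\<bar> powr p)"
proof (rule sphere_integral_cong)
  fix x :: 'a assume "x \<in> sphere 0 1"
  with assms show "f x powr (p - 1) * f x = \<bar>f x\<bar> powr p"
    using powr_add[of "f x" "p - 1" 1] by (cases "f x = 0") (auto simp: less_le)
qed

lemma sphere_integral_nonneg:
  assumes "\<And>x. h x \<ge> 0" shows "sphere_integral h \<ge> 0"
  unfolding sphere_integral_def set_lebesgue_integral_def
  using assms by (intro mult_nonneg_nonneg integral_nonneg_AE AE_I2) auto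

subsection \<open>Comparison\<close>

text \<open>On the ray through \<open>\<xi>\<close> the function \<open>\<phi>\<close> is
  \<open>shell s * w \<xi>\<close>, so the ray integral separates; evenness of \<open>w\<close>
  takes care of the opposite half-line.\<close>

lemma cosine_transform_right_inverse:
  fixes \<phi> w :: "'a::euclidean_space \<Rightarrow> real"
  assumes q: "q > 0"
    and c: "\<And>(\<phi> :: 'a \<Rightarrow> real) e. test_fun (- {0}) \<phi> \<Longrightarrow> (\<integral>x. \<bar>x \<bullet> e\<bar> powr q * cos_ft \<phi> x \<partial>lborel) =
      c * ray_integral q \<phi> e"
    and w: "Ce_inf w" and \<phi>: "\<phi> = (\<lambda>x. shell (norm x) * w (x /\<^sub>R norm x))" and \<xi>: "\<xi> \<in> sphere 0 1"
  shows "cosine_transform q (radial_mellin q \<phi>) \<xi> = c * (\<integral>s. power_weight q s * shell s \<partial>lborel) * w \<xi>"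
proof -
  have t: "test_fun (- {0}) \<phi>" unfolding \<phi> using w by (intro test_fun_shell) (simp add: Ce_inf_def)
  have e: "power_weight q s * ((\<phi> (s *\<^sub>R \<xi>) + \<phi> (- (s *\<^sub>R \<xi>))) / 2) = power_weight q s * shell s * w \<xi>" for s
  proof (cases "s > 0")
    case True
    have "norm (s *\<^sub>R \<xi>) = s" "(s *\<^sub>R \<xi>) /\<^sub>R norm (s *\<^sub>R \<xi>) = \<xi>" using True \<xi> by auto
    moreover have "w (- \<xi>) = w \<xi>" using w \<xi> by (simp add: Ce_inf_def)
    ultimately show ?thesis unfolding \<phi> by (simp del: norm_scaleR scaleR_scaleR add: scaleR_minus_right)
  qed (simp add: power_weight_def)
  show ?thesis
    unfolding cosine_transform_radial_mellin[OF test_fun_mono[OF t subset_UNIV] q] c[OF t] ray_integral_def e by simp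
qed

text \<open>The cosine transform is symmetric and its range contains every smooth even function, hence it
  is injective.\<close>

lemma cosine_transform_injective:
  fixes w h :: "'a::euclidean_space \<Rightarrow> real"
  assumes q: "q > 0" "\<forall>k::nat. q \<noteq> 2 * (real k + 1)"
    and w: "Ce_inf w" and 0: "\<And>\<xi>. \<xi> \<in> sphere 0 1 \<Longrightarrow> cosine_transform q w \<xi> = 0"
    and h: "continuous_on (sphere 0 1) h"
  shows "sphere_integral (\<lambda>x. h x * w x) = 0"
proof -
  obtain c where c: "c / Gamma (- q / 2) > 0" "\<And>(\<phi> :: 'a \<Rightarrow> real) e. test_fun (- {0}) \<phi> \<Longrightarrow>
      (\<integral>x. \<bar>x \<bullet> e\<bar> powr q * cos_ft \<phi> x \<partial>lborel) = c * ray_integral q \<phi> e"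
    using integral_abs_inner_powr_cos_ft[OF q, where 'a = 'a] by blast
  \<comment> \<open>This produces a preimage of a nonzero multiple of \<open>w\<close> itself, so
    that symmetry turns the hypothesis into the vanishing of the integral of \<open>w\<close>
    squared.\<close>
  define \<phi> where "\<phi> = (\<lambda>x. shell (norm x) * w (x /\<^sub>R norm x))"
  define k where "k = c * (\<integral>s. power_weight q s * shell s \<partial>lborel)"
  have k: "k \<noteq> 0" using c(1) power_weight_shell_pos[of q] by (auto simp: k_def)
  have "test_fun (- {0}) \<phi>" unfolding \<phi>_def using w by (intro test_fun_shell) (simp add: Ce_inf_def)
  then have M: "Ce_inf (radial_mellin q \<phi>)"
    by (intro Ce_inf_radial_mellin q test_fun_mono[OF _ subset_UNIV])
  note wc = Ce_inf_continuous[OF w]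
  have "0 = sphere_integral (\<lambda>x. cosine_transform q w x * radial_mellin q \<phi> x)"
    using sphere_integral_cong[of "\<lambda>x. cosine_transform q w x * radial_mellin q \<phi> x" "\<lambda>x. 0 * 1"] 0
      sphere_integral_cmult[of 0 "\<lambda>_::'a. 1"] by simp
  also have "\<dots> = sphere_integral (\<lambda>x. w x * cosine_transform q (radial_mellin q \<phi>) x)"
    by (rule cosine_transform_selfadjoint[OF w M q(1)])
  also have "\<dots> = sphere_integral (\<lambda>x. k * (w x * w x))"
    using cosine_transform_right_inverse[OF q(1) c(2) w \<phi>_def]
    by (intro sphere_integral_cong) (simp add: k_def)
  finally have "sphere_integral (\<lambda>x. w x * w x) = 0" using k by (simp add: sphere_integral_cmult)
  then have "AE x in cone_measure. w (x /\<^sub>R norm x) * w (x /\<^sub>R norm x) = 0"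
    using wc by (subst (asm) sphere_integral_cont)
      (auto intro!: continuous_on_mult simp: integral_nonneg_eq_0_iff_AE[OF integrable_cone_sphere[OF continuous_on_mult[OF wc wc]]])
  then have "(\<integral>x. h (x /\<^sub>R norm x) * w (x /\<^sub>R norm x) \<partial>cone_measure) = 0"
    by (intro integral_eq_zero_AE) auto
  then show ?thesis using h wc by (subst sphere_integral_cont) (auto intro!: continuous_on_mult)
qed

lemma Lp_norm_le_if_FT_positive:
  fixes f g :: "'a::euclidean_space \<Rightarrow> real"
  assumes p: "p > 1" and q: "q > 0" "\<forall>k::nat. q \<noteq> 2 * (real k + 1)"
    and f: "Ce_inf f" "\<And>x. x \<in> sphere 0 1 \<Longrightarrow> 0 \<le> f x"
    and FT: "FT_positive_on (- {0}) (\<lambda>x. f x powr (p - 1) / Gamma (- q / 2)) q"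
    and g: "Ce_inf g" "\<And>x. x \<in> sphere 0 1 \<Longrightarrow> 0 \<le> g x"
    and le: "\<And>\<xi>. \<xi> \<in> sphere 0 1 \<Longrightarrow> cosine_transform q f \<xi> \<le> cosine_transform q g \<xi>"
  shows "Lp_norm_sphere p f \<le> Lp_norm_sphere p g"
proof -
  obtain c where c: "c / Gamma (- q / 2) > 0" "\<And>(\<phi> :: 'a \<Rightarrow> real) e. test_fun (- {0}) \<phi> \<Longrightarrow>
      (\<integral>x. \<bar>x \<bullet> e\<bar> powr q * cos_ft \<phi> x \<partial>lborel) = c * ray_integral q \<phi> e"
    using integral_abs_inner_powr_cos_ft[OF q, where 'a = 'a] by blast
  define I where "I = (\<integral>s. power_weight q s * shell s \<partial>lborel)"
  have I: "I > 0" unfolding I_def by (rule power_weight_shell_pos)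
  let ?h = "\<lambda>x. f x powr (p - 1) / Gamma (- q / 2)"
  note fc = Ce_inf_continuous[OF f(1)] and gc = Ce_inf_continuous[OF g(1)]
  \<comment> \<open>Zeros of \<open>f\<close> are allowed here, and \<open>p > 1\<close> keeps the
    exponent positive, so continuity survives.\<close>
  have fp: "continuous_on (sphere 0 1) (\<lambda>x. f x powr (p - 1))"
    using p f(2) by (intro continuous_on_powr' fc continuous_on_const) auto
  have h: "continuous_on (sphere 0 1) ?h"
    using continuous_on_mult_right[OF fp, of "inverse (Gamma (- q / 2))"] by (simp only: divide_inverse)
  have h_even: "?h (- x) = ?h x" if "x \<in> sphere 0 1" for x
    using f(1) that unfolding Ce_inf_def by metis
  define u where "u = (\<lambda>x. g x - 1 * f x)"
  have u: "Ce_inf u" unfolding u_def by (intro Ce_inf_lincomb f g)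
  have Cu: "cosine_transform q u \<xi> = cosine_transform q g \<xi> - cosine_transform q f \<xi>" for \<xi>
    unfolding u_def using cosine_transform_lincomb[OF gc fc q(1), of 1] by simp
  \<comment> \<open>Nonnegative by the comparison of the cosine transforms, hence admissible in the
    positivity hypothesis.\<close>
  define \<phi> where "\<phi> = (\<lambda>x. shell (norm x) * cosine_transform q u (x /\<^sub>R norm x))"
  let ?M = "radial_mellin q \<phi>"
  have W: "Ce_inf (cosine_transform q u)" by (rule Ce_inf_cosine_transform[OF u q(1)])
  have t: "test_fun (- {0}) \<phi>" unfolding \<phi>_def using W by (intro test_fun_shell) (simp add: Ce_inf_def)
  have t': "test_fun UNIV \<phi>" by (rule test_fun_mono[OF t]) simp
  have \<phi>0: "\<phi> x \<ge> 0" for x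
  proof (cases "x = 0")
    case False
    then show ?thesis unfolding \<phi>_def Cu using le[OF normalize_in_sphere[OF False]] shell_nonneg by simp
  qed (simp add: \<phi>_def shell_eq_0)
  have M: "Ce_inf ?M" by (rule Ce_inf_radial_mellin[OF t' q(1)])
  have CM: "cosine_transform q ?M \<xi> = (c * I) * cosine_transform q u \<xi>" if "\<xi> \<in> sphere 0 1" for \<xi>
    unfolding I_def by (rule cosine_transform_right_inverse[OF q(1) c(2) W \<phi>_def that])
  note Mc = Ce_inf_continuous[OF M] and uc = Ce_inf_continuous[OF u]
  \<comment> \<open>On the sphere \<open>?M\<close> and \<open>(c * I) * u\<close> have the same
    cosine transform, so they may be exchanged under the integral against the merely continuous
    \<open>?h\<close>.\<close>
  have "sphere_integral (\<lambda>x. ?h x * (?M x - (c * I) * u x)) = 0"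
    by (rule cosine_transform_injective[OF q Ce_inf_lincomb[OF M u] _ h])
      (simp add: cosine_transform_lincomb[OF Mc uc q(1)] CM)
  moreover have "sphere_integral (\<lambda>x. ?h x * (?M x - (c * I) * u x)) =
      sphere_integral (\<lambda>x. ?h x * ?M x - (c * I / Gamma (- q / 2)) * (f x powr (p - 1) * u x))"
    by (rule sphere_integral_cong) (simp add: right_diff_distrib diff_divide_distrib mult_ac)
  moreover have "\<dots> = sphere_integral (\<lambda>x. ?h x * ?M x) - (c * I / Gamma (- q / 2)) * sphere_integral (\<lambda>x. f x powr (p - 1) * u x)"
    by (subst sphere_integral_diff) (simp_all only: sphere_integral_cmult continuous_on_mult continuous_on_mult_left h Mc fp uc)
  ultimately have "sphere_integral (\<lambda>x. ?h x * ?M x) = (c * I / Gamma (- q / 2)) * sphere_integral (\<lambda>x. f x powr (p - 1) * u x)"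
    by simp
  moreover have "0 \<le> Re (FT_homog ?h q \<phi>)"
    using FT t \<phi>0 unfolding FT_positive_on_def by blast
  then have "0 \<le> sphere_integral (\<lambda>x. ?h x * ?M x)"
    using FT_homog_eq[OF t' q(1) h h_even] by (simp only: Re_complex_of_real)
  moreover have "c * I / Gamma (- q / 2) > 0" using mult_pos_pos[OF c(1) I] by simp
  ultimately have "0 \<le> sphere_integral (\<lambda>x. f x powr (p - 1) * u x)"
    by (simp only: zero_le_mult_iff) linarith
  also have "\<dots> = sphere_integral (\<lambda>x. f x powr (p - 1) * g x - f x powr (p - 1) * f x)"
    by (rule sphere_integral_cong) (simp add: u_def algebra_simps)
  also have "\<dots> = sphere_integral (\<lambda>x. f x powr (p - 1) * g x) - sphere_integral (\<lambda>x. \<bar>f x\<bar> powr p)"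
    using sphere_integral_powr_self[of f p, OF f(2)]
      sphere_integral_diff[OF continuous_on_mult[OF fp gc] continuous_on_mult[OF fp fc]] by simp
  \<comment> \<open>Young's inequality bounds the mixed integral; absorbing the share
    \<open>1 - 1 / p\<close> leaves the comparison of the integrals of the \<open>p\<close>-th
    powers.\<close>
  finally have "sphere_integral (\<lambda>x. \<bar>f x\<bar> powr p) \<le>
      (1 - 1 / p) * sphere_integral (\<lambda>x. \<bar>f x\<bar> powr p) + (1 / p) * sphere_integral (\<lambda>x. \<bar>g x\<bar> powr p)"
    using young_sphere[OF fc f(2) gc g(2) p] by linarith
  then have "sphere_integral (\<lambda>x. \<bar>f x\<bar> powr p) \<le> sphere_integral (\<lambda>x. \<bar>g x\<bar> powr p)"
    using p by (simp add: field_simps)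
  then show ?thesis
    unfolding Lp_norm_sphere_def using p by (intro powr_mono2 sphere_integral_nonneg) auto
qed

lemma Lp_norm_greater_if_not_FT_positive:
  fixes g :: "'a::euclidean_space \<Rightarrow> real"
  assumes p: "p > 1" and q: "q > 0" "\<forall>k::nat. q \<noteq> 2 * (real k + 1)"
    and g: "Ce_inf g" "\<And>x. x \<in> sphere 0 1 \<Longrightarrow> 0 < g x"
    and FT: "\<not> FT_positive_on (- {0}) (\<lambda>x. g x powr (p - 1) / Gamma (- q / 2)) q"
  shows "\<exists>f :: 'a \<Rightarrow> real. Ce_inf f \<and> (\<forall>x\<in>sphere 0 1. 0 < f x) \<and>
    (\<forall>\<xi>\<in>sphere 0 1. cosine_transform q f \<xi> \<le> cosine_transform q g \<xi>) \<and>
    Lp_norm_sphere p f > Lp_norm_sphere p g"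
proof -
  obtain c where c: "c / Gamma (- q / 2) > 0" "\<And>(\<phi> :: 'a \<Rightarrow> real) e. test_fun (- {0}) \<phi> \<Longrightarrow>
      (\<integral>x. \<bar>x \<bullet> e\<bar> powr q * cos_ft \<phi> x \<partial>lborel) = c * ray_integral q \<phi> e"
    using integral_abs_inner_powr_cos_ft[OF q, where 'a = 'a] by blast
  let ?G = "Gamma (- q / 2)"
  let ?h = "\<lambda>x. g x powr (p - 1) / ?G"
  note gc = Ce_inf_continuous[OF g(1)]
  have gp: "continuous_on (sphere 0 1) (\<lambda>x. g x powr (p - 1))"
    using p g(2) by (intro continuous_on_powr' gc continuous_on_const) (auto simp: less_imp_le)
  have h: "continuous_on (sphere 0 1) ?h"
    using continuous_on_mult_right[OF gp, of "inverse ?G"] by (simp only: divide_inverse)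
  have h_even: "?h (- x) = ?h x" if "x \<in> sphere 0 1" for x
    using g(1) that unfolding Ce_inf_def by metis
  obtain \<phi> where t: "test_fun (- {0}) \<phi>" and \<phi>0: "\<And>x. 0 \<le> \<phi> x"
    and neg: "\<not> (Im (FT_homog ?h q \<phi>) = 0 \<and> 0 \<le> Re (FT_homog ?h q \<phi>))"
    using FT unfolding FT_positive_on_def by blast
  have t': "test_fun UNIV \<phi>" by (rule test_fun_mono[OF t]) simp
  let ?M = "radial_mellin q \<phi>"
  have M: "Ce_inf ?M" by (rule Ce_inf_radial_mellin[OF t' q(1)])
  note Mc = Ce_inf_continuous[OF M]
  \<comment> \<open>Since \<open>?h\<close> is even, the value on a real test function is real, so a
    violation of positivity can only be a negative value.\<close>
  have I: "sphere_integral (\<lambda>x. ?h x * ?M x) < 0"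
  proof -
    have "FT_homog ?h q \<phi> = complex_of_real (sphere_integral (\<lambda>x. ?h x * ?M x))"
      by (rule FT_homog_eq[OF t' q(1) h h_even])
    with neg show ?thesis by (simp only: Im_complex_of_real Re_complex_of_real) linarith
  qed
  \<comment> \<open>\<open>c\<close> and \<open>Gamma (- q / 2)\<close> have the same sign, so
    dividing by \<open>Gamma (- q / 2)\<close> leaves a positive multiple of the ray integral of a
    nonnegative function.\<close>
  have CM: "cosine_transform q ?M \<xi> / ?G \<ge> 0" for \<xi>
  proof -
    let ?J = "ray_integral q \<phi> \<xi>"
    have "?J \<ge> 0"
      unfolding ray_integral_def using \<phi>0 power_weight_nonneg by (intro integral_nonneg_AE AE_I2 mult_nonneg_nonneg) (auto simp: add_nonneg_nonneg)
    then have "c / ?G * ?J \<ge> 0" using c(1) by (intro mult_nonneg_nonneg) (simp_all only: less_imp_le)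
    then show ?thesis unfolding cosine_transform_radial_mellin[OF t' q(1)] c(2)[OF t]
      by (simp only: times_divide_eq_left)
  qed
  have ne: "sphere (0::'a) 1 \<noteq> {}" by simp
  obtain x0 where x0: "x0 \<in> sphere 0 1" "\<And>x. x \<in> sphere 0 1 \<Longrightarrow> g x0 \<le> g x"
    using continuous_attains_inf[OF compact_sphere ne gc] by blast
  have "continuous_on (sphere 0 1) (\<lambda>x. ?M x / ?G)"
    using continuous_on_mult_right[OF Mc, of "inverse ?G"] by (simp only: divide_inverse)
  then obtain C where C: "C \<ge> 0" "\<And>x. x \<in> sphere 0 1 \<Longrightarrow> \<bar>?M x / ?G\<bar> \<le> C"
    using bounded_on_sphere by blast
  \<comment> \<open>Small enough that \<open>e * C < g x0\<close>, where \<open>g x0\<close> is the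
    minimum of \<open>g\<close> on the sphere; \<open>C + 1\<close> avoids division by 0 when
    \<open>C = 0\<close>.\<close>
  define e where "e = g x0 / (2 * (C + 1))"
  have e: "e > 0" using g(2)[OF x0(1)] C(1) by (simp add: e_def)
  define f where "f = (\<lambda>x. g x - (e / ?G) * ?M x)"
  have f: "Ce_inf f" unfolding f_def by (intro Ce_inf_lincomb g M)
  note fc = Ce_inf_continuous[OF f]
  have f_pos: "f x > 0" if x: "x \<in> sphere 0 1" for x
  proof -
    have "e * (?M x / ?G) \<le> e * C"
      using abs_le_D1[OF C(2)[OF x]] e by (intro mult_left_mono) (simp_all only: less_imp_le)
    also have "\<dots> < g x0"
      using C(1) g(2)[OF x0(1)] by (simp add: e_def field_simps) (smt (verit) mult_nonneg_nonneg)
    also have "\<dots> \<le> g x" by (rule x0(2)[OF x])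
    finally show ?thesis by (simp add: f_def)
  qed
  have "cosine_transform q f \<xi> \<le> cosine_transform q g \<xi>" for \<xi>
    unfolding f_def cosine_transform_lincomb[OF gc Mc q(1)]
    using mult_nonneg_nonneg[OF less_imp_le[OF e] CM[of \<xi>]] by simp
  moreover have "Lp_norm_sphere p g < Lp_norm_sphere p f"
  proof -
    \<comment> \<open>The pairing with the power of \<open>g\<close> is linear in \<open>f\<close>,
      so the perturbation gives a strict gain; Young's inequality with \<open>g\<close> as first
      factor passes it on to the norm of \<open>f\<close>.\<close>
    have "sphere_integral (\<lambda>x. g x powr (p - 1) * f x) = sphere_integral (\<lambda>x. g x powr (p - 1) * g x - e * (?h x * ?M x))"
      by (rule sphere_integral_cong) (simp add: f_def algebra_simps)
    also have "\<dots> = sphere_integral (\<lambda>x. g x powr (p - 1) * g x) - e * sphere_integral (\<lambda>x. ?h x * ?M x)"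
      by (subst sphere_integral_diff) (simp_all only: sphere_integral_cmult continuous_on_mult continuous_on_mult_left h Mc gp gc)
    also have "sphere_integral (\<lambda>x. g x powr (p - 1) * g x) = sphere_integral (\<lambda>x. \<bar>g x\<bar> powr p)"
      by (rule sphere_integral_powr_self) (use g(2) in \<open>simp add: less_imp_le\<close>)
    finally have "sphere_integral (\<lambda>x. \<bar>g x\<bar> powr p) < sphere_integral (\<lambda>x. g x powr (p - 1) * f x)"
      using mult_pos_neg[OF e I] by linarith
    also have "\<dots> \<le> (1 - 1 / p) * sphere_integral (\<lambda>x. \<bar>g x\<bar> powr p) + (1 / p) * sphere_integral (\<lambda>x. \<bar>f x\<bar> powr p)"
      using g(2) f_pos by (intro young_sphere gc fc p) (auto simp: less_imp_le)
    finally have "sphere_integral (\<lambda>x. \<bar>g x\<bar> powr p) < sphere_integral (\<lambda>x. \<bar>f x\<bar> powr p)"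
      using p by (simp add: field_simps)
    then show ?thesis
      unfolding Lp_norm_sphere_def using p by (intro powr_less_mono2 sphere_integral_nonneg) auto
  qed
  ultimately show ?thesis using f f_pos by blast
qed

theorem theorem1:
  fixes p q :: real
  assumes "DIM('a::euclidean_space) \<ge> 2" and "p > 1" and "q > 0"
    and "\<forall>k::nat. q \<noteq> 2 * (real k + 1)"
  shows "(\<forall>f g :: 'a \<Rightarrow> real.
            Ce_inf f \<and> (\<forall>x\<in>sphere 0 1. 0 \<le> f x) \<and>
            FT_positive_on (- {0}) (\<lambda>x. f x powr (p - 1) / Gamma (- q / 2)) q \<and>
            Ce_inf g \<and> (\<forall>x\<in>sphere 0 1. 0 \<le> g x) \<and>
            (\<forall>\<xi>\<in>sphere 0 1. cosine_transform q f \<xi> \<le> cosine_transform q g \<xi>)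
            \<longrightarrow> Lp_norm_sphere p f \<le> Lp_norm_sphere p g)
       \<and> (\<forall>g :: 'a \<Rightarrow> real.
            Ce_inf g \<and> (\<forall>x\<in>sphere 0 1. 0 < g x) \<and>
            \<not> FT_positive_on (- {0}) (\<lambda>x. g x powr (p - 1) / Gamma (- q / 2)) q
            \<longrightarrow> (\<exists>f :: 'a \<Rightarrow> real. Ce_inf f \<and> (\<forall>x\<in>sphere 0 1. 0 < f x) \<and>
                  (\<forall>\<xi>\<in>sphere 0 1. cosine_transform q f \<xi> \<le> cosine_transform q g \<xi>) \<and>
                  Lp_norm_sphere p f > Lp_norm_sphere p g))"
proof (intro conjI allI impI; elim conjE)
  fix f g :: "'a \<Rightarrow> real"
  assume "Ce_inf f" "\<forall>x\<in>sphere 0 1. 0 \<le> f x"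
    "FT_positive_on (- {0}) (\<lambda>x. f x powr (p - 1) / Gamma (- q / 2)) q"
    "Ce_inf g" "\<forall>x\<in>sphere 0 1. 0 \<le> g x"
    "\<forall>\<xi>\<in>sphere 0 1. cosine_transform q f \<xi> \<le> cosine_transform q g \<xi>"
  then show "Lp_norm_sphere p f \<le> Lp_norm_sphere p g"
    using Lp_norm_le_if_FT_positive[OF assms(2-4)] by blast
next
  fix g :: "'a \<Rightarrow> real"
  assume "Ce_inf g" "\<forall>x\<in>sphere 0 1. 0 < g x"
    "\<not> FT_positive_on (- {0}) (\<lambda>x. g x powr (p - 1) / Gamma (- q / 2)) q"
  then show "\<exists>f :: 'a \<Rightarrow> real. Ce_inf f \<and> (\<forall>x\<in>sphere 0 1. 0 < f x) \<and>
                  (\<forall>\<xi>\<in>sphere 0 1. cosine_transform q f \<xi> \<le> cosine_transform q g \<xi>) \<and>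
                  Lp_norm_sphere p f > Lp_norm_sphere p g"
    using Lp_norm_greater_if_not_FT_positive[OF assms(2-4)] by blast
qed

end
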